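(* Let $\varphi_\alpha:\mathbb{R}^4\to M'^{\,4}_h(o')$, $(\theta,r)\mapsto(\theta,\alpha(r))$, be a rotationally symmetric, proper biharmonic, conformal diffeomorphism into a $4$-dimensional model. Then there exist constants $c,d>0$ such that one of the following holds: (1) $h(\alpha)=\frac1d\sin(d\alpha)$ (the target is the sphere $S^4(d^2)$ of constant curvature $d^2$) and $\alpha(r)=\frac2d\arctan(c^2r)$, so that $\varphi_\alpha$ is a diffeomorphism from $\mathbb{R}^4$ to $S^4(d^2)\setminus\{\text{south pole}\}$; or (2) $h(\alpha)=\frac1d\sinh(d\alpha)$ (the target is the hyperbolic space $H^4(-d^2)$ of constant curvature $-d^2$) and $\alpha(r)=\frac2d\tanh^{-1}(c^2r)$, $0\le r<\frac1{c^2}$, so that $\varphi_\alpha$ is a diffeomorphism from the open ball $B^4(1/c^2)$ of radius $1/c^2$ in $\mathbb{R}^4$ to $H^4(-d^2)$.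
   Context: Models. An $m$-dimensional model $M_f^m(o)$ with pole $o$ is the Riemannian manifold given in geodesic polar coordinates $(\theta,r)$ around $o$ by $S^{m-1}\times[0,+\infty)$ with metric $f^2(r)\,g_{S^{m-1}}+dr^2$ (with $r=0$ collapsed to the point $o$), where $(S^{m-1},g_{S^{m-1}})$ is the Euclidean unit sphere and $f$ is smooth with $f(0)=0$, $f'(0)=1$, $f(r)>0$ for $r>0$. With a slight abuse of terminology one also admits $f$ defined on a finite interval $[0,b]$ with $f>0$ on $(0,b)$, $f(b)=0$, $f'(b)=-1$. Thus $f(r)=r$ gives $\mathbb{R}^m$; $f(r)=\frac1c\sinh(cr)$ gives the hyperbolic space $H^m(-c^2)$; $f(r)=\frac1d\sin(dr)$, $0\le r\le\pi/d$, gives the sphere $S^m(d^2)$ (the south pole is the point $r=\pi/d$). Rotationally symmetric maps. These are maps $\varphi_\alpha:M_f^m(o)\to M'^{\,m}_h(o')$, $(\theta,r)\mapsto(\theta,\alpha(r))$, with $\alpha$ smooth, $\alpha(r)>0$ for $r>0$, and $\alpha(0)=0$. Such a map is allowed to be defined only on a geodesic ball centred at $o$ (here, a ball centred at the origin of $\mathbb{R}^4$), with its maximal interval of definition in $r$, and a diffeomorphism is understood onto its image. Conformality of $\varphi_\alpha$, together with $\alpha(0)=0$, means $\dot\alpha=h(\alpha)/f(r)$; here $f(r)=r$. Harmonic and biharmonic. For a smooth map $\varphi:(M,g)\to(N,h)$ of Riemannian manifolds the tension field is $\tau(\varphi)=\operatorname{trace}\nabla d\varphi$; $\varphi$ is harmonic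 if $\tau(\varphi)=0$. It is biharmonic if it is a critical point of the bienergy $E_2(\varphi)=\frac12\int_M|\tau(\varphi)|^2dv_g$ (tested over compact domains, with variations fixed outside the interior of the domain), and proper biharmonic if it is biharmonic but not harmonic. *)

theory Defs
  imports "HOL-Analysis.Analysis"
begin

section \<open>Smooth maps\<close>

text \<open>For open \<open>S\<close>; \<open>Ck_on k S f\<close> says that \<open>f\<close> is \<open>k\<close> times continuously differentiable on \<open>S\<close>.\<close>

fun Ck_on :: "nat \<Rightarrow> 'a::real_normed_vector set \<Rightarrow> ('a \<Rightarrow> 'b::real_normed_vector) \<Rightarrow> bool" where
  "Ck_on 0 S f \<longleftrightarrow> continuous_on S f"
| "Ck_on (Suc k) S f \<longleftrightarrow>
     (\<forall>x\<in>S. f differentiable (at x)) \<and>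
     (\<forall>v. Ck_on k S (\<lambda>x. frechet_derivative f (at x) v))"

definition smooth_on :: "'a::real_normed_vector set \<Rightarrow> ('a \<Rightarrow> 'b::real_normed_vector) \<Rightarrow> bool" where
  "smooth_on S f \<longleftrightarrow> (\<forall>k. Ck_on k S f)"

text \<open>Smoothness of a real function on an interval, with one-sided derivatives at those
  endpoints that belong to it.\<close>

definition smooth_on_interval :: "real set \<Rightarrow> (real \<Rightarrow> real) \<Rightarrow> bool" where
  "smooth_on_interval I f \<longleftrightarrow>
     (\<exists>D. D 0 = f \<and>
        (\<forall>n. \<forall>x\<in>I. (D n has_real_derivative D (Suc n) x) (at x within I)))"

definition diffeomorphism ::
  "'a::real_normed_vector set \<Rightarrow> 'b::real_normed_vector set \<Rightarrow> ('a \<Rightarrow> 'b) \<Rightarrow> bool" where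
  "diffeomorphism U W \<phi> \<longleftrightarrow>
     open U \<and> open W \<and> bij_betw \<phi> U W \<and> smooth_on U \<phi> \<and> smooth_on W (inv_into U \<phi>)"


section \<open>Riemannian geometry on open subsets of Euclidean space\<close>

text \<open>A Riemannian metric is given as \<open>g x v w\<close>: the inner product, in the tangent space at \<open>x\<close>,
  of \<open>v\<close> and \<open>w\<close>.\<close>

type_synonym 'n metric = "real^'n \<Rightarrow> real^'n \<Rightarrow> real^'n \<Rightarrow> real"

definition flat_metric :: "'n::finite metric" where
  "flat_metric x v w = v \<bullet> w"

definition gram :: "'n::finite metric \<Rightarrow> real^'n \<Rightarrow> real^'n^'n" where
  "gram g x = (\<chi> i j. g x (axis i 1) (axis j 1))"

definition partial :: "'n::finite \<Rightarrow> (real^'n \<Rightarrow> real) \<Rightarrow> real^'n \<Rightarrow> real" where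
  "partial i F x = frechet_derivative F (at x) (axis i 1)"

text \<open>\<open>christoffel g x k i j\<close> is the symbol with upper index \<open>k\<close> and lower indices \<open>i\<close>, \<open>j\<close>.\<close>

definition christoffel :: "'n::finite metric \<Rightarrow> real^'n \<Rightarrow> 'n \<Rightarrow> 'n \<Rightarrow> 'n \<Rightarrow> real" where
  "christoffel g x k i j =
     (1/2) * (\<Sum>l\<in>UNIV. matrix_inv (gram g x) $ k $ l *
        (partial i (\<lambda>y. gram g y $ j $ l) x + partial j (\<lambda>y. gram g y $ i $ l) x
           - partial l (\<lambda>y. gram g y $ i $ j) x))"

text \<open>The components of \<open>\<nabla>d\<phi>\<close> for \<open>\<phi>\<close> from a domain with metric \<open>g\<close> to a target with metric \<open>h\<close>.\<close>

definition nabla_d ::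
  "'m::finite metric \<Rightarrow> 'n::finite metric \<Rightarrow> (real^'m \<Rightarrow> real^'n) \<Rightarrow> real^'m \<Rightarrow> 'm \<Rightarrow> 'm \<Rightarrow> real^'n" where
  "nabla_d g h \<phi> x i j =
     (\<chi> k. partial i (partial j (\<lambda>y. \<phi> y $ k)) x
        - (\<Sum>l\<in>UNIV. christoffel g x l i j * partial l (\<lambda>y. \<phi> y $ k) x)
        + (\<Sum>p\<in>UNIV. \<Sum>q\<in>UNIV. christoffel h (\<phi> x) k p q
             * partial i (\<lambda>y. \<phi> y $ p) x * partial j (\<lambda>y. \<phi> y $ q) x))"

definition tension ::
  "'m::finite metric \<Rightarrow> 'n::finite metric \<Rightarrow> (real^'m \<Rightarrow> real^'n) \<Rightarrow> real^'m \<Rightarrow> real^'n" where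
  "tension g h \<phi> x =
     (\<Sum>i\<in>UNIV. \<Sum>j\<in>UNIV. matrix_inv (gram g x) $ i $ j *\<^sub>R nabla_d g h \<phi> x i j)"

definition bienergy ::
  "'m::finite metric \<Rightarrow> 'n::finite metric \<Rightarrow> (real^'m) set \<Rightarrow> (real^'m \<Rightarrow> real^'n) \<Rightarrow> real" where
  "bienergy g h D \<phi> =
     (1/2) * (LINT x:D|lborel.
        h (\<phi> x) (tension g h \<phi> x) (tension g h \<phi> x) * sqrt (det (gram g x)))"

definition harmonic ::
  "(real^'m) set \<Rightarrow> 'm::finite metric \<Rightarrow> (real^'n) set \<Rightarrow> 'n::finite metric
     \<Rightarrow> (real^'m \<Rightarrow> real^'n) \<Rightarrow> bool" where
  "harmonic U g V h \<phi> \<longleftrightarrow>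
     smooth_on U \<phi> \<and> \<phi> ` U \<subseteq> V \<and> (\<forall>x\<in>U. tension g h \<phi> x = 0)"

text \<open>Variations \<open>\<Phi> t\<close>, \<open>\<bar>t\<bar> < \<epsilon>\<close>, of \<open>\<phi>\<close> that are fixed outside the interior of \<open>D\<close>.\<close>

definition variation ::
  "(real^'m) set \<Rightarrow> (real^'n) set \<Rightarrow> (real^'m) set \<Rightarrow> (real^'m \<Rightarrow> real^'n)
     \<Rightarrow> real \<Rightarrow> (real \<Rightarrow> real^'m \<Rightarrow> real^'n) \<Rightarrow> bool" where
  "variation U V D \<phi> \<epsilon> \<Phi> \<longleftrightarrow>
     0 < \<epsilon> \<and>
     smooth_on ({-\<epsilon><..<\<epsilon>} \<times> U) (\<lambda>(t, x). \<Phi> t x) \<and>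
     (\<forall>t\<in>{-\<epsilon><..<\<epsilon>}. \<Phi> t ` U \<subseteq> V) \<and>
     (\<forall>x\<in>U. \<Phi> 0 x = \<phi> x) \<and>
     (\<forall>t\<in>{-\<epsilon><..<\<epsilon>}. \<forall>x\<in>U - interior D. \<Phi> t x = \<phi> x)"

definition biharmonic ::
  "(real^'m) set \<Rightarrow> 'm::finite metric \<Rightarrow> (real^'n) set \<Rightarrow> 'n::finite metric
     \<Rightarrow> (real^'m \<Rightarrow> real^'n) \<Rightarrow> bool" where
  "biharmonic U g V h \<phi> \<longleftrightarrow>
     smooth_on U \<phi> \<and> \<phi> ` U \<subseteq> V \<and>
     (\<forall>D \<epsilon> \<Phi>. compact D \<and> D \<subseteq> U \<and> variation U V D \<phi> \<epsilon> \<Phi> \<longrightarrow>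
        ((\<lambda>t. bienergy g h D (\<Phi> t)) has_real_derivative 0) (at 0))"

definition proper_biharmonic ::
  "(real^'m) set \<Rightarrow> 'm::finite metric \<Rightarrow> (real^'n) set \<Rightarrow> 'n::finite metric
     \<Rightarrow> (real^'m \<Rightarrow> real^'n) \<Rightarrow> bool" where
  "proper_biharmonic U g V h \<phi> \<longleftrightarrow> biharmonic U g V h \<phi> \<and> \<not> harmonic U g V h \<phi>"

definition conformal ::
  "(real^'m) set \<Rightarrow> 'm::finite metric \<Rightarrow> (real^'n) set \<Rightarrow> 'n::finite metric
     \<Rightarrow> (real^'m \<Rightarrow> real^'n) \<Rightarrow> bool" where
  "conformal U g V h \<phi> \<longleftrightarrow>
     \<phi> ` U \<subseteq> V \<and> (\<forall>x\<in>U. \<phi> differentiable (at x)) \<and>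
     (\<exists>\<rho>. (\<forall>x\<in>U. 0 < \<rho> x) \<and>
        (\<forall>x\<in>U. \<forall>v w. h (\<phi> x) (frechet_derivative \<phi> (at x) v) (frechet_derivative \<phi> (at x) w)
                       = (\<rho> x)\<^sup>2 * g x v w))"


section \<open>Models and rotationally symmetric maps\<close>

text \<open>\<open>model b f\<close>: \<open>f\<close> is the warping function of a model, defined on \<open>[0, b]\<close> if \<open>b\<close> is finite and
  on \<open>[0, \<infinity>)\<close> if \<open>b = \<infinity>\<close>. Values of \<open>f\<close> outside this interval are irrelevant.\<close>

definition model_interval :: "ereal \<Rightarrow> real set" where
  "model_interval b = {r. 0 \<le> r \<and> ereal r \<le> b}"

definition model :: "ereal \<Rightarrow> (real \<Rightarrow> real) \<Rightarrow> bool" where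
  "model b f \<longleftrightarrow>
     0 < b \<and>
     smooth_on_interval (model_interval b) f \<and>
     f 0 = 0 \<and> (f has_real_derivative 1) (at 0 within model_interval b) \<and>
     (\<forall>r. 0 < r \<and> ereal r < b \<longrightarrow> 0 < f r) \<and>
     (\<forall>\<beta>. b = ereal \<beta> \<longrightarrow>
        f \<beta> = 0 \<and> (f has_real_derivative -1) (at \<beta> within model_interval b))"

text \<open>Geodesic polar coordinates \<open>(\<theta>, r)\<close> are written as \<open>x = r *\<^sub>R \<theta>\<close>. With respect to the pole,
  \<open>geodesic_ball R\<close> is the ball of radius \<open>R\<close>, and \<open>geodesic_ball b\<close> is the whole model if
  \<open>b = \<infinity>\<close> and the model without its south pole if \<open>b\<close> is finite. The south pole needs no chart
  here: its preimage under a rotationally symmetric map is a union of spheres of positive radius,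
  so a rotationally symmetric map that is injective does not meet it, and a variation that is
  fixed outside a compact set does not meet it for small times.\<close>

definition geodesic_ball :: "ereal \<Rightarrow> (real^'n::finite) set" where
  "geodesic_ball R = {x. ereal (norm x) < R}"

text \<open>The metric \<open>f\<^sup>2 g\<^sub>S + dr\<^sup>2\<close> in the coordinate \<open>x\<close>; \<open>dr\<close> and \<open>d_theta\<close> are the differentials of
  \<open>x \<mapsto> norm x\<close> and \<open>x \<mapsto> x /\<^sub>R norm x\<close>. At the pole it extends to the Euclidean inner product,
  because \<open>f' 0 = 1\<close>.\<close>

definition dr :: "real^'n::finite \<Rightarrow> real^'n \<Rightarrow> real" where
  "dr x v = (x /\<^sub>R norm x) \<bullet> v"

definition d_theta :: "real^'n::finite \<Rightarrow> real^'n \<Rightarrow> real^'n" where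
  "d_theta x v = (v - dr x v *\<^sub>R (x /\<^sub>R norm x)) /\<^sub>R norm x"

definition model_metric :: "(real \<Rightarrow> real) \<Rightarrow> 'n::finite metric" where
  "model_metric f x v w =
     (if x = 0 then v \<bullet> w
      else (f (norm x))\<^sup>2 * (d_theta x v \<bullet> d_theta x w) + dr x v * dr x w)"

definition rot_map :: "(real \<Rightarrow> real) \<Rightarrow> real^'n::finite \<Rightarrow> real^'n" where
  "rot_map \<alpha> x = \<alpha> (norm x) *\<^sub>R (x /\<^sub>R norm x)"

lemma rot_map_polar:
  assumes "norm \<theta> = 1" "0 \<le> r" "\<alpha> 0 = 0"
  shows "rot_map \<alpha> (r *\<^sub>R \<theta>) = \<alpha> r *\<^sub>R \<theta>"
  using assms by (cases "r = 0") (auto simp: rot_map_def)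

lemma model_metric_flat: "model_metric (\<lambda>r. r) = flat_metric"
proof (intro ext)
  fix x v w :: "real^'n"
  show "model_metric (\<lambda>r. r) x v w = flat_metric x v w"
  proof (cases "x = 0")
    case False
    define u where "u = x /\<^sub>R norm x"
    have u: "u \<bullet> u = 1"
      using False by (simp add: u_def dot_square_norm power2_eq_square)
    have n: "norm x \<noteq> 0"
      using False by simp
    have "(norm x)\<^sup>2 * (d_theta x v \<bullet> d_theta x w)
            = (v - (u \<bullet> v) *\<^sub>R u) \<bullet> (w - (u \<bullet> w) *\<^sub>R u)"
      using n by (simp add: d_theta_def dr_def u_def[symmetric] power2_eq_square) (simp add: field_simps)
    also have "\<dots> = v \<bullet> w - (u \<bullet> v) * (u \<bullet> w)"
      using u by (simp add: inner_diff_left inner_diff_right inner_commute algebra_simps)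
    finally show ?thesis
      using False
      by (simp add: model_metric_def flat_metric_def dr_def u_def[symmetric])
  qed (simp add: model_metric_def flat_metric_def)
qed

text \<open>\<open>\<alpha>\<close> is the profile of a rotationally symmetric map from the ball of radius \<open>R\<close> into a model
  whose radial variable ranges over \<open>model_interval b\<close>.\<close>

definition rotationally_symmetric :: "ereal \<Rightarrow> ereal \<Rightarrow> (real \<Rightarrow> real) \<Rightarrow> bool" where
  "rotationally_symmetric R b \<alpha> \<longleftrightarrow>
     0 < R \<and>
     smooth_on_interval {r. 0 \<le> r \<and> ereal r < R} \<alpha> \<and>
     \<alpha> 0 = 0 \<and>
     (\<forall>r. 0 < r \<and> ereal r < R \<longrightarrow> 0 < \<alpha> r) \<and>
     (\<forall>r. 0 \<le> r \<and> ereal r < R \<longrightarrow> \<alpha> r \<in> model_interval b)"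

end

theory Submission
  imports Defs
begin

text \<open>
  Conformality turns the profile into a solution of the first-order equation
  \<open>r \<alpha>'(r) = h(\<alpha>(r))\<close> (\<open>profile_ode\<close>). In dimension \<open>m\<close> a rotationally symmetric map with profile
  \<open>\<beta>\<close> has a radial tension field of size \<open>\<beta>'' + (m - 1) (\<beta>'/r - h(\<beta>) h'(\<beta>)/r\<^sup>2)\<close>
  (\<open>tension_rot_map\<close>); for \<open>m = 4\<close> and a conformal profile this is \<open>2 h(\<alpha>) (1 - h'(\<alpha>))/r\<^sup>2\<close>.

  Biharmonicity is used only for variations through rotationally symmetric maps: the profile is
  replaced by \<open>\<alpha> + t \<eta>\<close>, with \<open>\<eta>\<close> supported in \<open>[p, q]\<close>. In polar coordinates the bienergy is a
  one-dimensional integral. Its derivative at \<open>t = 0\<close>, after two integrations by parts, yields a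
  third-order equation for \<open>\<alpha>\<close>. By \<open>r \<alpha>' = h(\<alpha>)\<close> every derivative of \<open>\<alpha>\<close> is an expression in the
  derivatives of \<open>h\<close> at \<open>\<alpha>\<close>, and the equation becomes the autonomous equation
  \<open>h G'' = 2 h' (G' - 1)\<close> with \<open>G = h h'\<close> (\<open>biharmonic_profile_third_order_ode\<close>). It holds on the
  range of \<open>\<alpha>\<close>.

  Maximality of the interval of definition makes this range the whole of \<open>[0, b)\<close>: the equation
  \<open>r \<alpha>' = h(\<alpha>)\<close> says that \<open>ln r\<close> is an antiderivative of \<open>1/h\<close> evaluated at \<open>\<alpha>\<close>, so a profile that
  stays below a value less than \<open>b\<close> reaches its supremum at a finite radius, where \<open>h\<close> is still
  positive, and can be continued (\<open>bounded_profile_extends\<close>, \<open>maximal_profile_onto\<close>).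

  The autonomous equation integrates twice: \<open>(G' - 1)/h\<^sup>2\<close> is constant, hence so is
  \<open>h\<^sup>2 (h'\<^sup>2 - 1 - \<kappa> h\<^sup>2)\<close>, and with \<open>h(0) = 0\<close> one gets \<open>h'' = \<kappa> h\<close>. So \<open>h\<close> is a sine, a hyperbolic
  sine or the identity, according to the sign of \<open>\<kappa>\<close> (\<open>warping_function_cases\<close>). In the first two
  cases \<open>tan (d \<alpha>/2)/r\<close> and \<open>tanh (d \<alpha>/2)/r\<close> are constant, and surjectivity onto \<open>[0, b)\<close> determines
  the radius \<open>R\<close>. In the third case the target is Euclidean and the map is a dilation, which is
  harmonic, contrary to properness.
\<close>

section \<open>Closure properties of smooth maps\<close>

lemma frechet_derivative_cong_open:
  assumes "open S" "x \<in> S" "\<And>y. y \<in> S \<Longrightarrow> f y = g y"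
  shows "frechet_derivative f (at x) = frechet_derivative g (at x)"
    and "f differentiable (at x) \<longleftrightarrow> g differentiable (at x)"
proof -
  have "(f has_derivative D) (at x) \<longleftrightarrow> (g has_derivative D) (at x)" for D
    using has_derivative_transform_within_open[of f D x UNIV S g]
      has_derivative_transform_within_open[of g D x UNIV S f] assms by auto
  then show "frechet_derivative f (at x) = frechet_derivative g (at x)"
    and "f differentiable (at x) \<longleftrightarrow> g differentiable (at x)"
    by (simp_all add: frechet_derivative_def differentiable_def)
qed

lemma Ck_on_cong:
  assumes "open S" "\<And>x. x \<in> S \<Longrightarrow> f x = g x"
  shows "Ck_on k S f \<longleftrightarrow> Ck_on k S g"
  using assms(2)
proof (induction k arbitrary: f g)
  case 0
  then show ?case by (simp cong: continuous_on_cong)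
next
  case (Suc k)
  have "Ck_on k S (\<lambda>x. frechet_derivative f (at x) v) \<longleftrightarrow>
        Ck_on k S (\<lambda>x. frechet_derivative g (at x) v)" for v
    by (rule Suc.IH) (use frechet_derivative_cong_open(1)[OF assms(1)] Suc.prems in metis)
  moreover have "x \<in> S \<Longrightarrow> f differentiable (at x) \<longleftrightarrow> g differentiable (at x)" for x
    using frechet_derivative_cong_open(2)[OF assms(1)] Suc.prems by metis
  ultimately show ?case by auto
qed

text \<open>The recursion for \<open>Ck_on\<close> refers to \<open>frechet_derivative\<close>; this form accepts any derivative
  that is at hand.\<close>

lemma Ck_on_SucI:
  assumes "open S"
    and "\<And>x. x \<in> S \<Longrightarrow> (f has_derivative D x) (at x)"
    and "\<And>v. Ck_on k S (\<lambda>x. D x v)"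
  shows "Ck_on (Suc k) S f"
proof -
  have "Ck_on k S (\<lambda>x. frechet_derivative f (at x) v) \<longleftrightarrow> Ck_on k S (\<lambda>x. D x v)" for v
    using frechet_derivative_at[OF assms(2)] by (intro Ck_on_cong[OF assms(1)]) simp
  with assms show ?thesis by (auto simp: differentiable_def)
qed

lemma Ck_on_SucD:
  assumes "Ck_on (Suc k) S f"
  shows "\<And>x. x \<in> S \<Longrightarrow> (f has_derivative frechet_derivative f (at x)) (at x)"
    and "\<And>v. Ck_on k S (\<lambda>x. frechet_derivative f (at x) v)"
  using assms by (auto simp: frechet_derivative_works)

lemma Ck_on_lower: "Ck_on (Suc k) S f \<Longrightarrow> Ck_on k S f"
proof (induction k arbitrary: f)
  case 0
  then show ?case
    by (auto intro!: continuous_at_imp_continuous_on differentiable_imp_continuous_within)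
next
  case (Suc k)
  then show ?case using Ck_on.simps(2) by blast
qed

lemma Ck_on_const: "open S \<Longrightarrow> Ck_on k S (\<lambda>x. c)"
proof (induction k arbitrary: c)
  case (Suc k)
  show ?case
    by (rule Ck_on_SucI[OF Suc.prems, of _ "\<lambda>_ _. 0"]) (auto intro: Suc)
qed auto

lemma Ck_on_bounded_linear:
  assumes "open S" "bounded_linear L"
  shows "Ck_on k S L"
proof (cases k)
  case 0
  then show ?thesis
    using assms by (simp add: linear_continuous_on)
next
  case (Suc j)
  show ?thesis unfolding Suc
    by (rule Ck_on_SucI[OF assms(1), of _ "\<lambda>_. L"])
      (auto intro: Ck_on_const assms bounded_linear_imp_has_derivative)
qed

lemma Ck_on_add:
  assumes "open S"
  shows "Ck_on k S f \<Longrightarrow> Ck_on k S g \<Longrightarrow> Ck_on k S (\<lambda>x. f x + g x)"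
proof (induction k arbitrary: f g)
  case 0
  then show ?case by (auto intro: continuous_intros)
next
  case (Suc k)
  show ?case
    by (rule Ck_on_SucI[OF assms has_derivative_add])
      (auto intro: Ck_on_SucD[OF Suc.prems(1)] Ck_on_SucD[OF Suc.prems(2)] Suc.IH)
qed

text \<open>Closure under products follows from the Leibniz rule by induction on \<open>k\<close>: each summand of the
  derivative is again a product of maps of class \<open>k\<close>.\<close>

lemma Ck_on_scaleR:
  assumes "open S"
  shows "Ck_on k S c \<Longrightarrow> Ck_on k S f \<Longrightarrow> Ck_on k S (\<lambda>x. c x *\<^sub>R f x)"
proof (induction k arbitrary: c f)
  case 0
  then show ?case by (auto intro: continuous_intros)
next
  case (Suc k)
  show ?case
    by (rule Ck_on_SucI[OF assms has_derivative_scaleR])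
      (auto intro!: Ck_on_SucD[OF Suc.prems(1)] Ck_on_SucD[OF Suc.prems(2)] Suc.IH
        Ck_on_add[OF assms] Ck_on_lower[OF Suc.prems(1)] Ck_on_lower[OF Suc.prems(2)])
qed

text \<open>The whole sequence of derivatives of the outer function enters, so that the derivative of
  \<open>E n \<circ> q\<close>, a multiple of \<open>E (Suc n) \<circ> q\<close>, falls under the induction hypothesis.\<close>

lemma Ck_on_compose_derivatives:
  fixes q :: "'a::real_normed_vector \<Rightarrow> real" and E :: "nat \<Rightarrow> real \<Rightarrow> real"
  assumes "open S" and E: "\<And>n y. (E n has_real_derivative E (Suc n) y) (at y)"
  shows "Ck_on k S q \<Longrightarrow> Ck_on k S (\<lambda>x. E n (q x))"
proof (induction k arbitrary: n)
  case 0
  have "continuous_on UNIV (E n)"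
    using E by (auto intro!: continuous_at_imp_continuous_on DERIV_isCont)
  with 0 show ?case
    by (auto intro: continuous_on_compose2)
next
  case (Suc k)
  note D = Ck_on_SucD[OF Suc.prems]
  show ?case
  proof (rule Ck_on_SucI[OF assms(1), of _ "\<lambda>x v. E (Suc n) (q x) *\<^sub>R frechet_derivative q (at x) v"])
    fix x assume "x \<in> S"
    from has_derivative_compose[OF D(1)[OF this], of "E n"] E[of n "q x", THEN has_field_derivative_imp_has_derivative]
    show "((\<lambda>x. E n (q x)) has_derivative (\<lambda>v. E (Suc n) (q x) *\<^sub>R frechet_derivative q (at x) v)) (at x)"
      by auto
  next
    show "Ck_on k S (\<lambda>x. E (Suc n) (q x) *\<^sub>R frechet_derivative q (at x) v)" for v
      by (intro Ck_on_scaleR assms Suc.IH Ck_on_lower[OF Suc.prems] D)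
  qed
qed

lemma Ck_on_compose_snd:
  fixes f :: "'b::real_normed_vector \<Rightarrow> 'c::real_normed_vector" and I :: "'a::real_normed_vector set"
  assumes "open I" "open U"
  shows "Ck_on k U f \<Longrightarrow> Ck_on k (I \<times> U) (\<lambda>z. f (snd z))"
proof (induction k arbitrary: f)
  case 0
  then show ?case by (auto intro!: continuous_on_compose2[of U f] continuous_intros)
next
  case (Suc k)
  note D = Ck_on_SucD[OF Suc.prems]
  show ?case
  proof (rule Ck_on_SucI[of _ _ "\<lambda>z v. frechet_derivative f (at (snd z)) (snd v)"])
    show "open (I \<times> U)" using assms by (rule open_Times)
    show "((\<lambda>z. f (snd z)) has_derivative (\<lambda>v. frechet_derivative f (at (snd z)) (snd v))) (at z)"
      if "z \<in> I \<times> U" for z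
      using that by (intro has_derivative_compose[OF has_derivative_snd[OF has_derivative_ident]] D) auto
    show "Ck_on k (I \<times> U) (\<lambda>z. frechet_derivative f (at (snd z)) (snd v))" for v
      by (rule Suc.IH[OF D(2)])
  qed
qed

text \<open>The squared norm is quadratic: its derivative in a fixed direction is linear in the base point.\<close>

lemma Ck_on_inner_self:
  fixes L :: "'a::real_normed_vector \<Rightarrow> 'b::real_inner"
  assumes "open S" "bounded_linear L"
  shows "Ck_on k S (\<lambda>x. L x \<bullet> L x)"
proof (cases k)
  case 0
  then show ?thesis
    using assms by (simp add: linear_continuous_on continuous_on_inner)
next
  case (Suc j)
  interpret L: bounded_linear L by (rule assms)
  have *: "bounded_linear (\<lambda>x. L x \<bullet> L v + L v \<bullet> L x)" for v
    by (intro bounded_linear_add bounded_linear_compose[OF bounded_linear_inner_left]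
        bounded_linear_compose[OF bounded_linear_inner_right] assms)
  show ?thesis unfolding Suc
    by (rule Ck_on_SucI[OF assms(1) has_derivative_inner])
      (auto intro: Ck_on_bounded_linear[OF assms(1) *] bounded_linear_imp_has_derivative assms)
qed

section \<open>Bump functions\<close>

text \<open>For \<open>p = 1\<close> this is the classical smooth function \<open>exp(-1/x)\<close> that is flat at \<open>0\<close>; the factor
  \<open>p (1/x)\<close> makes the family closed under differentiation.\<close>

definition flat_exp :: "real poly \<Rightarrow> real \<Rightarrow> real" where
  "flat_exp p x = (if x > 0 then poly p (1 / x) * exp (- (1 / x)) else 0)"

lemma poly_times_exp_minus_tendsto_0: "((\<lambda>y. poly p y * exp (- y)) \<longlongrightarrow> (0::real)) at_top"
proof -
  have "((\<lambda>y. \<Sum>i\<le>degree p. coeff p i * (y ^ i / exp y)) \<longlongrightarrow> (\<Sum>i\<le>degree p. coeff p i * 0)) at_top"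
    by (intro tendsto_intros tendsto_power_div_exp_0)
  then show ?thesis
    by (simp add: poly_altdef exp_minus divide_inverse sum_distrib_left mult_ac)
qed

text \<open>At \<open>0\<close> the difference quotient is \<open>(1/x) p(1/x) exp(-1/x)\<close>, which tends to \<open>0\<close> because the
  exponential beats every polynomial.\<close>

lemma flat_exp_deriv:
  "(flat_exp p has_real_derivative flat_exp ([:0, 0, 1:] * (p - pderiv p)) x) (at x)"
proof -
  consider "x > 0" | "x < 0" | "x = 0" by linarith
  then show ?thesis
  proof cases
    case 1
    have "((\<lambda>x. poly p (1 / x) * exp (- (1 / x))) has_real_derivative
        flat_exp ([:0, 0, 1:] * (p - pderiv p)) x) (at x)"
      using 1 by (auto intro!: derivative_eq_intros simp: flat_exp_def field_simps power2_eq_square)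
    then show ?thesis
      by (rule has_field_derivative_transform_within_open[of _ _ _ "{0<..}"])
        (use 1 in \<open>auto simp: flat_exp_def\<close>)
  next
    case 2
    have "((\<lambda>x. 0) has_real_derivative 0) (at x)" by simp
    then have "(flat_exp p has_real_derivative 0) (at x)"
      by (rule has_field_derivative_transform_within_open[of _ _ _ "{..<0}"])
        (use 2 in \<open>auto simp: flat_exp_def\<close>)
    then show ?thesis using 2 by (simp add: flat_exp_def)
  next
    case 3
    have "((\<lambda>h. poly (pCons 0 p) (inverse h) * exp (- inverse h)) \<longlongrightarrow> 0) (at_right 0)"
      by (rule filterlim_compose[OF poly_times_exp_minus_tendsto_0 filterlim_inverse_at_top_right])
    then have r: "((\<lambda>h. flat_exp p h / h) \<longlongrightarrow> 0) (at_right 0)"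
      by (rule Lim_transform_eventually)
        (auto simp: eventually_at_right_field flat_exp_def field_simps intro!: exI[of _ 1])
    have l: "((\<lambda>h. flat_exp p h / h) \<longlongrightarrow> 0) (at_left 0)"
      by (rule Lim_transform_eventually[OF tendsto_const])
        (auto simp: eventually_at_left_field flat_exp_def intro!: exI[of _ "-1"])
    from filterlim_split_at[OF l r] show ?thesis
      using 3 by (simp add: DERIV_def flat_exp_def)
  qed
qed

lemma flat_exp_derivatives:
  "\<exists>E. E 0 = flat_exp 1 \<and> (\<forall>n y. (E n has_real_derivative E (Suc n) y) (at y))"
proof -
  let ?step = "\<lambda>p :: real poly. [:0, 0, 1:] * (p - pderiv p)"
  have "(flat_exp ((?step ^^ n) 1) has_real_derivative flat_exp ((?step ^^ Suc n) 1) y) (at y)" for n y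
    using flat_exp_deriv[of "(?step ^^ n) 1" y] by (simp only: funpow.simps comp_apply)
  then show ?thesis
    by (intro exI[of _ "\<lambda>n. flat_exp ((?step ^^ n) 1)"] conjI allI) (simp only: funpow_0, blast)
qed

definition bump :: "real \<Rightarrow> real \<Rightarrow> real \<Rightarrow> real" where
  "bump p q y = flat_exp 1 (y - p) * flat_exp 1 (q - y)"

lemma bump_pos: "p < y \<Longrightarrow> y < q \<Longrightarrow> 0 < bump p q y"
  and bump_eq_0: "y \<le> p \<or> q \<le> y \<Longrightarrow> bump p q y = 0"
  by (auto simp: bump_def flat_exp_def)

text \<open>The bump is composed with a squared norm, not with the norm, so that it is smooth across the
  origin as well.\<close>

lemma Ck_on_bump:
  fixes L :: "'a::real_normed_vector \<Rightarrow> 'b::real_inner"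
  assumes "open S" "bounded_linear L"
  shows "Ck_on k S (\<lambda>x. bump p q (L x \<bullet> L x))"
proof -
  obtain E :: "nat \<Rightarrow> real \<Rightarrow> real"
    where "E 0 = flat_exp 1 \<and> (\<forall>n y. (E n has_real_derivative E (Suc n) y) (at y))"
    using flat_exp_derivatives ..
  then have E: "E 0 = flat_exp 1" "\<And>n y. (E n has_real_derivative E (Suc n) y) (at y)"
    by simp_all
  note q = Ck_on_inner_self[OF assms]
  have 1: "Ck_on k S (\<lambda>x. E 0 (- p + L x \<bullet> L x))"
    by (intro Ck_on_compose_derivatives[where E=E, OF assms(1) E(2)] assms Ck_on_add Ck_on_const q)
  have 2: "Ck_on k S (\<lambda>x. E 0 (q + (-1) *\<^sub>R (L x \<bullet> L x)))"
    by (intro Ck_on_compose_derivatives[where E=E, OF assms(1) E(2)] assms Ck_on_add Ck_on_const Ck_on_scaleR q)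
  from Ck_on_scaleR[OF assms(1) 1 2] show ?thesis
    by (simp add: bump_def E)
qed

section \<open>The tension field of a rotationally symmetric map\<close>

lemma matrix_inv_eqI:
  fixes A B :: "real^'n^'n"
  assumes "A ** B = mat 1"
  shows "matrix_inv A = B"
proof -
  have BA: "B ** A = mat 1"
    using assms matrix_left_right_inverse by blast
  then have "A ** matrix_inv A = mat 1"
    using assms unfolding matrix_inv_def by (intro conjunct1[OF someI[of "\<lambda>A'. A ** A' = mat 1 \<and> A' ** A = mat 1"]]) auto
  then show ?thesis
    by (metis BA matrix_mul_assoc matrix_mul_lid matrix_mul_rid)
qed

lemma partial_eqI: "(F has_derivative F') (at x) \<Longrightarrow> partial i F x = F' (axis i 1)"
  unfolding partial_def by (metis frechet_derivative_at)

lemma partial_cong_open: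
  assumes "open S" "x \<in> S" "\<And>y. y \<in> S \<Longrightarrow> F y = G y"
  shows "partial i F x = partial i G x"
  unfolding partial_def using frechet_derivative_cong_open(1)[of S x F G] assms by simp

lemma gram_flat: "gram flat_metric x = mat 1"
  by (simp add: gram_def flat_metric_def mat_def vec_eq_iff inner_axis_axis)

lemma matrix_inv_mat_1: "matrix_inv (mat 1 :: real^'n^'n) = mat 1"
  by (rule matrix_inv_eqI) simp

lemma christoffel_flat: "christoffel flat_metric x k i j = 0"
  by (simp add: christoffel_def gram_flat partial_def)

text \<open>On the flat side the inverse Gram matrix is the identity and the Christoffel symbols vanish, so
  the trace is a sum over the diagonal.\<close>

lemma tension_flat_domain:
  "tension flat_metric h \<phi> x =
     (\<chi> k. \<Sum>i\<in>UNIV. partial i (partial i (\<lambda>y. \<phi> y $ k)) x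
        + (\<Sum>p\<in>UNIV. \<Sum>q\<in>UNIV. christoffel h (\<phi> x) k p q
             * partial i (\<lambda>y. \<phi> y $ p) x * partial i (\<lambda>y. \<phi> y $ q) x))"
  by (simp add: tension_def gram_flat matrix_inv_mat_1 nabla_d_def christoffel_flat vec_eq_iff)
    (simp add: mat_def if_distrib[of "\<lambda>c. c * _"] sum.delta cong: if_cong)

lemma has_derivative_radial:
  fixes x :: "real^'n::finite"
  assumes "x \<noteq> 0" "(f has_real_derivative f') (at (norm x))"
  shows "((\<lambda>y. f (norm y)) has_derivative (\<lambda>v. f' / norm x * (x \<bullet> v))) (at x)"
proof -
  have "((\<lambda>y. f (norm y)) has_derivative (\<lambda>v. f' * (sgn x \<bullet> v))) (at x)"
    using has_derivative_compose[OF has_derivative_norm[OF assms(1)]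
        assms(2)[THEN has_field_derivative_imp_has_derivative]] by (simp add: inner_commute)
  then show ?thesis by (simp add: sgn_div_norm divide_inverse mult_ac)
qed

lemma has_derivative_component: "((\<lambda>y. y $ i) has_derivative (\<lambda>v. v $ i)) (at x)"
  by (intro bounded_linear_imp_has_derivative bounded_linear_vec_nth)

text \<open>A symbol for the entries of the identity matrix keeps the simplifier from splitting the index
  sums below into cases.\<close>

definition kron :: "'n \<Rightarrow> 'n \<Rightarrow> real" where
  "kron i j = (if i = j then 1 else 0)"

lemma kron_simps:
  "kron i i = 1" "kron i j = kron j i" for i j :: "'n::finite"
  by (auto simp: kron_def)

lemma sum_kron:
  "(\<Sum>i\<in>UNIV. kron i j * f i) = f j" "(\<Sum>i\<in>UNIV. kron j i * f i) = f j"
  "(\<Sum>i\<in>UNIV. f i * kron i j) = f j" "(\<Sum>i\<in>UNIV. f i * kron j i) = f j"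
  for f :: "'n::finite \<Rightarrow> real"
  by (simp_all add: kron_def if_distrib[of "\<lambda>c. c * _"] if_distrib[of "\<lambda>c. _ * c"] cong: if_cong)

lemma axis_nth_kron: "axis i 1 $ j = kron i j"
  by (auto simp: axis_def kron_def)

lemma partial_radial_times_component:
  fixes x :: "real^'n::finite"
  assumes "x \<noteq> 0" "(\<psi> has_real_derivative \<psi>') (at (norm x))"
  shows "partial i (\<lambda>y. \<psi> (norm y) * y $ k) x = \<psi> (norm x) * kron i k + \<psi>' / norm x * x $ i * x $ k"
  by (subst partial_eqI[OF has_derivative_mult[OF has_derivative_radial[OF assms] has_derivative_component]])
    (simp add: axis_nth_kron inner_axis)

lemma sum_square_components: "(\<Sum>i\<in>UNIV. x $ i * x $ i) = (norm x)\<^sup>2" for x :: "real^'n::finite"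
  by (simp add: power2_norm_eq_inner inner_vec_def)

text \<open>A rotationally symmetric map has components \<open>\<psi>(|y|) y\<^sub>k\<close>. Writing \<open>\<psi>' = r \<omega>\<close> avoids the
  quotient by \<open>|y|\<close>: the gradient of \<open>\<psi>(|y|)\<close> is \<open>\<omega>(|y|) y\<close>.\<close>

lemma Laplacian_radial_times_component:
  fixes x :: "real^'n::finite"
  assumes S: "open S" "norm x \<in> S" "0 \<notin> S"
    and \<psi>: "\<And>r. r \<in> S \<Longrightarrow> (\<psi> has_real_derivative r * \<omega> r) (at r)"
    and \<omega>: "(\<omega> has_real_derivative \<omega>') (at (norm x))"
  shows "(\<Sum>i\<in>UNIV. partial i (partial i (\<lambda>y. \<psi> (norm y) * y $ k)) x) =
    ((real CARD('n) + 2) * \<omega> (norm x) + norm x * \<omega>') * x $ k"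
proof -
  have x0: "x \<noteq> 0" and r0: "norm x \<noteq> 0" using S by auto
  have op: "open {y :: real^'n. norm y \<in> S}"
    using open_vimage[OF S(1), of "norm :: real^'n \<Rightarrow> real"] by (simp add: vimage_def continuous_on_norm_id)
  have p1: "partial i (\<lambda>y. \<psi> (norm y) * y $ k) y = \<psi> (norm y) * kron i k + \<omega> (norm y) * (y $ i * y $ k)"
    if "y \<in> {y. norm y \<in> S}" for y :: "real^'n" and i
    using that S(3) partial_radial_times_component[of y \<psi> "norm y * \<omega> (norm y)" i k] \<psi>
    by (cases "y = 0") auto
  have p2: "partial i (partial i (\<lambda>y. \<psi> (norm y) * y $ k)) x =
    2 * (\<omega> (norm x) * (x $ i * kron i k)) + \<omega> (norm x) * x $ k + \<omega>' / norm x * x $ k * (x $ i * x $ i)" for i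
  proof -
    have "partial i (partial i (\<lambda>y. \<psi> (norm y) * y $ k)) x =
      partial i (\<lambda>y. \<psi> (norm y) * kron i k + \<omega> (norm y) * (y $ i * y $ k)) x"
      by (rule partial_cong_open[OF op]) (use S p1 in auto)
    also have "\<dots> = \<omega> (norm x) * x $ i * kron i k
        + (\<omega> (norm x) * (kron i i * x $ k + x $ i * kron i k) + \<omega>' / norm x * x $ i * x $ i * x $ k)"
      by (subst partial_eqI[OF has_derivative_add[OF has_derivative_mult_left[OF has_derivative_radial[OF x0 \<psi>]]
            has_derivative_mult[OF has_derivative_radial[OF x0 \<omega>]
            has_derivative_mult[OF has_derivative_component has_derivative_component]]]])
        (use S r0 in \<open>auto simp: axis_nth_kron kron_simps(1) inner_axis algebra_simps\<close>)
    finally show ?thesis by (simp add: kron_simps(1) algebra_simps)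
  qed
  show ?thesis
    unfolding p2 using r0
    by (simp only: sum.distrib sum_distrib_left[symmetric] sum_kron sum_square_components)
      (simp add: field_simps power2_eq_square)
qed

subsection \<open>Christoffel symbols of a model\<close>

text \<open>In Cartesian coordinates the model metric is \<open>a \<delta>\<^sub>i\<^sub>j + (1 - a) y\<^sub>i y\<^sub>j/|y|\<^sup>2\<close> with
  \<open>a = (h/|y|)\<^sup>2\<close>: eigenvalue \<open>1\<close> in the radial direction, \<open>a\<close> orthogonally to it.\<close>

lemma gram_model_metric:
  fixes y :: "real^'n::finite"
  assumes "y \<noteq> 0"
  shows "gram (model_metric h) y $ i $ j =
    (h (norm y) / norm y)\<^sup>2 * kron i j + (1 - (h (norm y) / norm y)\<^sup>2) / (norm y)\<^sup>2 * (y $ i * y $ j)"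
proof -
  define r where "r = norm y"
  have r: "r \<noteq> 0" and yy: "y \<bullet> y = r\<^sup>2" using assms by (auto simp: r_def power2_norm_eq_inner)
  have dr: "dr y (axis i 1) = y $ i / r" for i
    by (simp add: dr_def r_def inner_axis divide_inverse)
  have dt: "d_theta y (axis i 1) \<bullet> d_theta y (axis j 1) = (kron i j - y $ i * y $ j / r\<^sup>2) / r\<^sup>2"
  proof -
    have "d_theta y (axis i 1) \<bullet> d_theta y (axis j 1) =
      ((axis i 1 - (y $ i / r\<^sup>2) *\<^sub>R y) \<bullet> (axis j 1 - (y $ j / r\<^sup>2) *\<^sub>R y)) / r\<^sup>2"
      by (simp add: d_theta_def dr r_def[symmetric] power2_eq_square divide_inverse mult.assoc)
    also have "(axis i 1 - (y $ i / r\<^sup>2) *\<^sub>R y) \<bullet> (axis j 1 - (y $ j / r\<^sup>2) *\<^sub>R y) =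
      kron i j - y $ i * y $ j / r\<^sup>2"
      using r by (simp add: inner_diff_left inner_diff_right yy inner_axis inner_commute[of "axis _ _" y]
          inner_axis_axis axis_nth_kron kron_def field_simps power2_eq_square)
    finally show ?thesis .
  qed
  show ?thesis
    using assms r unfolding gram_def model_metric_def
    by (simp add: dr dt r_def[symmetric]) (simp add: field_simps power2_eq_square)
qed

text \<open>The inverse has the same shape, with eigenvalues \<open>1\<close> and \<open>1/a\<close>.\<close>

lemma matrix_inv_gram_model_metric:
  fixes y :: "real^'n::finite"
  assumes "y \<noteq> 0" and a: "a = (h (norm y) / norm y)\<^sup>2" "a \<noteq> 0"
  shows "matrix_inv (gram (model_metric h) y) $ i $ j =
    1 / a * kron i j + (1 - 1 / a) / (norm y)\<^sup>2 * (y $ i * y $ j)"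
proof -
  define r where "r = norm y"
  have r: "r \<noteq> 0" using assms by (auto simp: r_def)
  let ?B = "\<chi> i j. 1 / a * kron i j + (1 - 1 / a) / r\<^sup>2 * (y $ i * y $ j)"
  have "gram (model_metric h) y ** ?B = mat 1"
  proof -
    define ia where "ia = 1 / a"
    define c where "c = (1 - a) / r\<^sup>2"
    define e where "e = (1 - ia) / r\<^sup>2"
    have "(\<Sum>k\<in>UNIV. (a * kron i k + c * (y $ i * y $ k)) *
        (ia * kron k j + e * (y $ k * y $ j))) = kron i j" for i j
    proof -
      have "(\<Sum>k\<in>UNIV. (a * kron i k + c * (y $ i * y $ k)) * (ia * kron k j + e * (y $ k * y $ j))) =
        (\<Sum>k\<in>UNIV. (a * ia) * (kron i k * kron k j) + a * e * y $ j * (kron i k * y $ k)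
          + c * ia * y $ i * (y $ k * kron k j) + c * e * y $ i * y $ j * (y $ k * y $ k))"
        by (intro sum.cong refl) (simp add: algebra_simps)
      also have "\<dots> = (a * ia) * kron i j + (a * e + c * ia + c * e * r\<^sup>2) * (y $ i * y $ j)"
        by (simp only: sum.distrib sum_distrib_left[symmetric] sum_kron sum_square_components r_def)
          (simp add: algebra_simps)
      also have "a * e + c * ia + c * e * r\<^sup>2 = 0"
        using a(2) r by (simp add: c_def e_def ia_def field_simps)
      also have "a * ia = 1" using a(2) by (simp add: ia_def)
      finally show ?thesis by simp
    qed
    moreover have "gram (model_metric h) y $ i $ k = a * kron i k + c * (y $ i * y $ k)" for i k
      using assms(1) by (simp add: gram_model_metric a(1) r_def c_def)
    ultimately show ?thesis
      by (simp add: matrix_matrix_mult_def mat_def vec_eq_iff c_def e_def ia_def) (simp add: kron_def)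
  qed
  from matrix_inv_eqI[OF this] show ?thesis by (simp add: r_def)
qed

text \<open>By rotational symmetry only three kinds of terms occur. The coefficient \<open>c\<close> governs the
  tangential directions; the relation between \<open>s\<close>, \<open>c\<close> and \<open>t\<close> says that the symbols vanish on a
  pair of radial vectors, that is, that radial lines are geodesics parametrized by arc length.
  These two facts are all that the tension field needs.\<close>

lemma christoffel_model_metric:
  fixes y :: "real^'n::finite"
  assumes "y \<noteq> 0" "h (norm y) \<noteq> 0" "(h has_real_derivative h') (at (norm y))"
  obtains s c t :: real
  where "\<And>k p q. christoffel (model_metric h) y k p q =
      s * (y $ p * kron q k + y $ q * kron p k) + c * kron p q * y $ k + t * (y $ p * y $ q * y $ k)"
    and "c = 1 / (norm y)\<^sup>2 - h (norm y) * h' / norm y ^ 3"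
    and "2 * s + c + t * (norm y)\<^sup>2 = 0"
proof -
  define \<rho> where "\<rho> = norm y"
  have \<rho>: "\<rho> > 0" using assms(1) by (simp add: \<rho>_def)
  define a where "a = (\<lambda>r. (h r / r)\<^sup>2)"
  define b where "b = (\<lambda>r. (1 - a r) / r\<^sup>2)"
  define a' where "a' = 2 * (h \<rho> / \<rho>) * ((h' * \<rho> - h \<rho>) / \<rho>\<^sup>2)"
  define b' where "b' = (- a' * \<rho>\<^sup>2 - (1 - a \<rho>) * (2 * \<rho>)) / (\<rho>\<^sup>2 * \<rho>\<^sup>2)"
  have h': "(h has_real_derivative h') (at \<rho>)" using assms(3) by (simp add: \<rho>_def)
  have da: "(a has_real_derivative a') (at \<rho>)"
    unfolding a_def a'_def
    by (rule derivative_eq_intros h' refl | use \<rho> in \<open>simp add: field_simps power2_eq_square\<close>)+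
  have db: "(b has_real_derivative b') (at \<rho>)"
    unfolding b_def b'_def
    by (rule derivative_eq_intros da refl | use \<rho> in \<open>simp add: field_simps power2_eq_square\<close>)+
  have a0: "a \<rho> \<noteq> 0" using assms(2) \<rho> by (simp add: a_def \<rho>_def)
  have op: "open (- {0 :: real^'n})" by auto
  have pg: "partial l (\<lambda>z. gram (model_metric h) z $ i $ j) y =
      a' / \<rho> * (y $ l * kron i j) + b \<rho> * (kron l i * y $ j + y $ i * kron l j)
        + b' / \<rho> * (y $ l * y $ i * y $ j)" for l i j
  proof -
    have "partial l (\<lambda>z. gram (model_metric h) z $ i $ j) y =
      partial l (\<lambda>z. a (norm z) * kron i j + b (norm z) * (z $ i * z $ j)) y"
      by (rule partial_cong_open[OF op]) (use assms(1) in \<open>auto simp: gram_model_metric a_def b_def\<close>)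
    also have "\<dots> = a' / \<rho> * (y $ l * kron i j) + b \<rho> * (kron l i * y $ j + y $ i * kron l j)
        + b' / \<rho> * (y $ l * y $ i * y $ j)"
      by (subst partial_eqI[OF has_derivative_add[OF
            has_derivative_mult_left[OF has_derivative_radial[OF assms(1) da[unfolded \<rho>_def]]]
            has_derivative_mult[OF has_derivative_radial[OF assms(1) db[unfolded \<rho>_def]]
            has_derivative_mult[OF has_derivative_component has_derivative_component]]]])
        (simp add: axis_nth_kron inner_axis \<rho>_def algebra_simps)
    finally show ?thesis .
  qed
  define s where "s = a' / (2 * \<rho>)"
  define t where "t = b' / (2 * \<rho>)"
  define c where "c = b \<rho> - s"
  define e where "e = (1 - 1 / a \<rho>) / \<rho>\<^sup>2"
  \<comment> \<open>The position vector is an eigenvector of the inverse Gram matrix with eigenvalue 1.\<close>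
  have ae: "1 / a \<rho> + e * \<rho>\<^sup>2 = 1" using \<rho> by (simp add: e_def)
  have chr: "christoffel (model_metric h) y k p q =
      s / a \<rho> * (y $ p * kron q k + y $ q * kron p k) + c * kron p q * y $ k
        + (t + 2 * s * e) * (y $ p * y $ q * y $ k)" for k p q
  proof -
    have "christoffel (model_metric h) y k p q = (1/2) * (\<Sum>l\<in>UNIV.
      (1 / a \<rho> * kron k l + e * (y $ k * y $ l)) *
      (2 * s * (y $ p * kron q l + y $ q * kron p l - y $ l * kron p q)
        + 2 * b \<rho> * (kron p q * y $ l) + 2 * t * (y $ p * y $ q * y $ l)))"
      unfolding christoffel_def pg
      by (intro arg_cong[of _ _ "\<lambda>u. 1/2 * u"] sum.cong refl arg_cong2[of _ _ _ _ "(*)"])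
        (use assms(1) a0 in \<open>auto simp: matrix_inv_gram_model_metric a_def \<rho>_def e_def s_def t_def
          kron_simps(2) algebra_simps add_divide_distrib diff_divide_distrib\<close>)
    also have "\<dots> = (\<Sum>l\<in>UNIV.
        s / a \<rho> * y $ p * (kron k l * kron q l) + s / a \<rho> * y $ q * (kron k l * kron p l)
        + 1 / a \<rho> * (c * kron p q + t * y $ p * y $ q) * (kron k l * y $ l)
        + e * s * y $ k * y $ p * (kron q l * y $ l) + e * s * y $ k * y $ q * (kron p l * y $ l)
        + e * y $ k * (c * kron p q + t * y $ p * y $ q) * (y $ l * y $ l))"
      by (simp add: sum_distrib_left c_def algebra_simps)
    also have "\<dots> = s / a \<rho> * y $ p * kron q k + s / a \<rho> * y $ q * kron p k
        + 2 * e * s * y $ k * y $ p * y $ q + (1 / a \<rho> + e * \<rho>\<^sup>2) * ((c * kron p q + t * y $ p * y $ q) * y $ k)"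
      by (simp only: sum.distrib sum_distrib_left[symmetric] sum_kron sum_square_components \<rho>_def[symmetric])
        (simp add: algebra_simps)
    finally show ?thesis unfolding ae by (simp add: algebra_simps)
  qed
  have c: "c = 1 / \<rho>\<^sup>2 - h \<rho> * h' / \<rho> ^ 3"
    using \<rho> by (simp add: c_def s_def b_def a_def a'_def field_simps power2_eq_square power3_eq_cube)
  \<comment> \<open>This is the derivative of \<open>a + \<rho>\<^sup>2 b = 1\<close>, the normalization of the radial eigenvalue.\<close>
  have bt: "2 * t * \<rho>\<^sup>2 = - 2 * s - 2 * b \<rho>"
    using \<rho> unfolding t_def s_def b'_def b_def by (simp add: field_simps power2_eq_square)
  have "2 * (s / a \<rho>) + c + (t + 2 * s * e) * \<rho>\<^sup>2 = 2 * s * (1 / a \<rho> + e * \<rho>\<^sup>2) + c + t * \<rho>\<^sup>2"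
    by (simp add: algebra_simps)
  also have "\<dots> = 0" using bt unfolding ae c_def by (simp add: algebra_simps)
  finally show ?thesis using that[of "s / a \<rho>" c "t + 2 * s * e"] chr c by (simp add: \<rho>_def)
qed

text \<open>The Laplacian of the components contributes \<open>\<beta>'' + (m - 1) (\<beta>'/r - \<beta>/r\<^sup>2)\<close> in the radial
  direction, and the Christoffel term contributes \<open>(m - 1) (\<beta>/r)\<^sup>2 c \<beta>\<close> with the coefficient \<open>c\<close> of
  \<open>christoffel_model_metric\<close>; the terms \<open>\<beta>/r\<^sup>2\<close> cancel.\<close>

lemma tension_rot_map:
  fixes x :: "real^'n::finite"
  assumes S: "open S" "norm x \<in> S" "S \<subseteq> {0<..}"
    and \<beta>1: "\<And>r. r \<in> S \<Longrightarrow> (\<beta> has_real_derivative \<beta>1 r) (at r)"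
    and \<beta>2: "(\<beta>1 has_real_derivative \<beta>2) (at (norm x))"
    and pos: "\<beta> (norm x) > 0"
    and h: "h (\<beta> (norm x)) \<noteq> 0" "(h has_real_derivative h') (at (\<beta> (norm x)))"
    and eq: "\<And>y. norm y \<in> S \<Longrightarrow> \<phi> y = rot_map \<beta> y"
  shows "tension flat_metric (model_metric h) \<phi> x =
    (\<beta>2 + (real CARD('n) - 1) * (\<beta>1 (norm x) / norm x - h (\<beta> (norm x)) * h' / (norm x)\<^sup>2))
      *\<^sub>R (x /\<^sub>R norm x)"
proof -
  define r where "r = norm x"
  have r: "r > 0" using S by (auto simp: r_def)
  have x0: "x \<noteq> 0" using r by (auto simp: r_def)
  define \<psi> where "\<psi> = (\<lambda>r. \<beta> r / r)"
  define \<omega> where "\<omega> = (\<lambda>r. (\<beta>1 r * r - \<beta> r) / r ^ 3)"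
  define \<omega>' where "\<omega>' = \<beta>2 / r\<^sup>2 - 3 * \<beta>1 r / r ^ 3 + 3 * \<beta> r / r ^ 4"
  have d\<psi>: "(\<psi> has_real_derivative s * \<omega> s) (at s)" if "s \<in> S" for s
    unfolding \<psi>_def \<omega>_def
    by (rule derivative_eq_intros \<beta>1 that refl | use S that in
        \<open>force simp: field_simps power2_eq_square power3_eq_cube\<close>)+
  have d\<omega>: "(\<omega> has_real_derivative \<omega>') (at r)"
    unfolding \<omega>_def \<omega>'_def
    by (rule derivative_eq_intros \<beta>1[of r] \<beta>2[folded r_def] refl | use S r in
        \<open>force simp: field_simps power2_eq_square power3_eq_cube power4_eq_xxxx r_def\<close>)+
  have op: "open {y :: real^'n. norm y \<in> S}"
    using open_vimage[OF S(1), of "norm :: real^'n \<Rightarrow> real"] by (simp add: vimage_def continuous_on_norm_id)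
  have \<phi>: "\<phi> y $ k = \<psi> (norm y) * y $ k" if "y \<in> {y. norm y \<in> S}" for y k
    using that eq by (simp add: rot_map_def \<psi>_def divide_inverse)
  have p1: "partial i (\<lambda>y. \<phi> y $ k) y = partial i (\<lambda>y. \<psi> (norm y) * y $ k) y"
    if "y \<in> {y. norm y \<in> S}" for y i k
    by (rule partial_cong_open[OF op that \<phi>])
  have p2: "partial i (partial i (\<lambda>y. \<phi> y $ k)) x = partial i (partial i (\<lambda>y. \<psi> (norm y) * y $ k)) x" for i k
    by (rule partial_cong_open[OF op _ p1]) (use S in auto)
  have lap: "(\<Sum>i\<in>UNIV. partial i (partial i (\<lambda>y. \<phi> y $ k)) x) =
      ((real CARD('n) + 2) * \<omega> r + r * \<omega>') * x $ k" for k
    unfolding p2 r_def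
    by (rule Laplacian_radial_times_component[OF S(1,2) _ d\<psi> d\<omega>[unfolded r_def]]) (use S in auto)
  define y where "y = \<phi> x"
  have y: "y = \<psi> r *\<^sub>R x" using \<phi>[of x] S by (simp add: y_def r_def vec_eq_iff)
  have \<psi>0: "\<psi> r > 0" using r pos by (simp add: \<psi>_def r_def)
  have ny: "norm y = \<beta> r" using pos r by (simp add: y \<psi>_def r_def)
  have y0: "y \<noteq> 0" using ny pos by (auto simp: r_def)
  obtain s c t :: real
    where chr: "\<And>k p q. christoffel (model_metric h) y k p q =
      s * (y $ p * kron q k + y $ q * kron p k) + c * kron p q * y $ k + t * (y $ p * y $ q * y $ k)"
      and c: "c = 1 / (norm y)\<^sup>2 - h (norm y) * h' / norm y ^ 3"
      and st: "2 * s + c + t * (norm y)\<^sup>2 = 0"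
    by (rule christoffel_model_metric[of y h h']) (use y0 ny h in \<open>auto simp: r_def\<close>)
  define P where "P = (\<lambda>i p. \<psi> r * kron i p + \<omega> r * (x $ i * x $ p))"
  have P: "partial i (\<lambda>y. \<phi> y $ p) x = P i p" for i p
    using p1[of x i p] S x0 partial_radial_times_component[of x \<psi> "r * \<omega> r" i p] d\<psi>[of r] r
    by (simp add: P_def r_def)
  define m where "m = \<psi> r * (\<psi> r + \<omega> r * r\<^sup>2)"
  have yP: "(\<Sum>p\<in>UNIV. y $ p * P i p) = m * x $ i" for i
  proof -
    have "(\<Sum>p\<in>UNIV. y $ p * P i p) =
       (\<Sum>p\<in>UNIV. \<psi> r * \<psi> r * (kron i p * x $ p) + \<psi> r * \<omega> r * x $ i * (x $ p * x $ p))"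
      by (simp add: y P_def algebra_simps)
    then show ?thesis
      by (simp only: sum.distrib sum_distrib_left[symmetric] sum_kron sum_square_components r_def[symmetric])
        (simp add: m_def power2_eq_square algebra_simps)
  qed
  have PP: "(\<Sum>p\<in>UNIV. P i p * P i p) = (\<psi> r)\<^sup>2 + (2 * \<psi> r * \<omega> r + (\<omega> r)\<^sup>2 * r\<^sup>2) * (x $ i * x $ i)" for i
  proof -
    have "(\<Sum>p\<in>UNIV. P i p * P i p) =
       (\<Sum>p\<in>UNIV. (\<psi> r)\<^sup>2 * (kron i p * kron i p) + 2 * \<psi> r * \<omega> r * x $ i * (kron i p * x $ p)
          + (\<omega> r)\<^sup>2 * (x $ i * x $ i) * (x $ p * x $ p))"
      by (simp add: P_def algebra_simps power2_eq_square)
    then show ?thesis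
      by (simp only: sum.distrib sum_distrib_left[symmetric] sum_kron sum_square_components r_def[symmetric])
        (simp add: kron_simps(1) algebra_simps)
  qed
  \<comment> \<open>The contraction needs only the inner products of the partial derivatives \<open>P i\<close> with \<open>y\<close> and
    with themselves.\<close>
  have \<Gamma>: "(\<Sum>p\<in>UNIV. \<Sum>q\<in>UNIV. christoffel (model_metric h) y k p q * P i p * P i q) =
      2 * s * (m * x $ i) * P i k + c * y $ k * (\<Sum>p\<in>UNIV. P i p * P i p) + t * y $ k * (m * x $ i)\<^sup>2" for i k
  proof -
    have "(\<Sum>p\<in>UNIV. \<Sum>q\<in>UNIV. christoffel (model_metric h) y k p q * P i p * P i q) =
      (\<Sum>p\<in>UNIV. \<Sum>q\<in>UNIV. s * ((y $ p * P i p) * (kron q k * P i q)) + s * ((kron p k * P i p) * (y $ q * P i q))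
        + c * y $ k * (P i p * (kron p q * P i q)) + t * y $ k * ((y $ p * P i p) * (y $ q * P i q)))"
      by (intro sum.cong refl) (simp add: chr algebra_simps)
    also have "\<dots> = s * (m * x $ i) * P i k + s * P i k * (m * x $ i)
        + c * y $ k * (\<Sum>p\<in>UNIV. P i p * P i p) + t * y $ k * ((m * x $ i) * (m * x $ i))"
      by (simp only: sum.distrib sum_distrib_left[symmetric] sum_distrib_right[symmetric] sum_kron yP)
    finally show ?thesis by (simp add: power2_eq_square algebra_simps)
  qed
  have \<Gamma>sum: "(\<Sum>i\<in>UNIV. \<Sum>p\<in>UNIV. \<Sum>q\<in>UNIV. christoffel (model_metric h) y k p q * P i p * P i q) =
      (real CARD('n) - 1) * (\<psi> r)\<^sup>2 * c * y $ k" for k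
  proof -
    have "(\<Sum>i\<in>UNIV. \<Sum>p\<in>UNIV. \<Sum>q\<in>UNIV. christoffel (model_metric h) y k p q * P i p * P i q) =
      (\<Sum>i\<in>UNIV. 2 * s * m * \<psi> r * (kron i k * x $ i) + c * y $ k * (\<psi> r)\<^sup>2
       + (2 * s * m * \<omega> r * x $ k + c * y $ k * (2 * \<psi> r * \<omega> r + (\<omega> r)\<^sup>2 * r\<^sup>2) + t * y $ k * m\<^sup>2) * (x $ i * x $ i))"
      unfolding \<Gamma> PP by (intro sum.cong refl) (simp add: P_def power2_eq_square algebra_simps)
    also have "\<dots> = 2 * s * m * \<psi> r * x $ k + real CARD('n) * (c * y $ k * (\<psi> r)\<^sup>2)
       + (2 * s * m * \<omega> r * x $ k + c * y $ k * (2 * \<psi> r * \<omega> r + (\<omega> r)\<^sup>2 * r\<^sup>2) + t * y $ k * m\<^sup>2) * r\<^sup>2"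
      by (simp add: sum.distrib sum_distrib_left[symmetric] sum_kron sum_square_components r_def[symmetric])
    \<comment> \<open>The second summand is the radial part, which vanishes by \<open>st\<close>.\<close>
    also have "\<dots> = (real CARD('n) - 1) * (\<psi> r)\<^sup>2 * c * y $ k
       + x $ k * (\<psi> r + \<omega> r * r\<^sup>2)\<^sup>2 * \<psi> r * (2 * s + c + t * (\<psi> r * r)\<^sup>2)"
      unfolding y m_def by (simp add: power2_eq_square algebra_simps)
    also have "\<psi> r * r = norm y" using r by (simp add: ny \<psi>_def)
    finally show ?thesis unfolding st by simp
  qed
  have "tension flat_metric (model_metric h) \<phi> x $ k =
      ((real CARD('n) + 2) * \<omega> r + r * \<omega>' + (real CARD('n) - 1) * (\<psi> r)\<^sup>2 * c * \<psi> r) * x $ k" for k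
    by (simp add: tension_flat_domain sum.distrib lap P \<Gamma>sum y_def[symmetric])
      (simp add: y algebra_simps)
  moreover have "(real CARD('n) + 2) * \<omega> r + r * \<omega>' + (real CARD('n) - 1) * (\<psi> r)\<^sup>2 * c * \<psi> r =
     (\<beta>2 + (real CARD('n) - 1) * (\<beta>1 r / r - h (\<beta> r) * h' / r\<^sup>2)) / r"
  proof -
    have "\<beta> r \<noteq> 0" using pos by (simp add: r_def)
    then have "(\<psi> r)\<^sup>2 * c * \<psi> r = \<beta> r / r ^ 3 - h (\<beta> r) * h' / r ^ 3"
      using r unfolding c ny \<psi>_def by (simp add: field_simps power2_eq_square power3_eq_cube)
    moreover have "(real CARD('n) + 2) * \<omega> r + r * \<omega>' =
        \<beta>2 / r + (real CARD('n) - 1) * (\<beta>1 r / r\<^sup>2 - \<beta> r / r ^ 3)"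
      using r unfolding \<omega>_def \<omega>'_def
      by (simp add: field_simps power2_eq_square power3_eq_cube power4_eq_xxxx)
    ultimately show ?thesis
      using r by (simp add: mult.assoc) (simp add: field_simps power2_eq_square power3_eq_cube)
  qed
  ultimately show ?thesis by (simp add: vec_eq_iff r_def divide_inverse)
qed

section \<open>Integration of radial functions\<close>

lemma emeasure_norm_greater:
  fixes s q :: real
  assumes "0 \<le> s" "s \<le> q"
  shows "emeasure lborel {x :: real^'n::finite. s < norm x \<and> norm x \<le> q} =
    ennreal (unit_ball_vol (real CARD('n)) * (q ^ CARD('n) - s ^ CARD('n)))"
proof -
  have eq: "{x :: real^'n. s < norm x \<and> norm x \<le> q} = cball 0 q - cball 0 s"
    by auto
  have sub: "cball (0 :: real^'n) s \<subseteq> cball 0 q"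
    using assms by auto
  have "emeasure lborel {x :: real^'n. s < norm x \<and> norm x \<le> q} =
      emeasure lborel (cball (0 :: real^'n) q) - emeasure lborel (cball (0 :: real^'n) s)"
    unfolding eq by (rule emeasure_Diff[OF _ _ _ sub]) (use assms in \<open>simp_all add: emeasure_cball\<close>)
  also have "\<dots> = ennreal (unit_ball_vol (real CARD('n)) * q ^ CARD('n)) -
      ennreal (unit_ball_vol (real CARD('n)) * s ^ CARD('n))"
    using assms by (simp add: emeasure_cball)
  also have "\<dots> = ennreal (unit_ball_vol (real CARD('n)) * (q ^ CARD('n) - s ^ CARD('n)))"
    using assms by (subst ennreal_minus) (auto simp: right_diff_distrib)
  finally show ?thesis .
qed

text \<open>Polar coordinates for radial functions: the two finite measures on the line agree on all rays
  \<open>(s, \<infinity>)\<close>, by the volume formula for balls. The restriction to a ball makes them finite.\<close>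

lemma distr_norm_cball:
  fixes q :: real
  assumes "0 \<le> q"
  shows "distr (density lborel (indicator (cball (0 :: real^'n::finite) q))) borel norm =
    density lborel (\<lambda>r. ennreal (real CARD('n) * unit_ball_vol (real CARD('n)) * r ^ (CARD('n) - 1)) * indicator {0..q} r)"
    (is "?M = ?N")
proof -
  define n where "n = CARD('n)"
  have n: "n > 0" by (simp add: n_def)
  define V where "V = unit_ball_vol (real n)"
  have V: "V \<ge> 0" by (simp add: V_def)
  have eq: "emeasure ?M {s<..} = ennreal (V * (q ^ n - (min q (max 0 s)) ^ n))
      \<and> emeasure ?N {s<..} = ennreal (V * (q ^ n - (min q (max 0 s)) ^ n))" for s
  proof
    define s' where "s' = min q (max 0 s)"
    have s': "0 \<le> s'" "s' \<le> q" using assms by (auto simp: s'_def)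
    have "emeasure ?M {s<..} = emeasure (density lborel (indicator (cball (0 :: real^'n) q))) (norm -` {s<..})"
      by (subst emeasure_distr) auto
    also have "\<dots> = (\<integral>\<^sup>+x. indicator (cball (0 :: real^'n) q) x * indicator (norm -` {s<..}) x \<partial>lborel)"
    proof -
      have "open (norm -` {s<..} :: (real^'n) set)"
        by (intro open_vimage continuous_on_norm_id) simp
      then show ?thesis
        by (subst emeasure_density) (auto simp: borel_closed borel_open intro!: borel_measurable_indicator)
    qed
    also have "\<dots> = (\<integral>\<^sup>+x. indicator ({x :: real^'n. s' < norm x \<and> norm x \<le> q}) x \<partial>lborel)"
    proof (rule nn_integral_cong_AE)
      have "AE x :: real^'n in lborel. 0 < norm x"
        using AE_lborel_singleton[of "0 :: real^'n"] by simp
      then show "AE x :: real^'n in lborel. (indicator (cball 0 q) x * indicator (norm -` {s<..}) x :: ennreal) =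
        indicator {x. s' < norm x \<and> norm x \<le> q} x"
      proof eventually_elim
        case (elim x)
        then show ?case
          using assms by (cases "norm x \<le> q") (auto simp: indicator_def s'_def max_def min_def not_le simp del: zero_less_norm_iff)
      qed
    qed
    also have "\<dots> = ennreal (V * (q ^ n - s' ^ n))"
      using emeasure_norm_greater[where 'n='n, OF s'] by (simp add: V_def n_def)
    finally show "emeasure ?M {s<..} = ennreal (V * (q ^ n - s' ^ n))" .
    have "emeasure ?N {s<..} =
       (\<integral>\<^sup>+r. ennreal (n * V * r ^ (n - 1)) * indicator {0..q} r * indicator {s<..} r \<partial>lborel)"
      by (subst emeasure_density) (auto simp: n_def V_def)
    also have "\<dots> = (\<integral>\<^sup>+r. ennreal (n * V * r ^ (n - 1)) * indicator {s'..q} r \<partial>lborel)"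
    proof (rule nn_integral_cong_AE)
      have "AE r in lborel. r \<noteq> s'" "AE r in lborel. r \<noteq> q"
        by (rule AE_lborel_singleton)+
      then show "AE r in lborel. ennreal (n * V * r ^ (n - 1)) * indicator {0..q} r * indicator {s<..} r =
          ennreal (n * V * r ^ (n - 1)) * indicator {s'..q} r"
        by eventually_elim (auto simp: indicator_def s'_def max_def min_def split: if_splits)
    qed
    also have "\<dots> = ennreal (V * q ^ n - V * s' ^ n)"
    proof (rule nn_integral_FTC_Icc)
      show "((\<lambda>r. V * r ^ n) has_real_derivative n * V * x ^ (n - 1)) (at x)" for x
        by (rule derivative_eq_intros refl | simp)+
    qed (use V s' in auto)
    finally show "emeasure ?N {s<..} = ennreal (V * (q ^ n - s' ^ n))"
      by (simp add: right_diff_distrib)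
  qed
  show ?thesis
  proof (rule measure_eqI_lessThan)
    show "emeasure ?M {s<..} < \<infinity>" for s
      unfolding eq[THEN conjunct1] by simp
    show "emeasure ?M {s<..} = emeasure ?N {s<..}" for s
      using eq[of s] by (simp only:)
  qed simp_all
qed

lemma LINT_annulus_radial:
  fixes F :: "real \<Rightarrow> real"
  assumes "0 \<le> p" "p \<le> q" and F: "continuous_on {p..q} F"
  shows "(LINT x:{x :: real^'n::finite. p \<le> norm x \<and> norm x \<le> q}|lborel. F (norm x)) =
    real CARD('n) * unit_ball_vol (real CARD('n)) * integral {p..q} (\<lambda>r. F r * r ^ (CARD('n) - 1))"
proof -
  define n where "n = CARD('n)"
  define V where "V = unit_ball_vol (real n)"
  have V: "V \<ge> 0" by (simp add: V_def)
  define g where "g = (\<lambda>r. indicator {p..q} r *\<^sub>R F r)"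
  have g[measurable]: "g \<in> borel_measurable borel"
    unfolding g_def by (rule borel_measurable_continuous_on_indicator[OF _ F]) simp
  have "(LINT x:{x :: real^'n. p \<le> norm x \<and> norm x \<le> q}|lborel. F (norm x)) =
      (LINT x|lborel. indicator (cball (0 :: real^'n) q) x *\<^sub>R g (norm x))"
    unfolding set_lebesgue_integral_def g_def
    by (intro Bochner_Integration.integral_cong) (auto simp: indicator_def)
  also have "\<dots> = (LINT x|density lborel (\<lambda>x. ennreal (indicator (cball (0 :: real^'n) q) x)). g (norm x))"
    by (rule integral_density[symmetric]) (auto intro!: borel_measurable_indicator simp: borel_closed)
  also have "\<dots> = (LINT r|distr (density lborel (indicator (cball (0 :: real^'n) q))) borel norm. g r)"
    by (subst integral_distr) (auto simp: ennreal_indicator)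
  also have "\<dots> = (LINT r|density lborel (\<lambda>r. ennreal (n * V * r ^ (n - 1) * indicator {0..q} r)). g r)"
    unfolding distr_norm_cball[where 'n='n, OF order_trans[OF assms(1,2)]]
    by (intro arg_cong2[of _ _ _ _ "integral\<^sup>L"] arg_cong2[of _ _ _ _ density] ext refl)
      (auto simp: indicator_def n_def V_def)
  also have "\<dots> = (LINT r|lborel. (n * V * r ^ (n - 1) * indicator {0..q} r) *\<^sub>R g r)"
    using V by (intro integral_density) (auto simp: indicator_def)
  also have "\<dots> = (LINT r:{p..q}|lborel. n * V * (F r * r ^ (n - 1)))"
    unfolding set_lebesgue_integral_def g_def using assms
    by (intro Bochner_Integration.integral_cong) (auto simp: indicator_def)
  also have "\<dots> = integral {p..q} (\<lambda>r. n * V * (F r * r ^ (n - 1)))"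
    by (intro set_borel_integral_eq_integral(2) borel_integrable_atLeastAtMost' continuous_intros F)
  finally show ?thesis by (simp add: n_def V_def)
qed

section \<open>Ordinary differential equations for the warping function\<close>

text \<open>The hypothesis is \<open>y G'' = 2 y' (G' - 1)\<close> for \<open>G = y y'\<close>, so \<open>G' - 1\<close> is a constant multiple
  \<open>2 \<kappa> y\<^sup>2\<close> of \<open>y\<^sup>2\<close>. Then \<open>y\<^sup>2 (y'\<^sup>2 - 1 - \<kappa> y\<^sup>2)\<close> has derivative \<open>2 y y' (G' - 1 - 2 \<kappa> y\<^sup>2) = 0\<close>, and its
  value at \<open>0\<close> is \<open>0\<close>. Subtracting the two identities leaves \<open>y'' = \<kappa> y\<close>. One-sided derivatives
  at \<open>0\<close> are the reason for working within \<open>I\<close>.\<close>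

lemma third_order_ode_imp_linear_ode:
  fixes y y1 y2 y3 :: "real \<Rightarrow> real"
  assumes d: "\<And>a. a \<in> I \<Longrightarrow> (y has_real_derivative y1 a) (at a within I)"
      "\<And>a. a \<in> I \<Longrightarrow> (y1 has_real_derivative y2 a) (at a within I)"
      "\<And>a. a \<in> I \<Longrightarrow> (y2 has_real_derivative y3 a) (at a within I)"
    and I: "convex I" "0 \<in> I" "I \<subseteq> {0..}" "at 0 within I \<noteq> bot" and "y 0 = 0" "y1 0 = 1" and pos: "\<And>a. a \<in> I \<Longrightarrow> 0 < a \<Longrightarrow> 0 < y a"
    and eq: "\<And>a. a \<in> I \<Longrightarrow> 0 < a \<Longrightarrow>
      y a * (3 * y1 a * y2 a + y a * y3 a) = 2 * y1 a * ((y1 a)\<^sup>2 + y a * y2 a - 1)"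
  shows "\<exists>\<kappa>. \<forall>a\<in>I. (y1 has_real_derivative \<kappa> * y a) (at a within I)"
proof -
  define Q where "Q = (\<lambda>a. ((y1 a)\<^sup>2 + y a * y2 a - 1) / (y a)\<^sup>2)"
  have cx: "convex (I \<inter> {0<..})" using I by (intro convex_Int) auto
  have sub: "(I \<inter> {0<..}) \<subseteq> I" by auto
  have "\<exists>c. \<forall>a\<in>(I \<inter> {0<..}). Q a = c"
  proof (rule has_field_derivative_zero_constant[OF cx])
    fix a assume a: "a \<in> (I \<inter> {0<..})"
    note d' = DERIV_subset[OF _ sub]
    have "(Q has_real_derivative
        ((2 * y1 a * y2 a + (y1 a * y2 a + y a * y3 a)) * (y a)\<^sup>2
          - ((y1 a)\<^sup>2 + y a * y2 a - 1) * (2 * y a * y1 a)) / ((y a)\<^sup>2 * (y a)\<^sup>2)) (at a within (I \<inter> {0<..}))"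
      unfolding Q_def using a pos[of a]
      by (auto intro!: derivative_eq_intros d[THEN d'])
    moreover have "(2 * y1 a * y2 a + (y1 a * y2 a + y a * y3 a)) * (y a)\<^sup>2
          - ((y1 a)\<^sup>2 + y a * y2 a - 1) * (2 * y a * y1 a) = 0"
    proof -
      have "(2 * y1 a * y2 a + (y1 a * y2 a + y a * y3 a)) * (y a)\<^sup>2
          - ((y1 a)\<^sup>2 + y a * y2 a - 1) * (2 * y a * y1 a) =
        y a * (y a * (3 * y1 a * y2 a + y a * y3 a) - 2 * y1 a * ((y1 a)\<^sup>2 + y a * y2 a - 1))"
        by (simp add: algebra_simps power2_eq_square)
      then show ?thesis using eq[of a] a by simp
    qed
    ultimately show "(Q has_real_derivative 0) (at a within (I \<inter> {0<..}))" by simp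
  qed
  then obtain c where c: "\<And>a. a \<in> I \<Longrightarrow> 0 < a \<Longrightarrow> Q a = c" by auto
  define \<kappa> where "\<kappa> = c / 2"
  have g: "(y1 a)\<^sup>2 + y a * y2 a - 1 = 2 * \<kappa> * (y a)\<^sup>2" if "a \<in> I" "0 < a" for a
    using c[OF that] pos[OF that] by (simp add: Q_def \<kappa>_def field_simps)
  define E where "E = (\<lambda>a. (y a)\<^sup>2 * ((y1 a)\<^sup>2 - 1 - \<kappa> * (y a)\<^sup>2))"
  have "\<exists>c. \<forall>a\<in>I. E a = c"
  proof (rule has_field_derivative_zero_constant[OF I(1)])
    fix a assume a: "a \<in> I"
    have "(E has_real_derivative 2 * y a * y1 a * ((y1 a)\<^sup>2 + y a * y2 a - 1 - 2 * \<kappa> * (y a)\<^sup>2)) (at a within I)"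
      unfolding E_def using a
      by (auto intro!: derivative_eq_intros d simp: algebra_simps power2_eq_square)
    moreover have "y a * ((y1 a)\<^sup>2 + y a * y2 a - 1 - 2 * \<kappa> * (y a)\<^sup>2) = 0"
      using g[of a] a \<open>y 0 = 0\<close> I(3) by (cases "a = 0") (auto simp: subset_iff less_eq_real_def)
    ultimately show "(E has_real_derivative 0) (at a within I)"
      by (metis mult.assoc mult.commute mult_zero_left)
  qed
  then have c_E: "\<exists>c. \<forall>a\<in>I. E a = c" .
  have E0: "E a = 0" if "a \<in> I" for a
  proof -
    have "E a = E 0" using c_E that I(2) by auto
    then show ?thesis using \<open>y 0 = 0\<close> by (simp add: E_def)
  qed
  have pos2: "y2 a = \<kappa> * y a" if "a \<in> I" "0 < a" for a
  proof -
    have "(y1 a)\<^sup>2 = 1 + \<kappa> * (y a)\<^sup>2"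
      using E0[of a] that pos[OF that] by (simp add: E_def)
    with g[OF that] have "y a * y2 a = y a * (\<kappa> * y a)"
      by (simp add: algebra_simps power2_eq_square)
    then show ?thesis using pos[OF that] by simp
  qed
  have "y2 0 = \<kappa> * y 0"
  proof -
    have "((\<lambda>a. y2 a - \<kappa> * y a) \<longlongrightarrow> y2 0 - \<kappa> * y 0) (at 0 within I)"
      using d[of 0] I(2) by (intro tendsto_intros) (auto simp: continuous_within[symmetric] intro: DERIV_continuous)
    moreover have "((\<lambda>a. y2 a - \<kappa> * y a) \<longlongrightarrow> 0) (at 0 within I)"
    proof (rule Lim_transform_eventually[OF tendsto_const])
      have "0 = y2 a - \<kappa> * y a" if "a \<noteq> 0" "a \<in> I" for a
        using that I(3) pos2[of a] by force
      then show "\<forall>\<^sub>F a in at 0 within I. 0 = y2 a - \<kappa> * y a"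
        by (simp add: eventually_at_filter always_eventually)
    qed
    ultimately show ?thesis using tendsto_unique[OF I(4)] by force
  qed
  with pos2 have "y2 a = \<kappa> * y a" if "a \<in> I" for a
    using that I(3) by (cases "a = 0") (auto simp: subset_iff less_eq_real_def)
  with d(2) show ?thesis by metis
qed

text \<open>The pair \<open>(d y, y')\<close>, rotated back by the angle \<open>d a\<close>, is constant. The hyperbolic case is
  analogous.\<close>

lemma linear_ode_sin:
  fixes y y1 :: "real \<Rightarrow> real"
  assumes I: "convex I" "0 \<in> I" and "0 < d" "y 0 = 0" "y1 0 = 1"
    and D: "\<And>a. a \<in> I \<Longrightarrow> (y has_real_derivative y1 a) (at a within I)"
      "\<And>a. a \<in> I \<Longrightarrow> (y1 has_real_derivative - (d\<^sup>2) * y a) (at a within I)"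
    and a: "a \<in> I"
  shows "y a = (1 / d) * sin (d * a)"
proof -
  define B where "B = (\<lambda>a. y1 a * cos (d * a) + d * y a * sin (d * a))"
  define C where "C = (\<lambda>a. y1 a * sin (d * a) - d * y a * cos (d * a))"
  have "\<exists>c. \<forall>a\<in>I. B a = c"
    by (rule has_field_derivative_zero_constant[OF I(1)])
      (auto simp: B_def algebra_simps power2_eq_square intro!: derivative_eq_intros D)
  then have B: "B a = B 0" using a I(2) by auto
  have "\<exists>c. \<forall>a\<in>I. C a = c"
    by (rule has_field_derivative_zero_constant[OF I(1)])
      (auto simp: C_def algebra_simps power2_eq_square intro!: derivative_eq_intros D)
  then have C: "C a = C 0" using a I(2) by auto
  have "d * y a = d * y a * ((sin (d * a))\<^sup>2 + (cos (d * a))\<^sup>2)" by simp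
  also have "\<dots> = B a * sin (d * a) - C a * cos (d * a)"
    unfolding B_def C_def by (simp only: algebra_simps power2_eq_square)
  also have "\<dots> = sin (d * a)" unfolding B C using assms by (simp add: B_def C_def)
  finally show ?thesis using \<open>0 < d\<close> by (simp add: field_simps)
qed

lemma linear_ode_sinh:
  fixes y y1 :: "real \<Rightarrow> real"
  assumes I: "convex I" "0 \<in> I" and "0 < d" "y 0 = 0" "y1 0 = 1"
    and D: "\<And>a. a \<in> I \<Longrightarrow> (y has_real_derivative y1 a) (at a within I)"
      "\<And>a. a \<in> I \<Longrightarrow> (y1 has_real_derivative d\<^sup>2 * y a) (at a within I)"
    and a: "a \<in> I"
  shows "y a = (1 / d) * sinh (d * a)"
proof -
  define B where "B = (\<lambda>a. y1 a * cosh (d * a) - d * y a * sinh (d * a))"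
  define C where "C = (\<lambda>a. y1 a * sinh (d * a) - d * y a * cosh (d * a))"
  have "\<exists>c. \<forall>a\<in>I. B a = c"
    by (rule has_field_derivative_zero_constant[OF I(1)])
      (auto simp: B_def algebra_simps power2_eq_square intro!: derivative_eq_intros D)
  then have B: "B a = B 0" using a I(2) by auto
  have "\<exists>c. \<forall>a\<in>I. C a = c"
    by (rule has_field_derivative_zero_constant[OF I(1)])
      (auto simp: C_def algebra_simps power2_eq_square intro!: derivative_eq_intros D)
  then have C: "C a = C 0" using a I(2) by auto
  have "d * y a * ((cosh (d * a))\<^sup>2 - (sinh (d * a))\<^sup>2) = B a * sinh (d * a) - C a * cosh (d * a)"
    by (simp add: B_def C_def algebra_simps power2_eq_square)
  also have "\<dots> = sinh (d * a)" unfolding B C using assms by (simp add: B_def C_def)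
  finally show ?thesis using \<open>0 < d\<close> by (simp add: field_simps hyperbolic_pythagoras)
qed

lemma linear_ode_identity:
  fixes y y1 :: "real \<Rightarrow> real"
  assumes I: "convex I" "0 \<in> I" and "y 0 = 0" "y1 0 = 1"
    and D: "\<And>a. a \<in> I \<Longrightarrow> (y has_real_derivative y1 a) (at a within I)"
      "\<And>a. a \<in> I \<Longrightarrow> (y1 has_real_derivative 0) (at a within I)"
    and a: "a \<in> I"
  shows "y a = a"
proof -
  have "\<exists>c. \<forall>a\<in>I. y1 a = c"
    by (rule has_field_derivative_zero_constant[OF I(1)]) (auto intro!: D)
  then have y1: "y1 a = 1" if "a \<in> I" for a using assms(2,4) that by auto
  have "\<exists>c. \<forall>a\<in>I. y a - a = c"
    by (rule has_field_derivative_zero_constant[OF I(1)])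
      (auto intro!: derivative_eq_intros D simp: y1)
  then obtain k where "\<forall>a\<in>I. y a - a = k" ..
  from bspec[OF this, of 0] bspec[OF this, of a] show ?thesis using assms a by auto
qed

section \<open>Conformal rotationally symmetric maps\<close>

definition radial_interval :: "ereal \<Rightarrow> real set" where
  "radial_interval R = {r. 0 \<le> r \<and> ereal r < R}"

lemma has_derivative_rot_map:
  fixes x :: "real^'n::finite"
  assumes "x \<noteq> 0" "(\<beta> has_real_derivative \<beta>') (at (norm x))"
  shows "(rot_map \<beta> has_derivative
    (\<lambda>v. (\<beta>' * dr x v) *\<^sub>R (x /\<^sub>R norm x) + \<beta> (norm x) *\<^sub>R d_theta x v)) (at x)"
proof -
  define r where "r = norm x"
  have r: "r > 0" using assms by (simp add: r_def)
  have n: "(norm has_derivative dr x) (at x)"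
    using has_derivative_norm[OF assms(1)] by (simp add: dr_def[abs_def] sgn_div_norm inner_commute)
  have b: "((\<lambda>y. \<beta> (norm y)) has_derivative (\<lambda>v. \<beta>' * dr x v)) (at x)"
    using has_derivative_compose[OF n assms(2)[THEN has_field_derivative_imp_has_derivative]] by simp
  have i: "((\<lambda>y. inverse (norm y)) has_derivative (\<lambda>v. - (dr x v) / r\<^sup>2)) (at x)"
    by (rule has_derivative_eq_rhs[OF Deriv.has_derivative_inverse[OF _ n]])
      (use assms r in \<open>auto simp: r_def fun_eq_iff divide_inverse power2_eq_square\<close>)
  have "((\<lambda>y. \<beta> (norm y) *\<^sub>R (inverse (norm y) *\<^sub>R y)) has_derivative
    (\<lambda>v. \<beta> r *\<^sub>R (inverse r *\<^sub>R v + (- (dr x v) / r\<^sup>2) *\<^sub>R x) + (\<beta>' * dr x v) *\<^sub>R (inverse r *\<^sub>R x))) (at x)"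
    unfolding r_def
    by (rule has_derivative_scaleR[OF b has_derivative_scaleR[OF i[unfolded r_def] has_derivative_ident]])
  moreover have "inverse r *\<^sub>R v + (- (dr x v) / r\<^sup>2) *\<^sub>R x = d_theta x v" for v
    by (simp add: d_theta_def r_def[symmetric] scaleR_diff_right divide_inverse power2_eq_square mult_ac)
  ultimately show ?thesis
    by (simp add: rot_map_def[abs_def] r_def add.commute)
qed

text \<open>The arguments are the values of the differential of \<open>rot_map \<beta>\<close> at \<open>x\<close>, by
  \<open>has_derivative_rot_map\<close>. The pulled-back metric stretches the sphere directions by \<open>h(\<beta>)/r\<close> and
  the radial direction by \<open>\<beta>'\<close>.\<close>

lemma model_metric_rot_map:
  fixes x :: "real^'n::finite"
  assumes "x \<noteq> 0" "0 < \<beta> (norm x)"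
  shows "model_metric h (rot_map \<beta> x)
      ((\<beta>' * dr x v) *\<^sub>R (x /\<^sub>R norm x) + \<beta> (norm x) *\<^sub>R d_theta x v)
      ((\<beta>' * dr x w) *\<^sub>R (x /\<^sub>R norm x) + \<beta> (norm x) *\<^sub>R d_theta x w) =
    (h (\<beta> (norm x)) / norm x)\<^sup>2 * (v \<bullet> w - dr x v * dr x w) + \<beta>'\<^sup>2 * (dr x v * dr x w)"
proof -
  define r where "r = norm x"
  have r: "r > 0" using assms by (simp add: r_def)
  define u where "u = x /\<^sub>R r"
  have uu: "u \<bullet> u = 1" using r by (simp add: u_def r_def power2_norm_eq_inner[symmetric] power2_eq_square)
  define y where "y = rot_map \<beta> x"
  have b: "\<beta> r > 0" using assms by (simp add: r_def)
  have y: "y = \<beta> r *\<^sub>R u" by (simp add: y_def rot_map_def r_def u_def)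
  have nu: "norm u = 1" using uu by (simp add: norm_eq_1)
  have ny: "norm y = \<beta> r" using b by (simp add: y nu)
  have yu: "y /\<^sub>R norm y = u" using b ny by (simp add: y)
  have y0: "y \<noteq> 0" using ny b by auto
  have dx: "dr x v = u \<bullet> v" "d_theta x v = (v - (u \<bullet> v) *\<^sub>R u) /\<^sub>R r" for v
    by (simp_all add: dr_def d_theta_def u_def r_def)
  define D where "D = (\<lambda>v. (\<beta>' * dr x v) *\<^sub>R u + \<beta> r *\<^sub>R d_theta x v)"
  have u_perp: "u \<bullet> d_theta x v = 0" for v
    by (simp add: dx inner_diff_right uu)
  have dD: "dr y (D v) = \<beta>' * dr x v" for v
    by (simp add: dr_def[of y] yu D_def inner_add_right u_perp uu)
  have tD: "d_theta y (D v) = d_theta x v" for v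
  proof -
    have "d_theta y (D v) = (D v - dr y (D v) *\<^sub>R (y /\<^sub>R norm y)) /\<^sub>R norm y"
      by (rule d_theta_def)
    also have "\<dots> = (D v - (\<beta>' * dr x v) *\<^sub>R u) /\<^sub>R norm y"
      unfolding dD yu ..
    also have "\<dots> = d_theta x v" using b by (simp add: D_def ny)
    finally show ?thesis .
  qed
  have tt: "d_theta x v \<bullet> d_theta x w = (v \<bullet> w - dr x v * dr x w) / r\<^sup>2"
  proof -
    have "d_theta x v \<bullet> d_theta x w = ((v - (u \<bullet> v) *\<^sub>R u) \<bullet> (w - (u \<bullet> w) *\<^sub>R u)) / r\<^sup>2"
      by (simp add: dx power2_eq_square divide_inverse mult.assoc)
    also have "(v - (u \<bullet> v) *\<^sub>R u) \<bullet> (w - (u \<bullet> w) *\<^sub>R u) = v \<bullet> w - dr x v * dr x w"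
      by (simp add: inner_diff_left inner_diff_right uu dx inner_commute[of v u] algebra_simps)
    finally show ?thesis .
  qed
  have "model_metric h y (D v) (D w) =
     (h (\<beta> r) / r)\<^sup>2 * (v \<bullet> w - dr x v * dr x w) + \<beta>'\<^sup>2 * (dr x v * dr x w)"
    using y0 by (simp add: model_metric_def dD tD tt ny power2_eq_square)
  then show ?thesis by (simp add: D_def y_def u_def r_def)
qed

text \<open>A radial unit vector and a unit vector orthogonal to it are stretched by the same factor. The
  second one exists only from dimension 2 on.\<close>

lemma conformal_imp_profile_square:
  assumes conf: "conformal U flat_metric V (model_metric h) (rot_map \<beta> :: real^'n::finite \<Rightarrow> real^'n)"
    and U: "\<And>x. norm x = r \<Longrightarrow> x \<in> U"
    and r: "0 < r" and pos: "0 < \<beta> r" and \<beta>': "(\<beta> has_real_derivative \<beta>') (at r)"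
    and card: "2 \<le> CARD('n)"
  shows "\<beta>'\<^sup>2 = (h (\<beta> r) / r)\<^sup>2"
proof -
  obtain i j :: 'n where ij: "i \<noteq> j"
    using card card_le_Suc0_iff_eq[of "UNIV :: 'n set"] by auto
  define x where "x = r *\<^sub>R axis i (1::real)"
  have nx: "norm x = r" and x0: "x \<noteq> 0" using r by (auto simp: x_def axis_eq_0_iff)
  have xU: "x \<in> U" using U nx by simp
  obtain \<rho> where \<rho>: "\<And>v w. model_metric h (rot_map \<beta> x) (frechet_derivative (rot_map \<beta>) (at x) v)
      (frechet_derivative (rot_map \<beta>) (at x) w) = \<rho>\<^sup>2 * (v \<bullet> w)"
    using conf xU unfolding conformal_def flat_metric_def by meson
  have fd: "frechet_derivative (rot_map \<beta>) (at x) =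
     (\<lambda>v. (\<beta>' * dr x v) *\<^sub>R (x /\<^sub>R norm x) + \<beta> (norm x) *\<^sub>R d_theta x v)"
    by (rule frechet_derivative_at[OF has_derivative_rot_map[OF x0], symmetric]) (use \<beta>' nx in simp)
  have m: "(h (\<beta> r) / r)\<^sup>2 * (v \<bullet> v - dr x v * dr x v) + \<beta>'\<^sup>2 * (dr x v * dr x v) = \<rho>\<^sup>2 * (v \<bullet> v)" for v
    using \<rho>[of v v] model_metric_rot_map[of x \<beta> h \<beta>' v v] x0 pos unfolding fd nx by simp
  have "dr x (axis i 1) = 1" "dr x (axis j 1) = 0"
    using r ij nx by (simp_all add: dr_def x_def inner_axis_axis)
  with m[of "axis i 1"] m[of "axis j 1"] show ?thesis by (simp add: inner_axis_axis)
qed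

text \<open>The origin is a separate case, because the formula for the differential breaks down there.\<close>

lemma conformal_rot_mapI:
  fixes U :: "(real^'n::finite) set"
  assumes "rot_map \<beta> ` U \<subseteq> V"
    and "\<And>x. x \<in> U \<Longrightarrow> x \<noteq> 0 \<Longrightarrow> 0 < \<beta> (norm x) \<and> 0 < h (\<beta> (norm x)) \<and>
      (\<beta> has_real_derivative h (\<beta> (norm x)) / norm x) (at (norm x))"
    and zero: "0 < \<rho>0" "rot_map \<beta> differentiable (at (0 :: real^'n))"
      "\<And>v w :: real^'n. model_metric h (rot_map \<beta> 0) (frechet_derivative (rot_map \<beta>) (at 0) v)
        (frechet_derivative (rot_map \<beta>) (at 0) w) = \<rho>0\<^sup>2 * (v \<bullet> w)"
  shows "conformal U flat_metric V (model_metric h) (rot_map \<beta>)"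
proof -
  define \<rho> where "\<rho> = (\<lambda>x :: real^'n. if x = 0 then \<rho>0 else h (\<beta> (norm x)) / norm x)"
  have "rot_map \<beta> differentiable (at x)" if "x \<in> U" for x
    using differentiableI[OF has_derivative_rot_map] assms(2)[OF that] zero(2) by (cases "x = 0") auto
  moreover have "0 < \<rho> x" if "x \<in> U" for x
    using assms(2)[OF that] zero(1) by (auto simp: \<rho>_def)
  moreover have "model_metric h (rot_map \<beta> x) (frechet_derivative (rot_map \<beta>) (at x) v)
       (frechet_derivative (rot_map \<beta>) (at x) w) = (\<rho> x)\<^sup>2 * flat_metric x v w" if "x \<in> U" for x v w
  proof (cases "x = 0")
    case True
    then show ?thesis using zero(3) by (simp add: \<rho>_def flat_metric_def)
  next
    case False
    note a = assms(2)[OF that False]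
    have "frechet_derivative (rot_map \<beta>) (at x) =
     (\<lambda>v. (h (\<beta> (norm x)) / norm x * dr x v) *\<^sub>R (x /\<^sub>R norm x) + \<beta> (norm x) *\<^sub>R d_theta x v)"
      by (rule frechet_derivative_at[OF has_derivative_rot_map[OF False], symmetric]) (use a in simp)
    then show ?thesis
      using model_metric_rot_map[of x \<beta> h "h (\<beta> (norm x)) / norm x" v w] False a
      by (simp add: \<rho>_def flat_metric_def algebra_simps)
  qed
  ultimately show ?thesis using assms(1) unfolding conformal_def by (intro conjI exI[of _ \<rho>]) auto
qed

text \<open>Since \<open>\<alpha>\<close> increases from \<open>0\<close> to a positive value, its derivative is positive somewhere, and by
  the intermediate value theorem it cannot change sign.\<close>

lemma positive_derivative_of_nonvanishing:
  fixes \<alpha> \<alpha>' :: "real \<Rightarrow> real"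
  assumes "\<alpha> 0 = 0" "0 < r" "0 < \<alpha> r"
    and cont: "continuous_on {0..r} \<alpha>" "continuous_on {0<..r} \<alpha>'"
    and D: "\<And>s. 0 < s \<Longrightarrow> s \<le> r \<Longrightarrow> (\<alpha> has_real_derivative \<alpha>' s) (at s)"
    and nz: "\<And>s. 0 < s \<Longrightarrow> s \<le> r \<Longrightarrow> \<alpha>' s \<noteq> 0"
  shows "0 < \<alpha>' r"
proof (rule ccontr)
  assume "\<not> 0 < \<alpha>' r"
  obtain z where z: "0 < z" "z < r" "\<alpha> r - \<alpha> 0 = (r - 0) * \<alpha>' z"
  proof (rule mvt[OF assms(2) cont(1)])
    show "(\<alpha> has_derivative (\<lambda>v. v * \<alpha>' s)) (at s)" if "0 < s" "s < r" for s
      using D[of s] that by (simp add: has_field_derivative_def mult_commute_abs)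
  qed
  have pz: "0 < \<alpha>' z"
    using z assms by (simp add: zero_less_mult_iff)
  have "\<exists>s\<ge>z. s \<le> r \<and> \<alpha>' s = 0"
    by (rule IVT2') (use pz z \<open>\<not> 0 < \<alpha>' r\<close> in \<open>auto intro: continuous_on_subset[OF cont(2)]\<close>)
  then show False using nz z by auto
qed

lemma Icc_radial_interval: "r \<in> radial_interval R \<Longrightarrow> {0..r} \<subseteq> radial_interval R"
  unfolding radial_interval_def by (cases R) auto

lemma convex_radial_interval: "convex (radial_interval R)"
  unfolding is_interval_convex_1[symmetric] is_interval_1
proof (intro ballI allI impI)
  fix r s t assume "r \<in> radial_interval R" "s \<in> radial_interval R" "r \<le> t \<and> t \<le> s"
  then have "t \<in> {0..s}" by (simp add: radial_interval_def)
  then show "t \<in> radial_interval R" using Icc_radial_interval[OF \<open>s \<in> radial_interval R\<close>] by blast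
qed

lemma open_radial_interior: "open {r. 0 < r \<and> ereal r < R}"
proof (cases R)
  case (real \<rho>)
  then have "{r. 0 < r \<and> ereal r < R} = {0<..<\<rho>}" by auto
  then show ?thesis by (simp only: open_greaterThanLessThan)
next
  case PInf
  then have "{r. 0 < r \<and> ereal r < R} = {0<..}" by auto
  then show ?thesis by (simp only: open_greaterThan)
next
  case MInf
  then have "{r. 0 < r \<and> ereal r < R} = {}" by auto
  then show ?thesis by (simp only: open_empty)
qed

lemma open_geodesic_ball: "open (geodesic_ball R :: (real^'n::finite) set)"
proof (cases R)
  case (real \<rho>)
  then have "(geodesic_ball R :: (real^'n) set) = ball 0 \<rho>" by (auto simp: geodesic_ball_def)
  then show ?thesis by simp
next
  case PInf
  then have "(geodesic_ball R :: (real^'n) set) = UNIV" by (auto simp: geodesic_ball_def)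
  then show ?thesis by simp
next
  case MInf
  then have "(geodesic_ball R :: (real^'n) set) = {}" by (auto simp: geodesic_ball_def)
  then show ?thesis by simp
qed

lemma at_within_radial_interval:
  assumes "0 < r" "ereal r < R" "{r. 0 < r \<and> ereal r < R} \<subseteq> I"
  shows "at r within I = at r"
  by (rule at_within_open_subset[OF _ open_radial_interior assms(3)]) (simp add: assms(1,2))

lemma model_derivatives:
  assumes "model b h"
  obtains H :: "nat \<Rightarrow> real \<Rightarrow> real" where "H 0 = h"
    "\<And>n a. a \<in> model_interval b \<Longrightarrow> (H n has_real_derivative H (Suc n) a) (at a within model_interval b)"
    "\<And>n a. 0 < a \<Longrightarrow> ereal a < b \<Longrightarrow> (H n has_real_derivative H (Suc n) a) (at a)"
proof -
  have "smooth_on_interval (model_interval b) h" using assms unfolding model_def by blast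
  then obtain H where H0: "H 0 = h"
    and H: "\<forall>n. \<forall>a\<in>model_interval b. (H n has_real_derivative H (Suc n) a) (at a within model_interval b)"
    unfolding smooth_on_interval_def by blast
  have "(H n has_real_derivative H (Suc n) a) (at a)" if "0 < a" "ereal a < b" for n a
  proof -
    have "at a within model_interval b = at a"
      by (rule at_within_radial_interval[OF that]) (auto simp: model_interval_def)
    moreover have "a \<in> model_interval b"
      using that by (simp add: model_interval_def less_imp_le)
    ultimately show ?thesis using H by metis
  qed
  with that H0 H show ?thesis by blast
qed

text \<open>Conformality gives \<open>\<alpha>'\<^sup>2 = (h(\<alpha>)/r)\<^sup>2\<close>. The right-hand side is positive, because the map avoids
  the south pole, so the sign of \<open>\<alpha>'\<close> is constant, and it is the positive one.\<close>

lemma profile_ode: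
  fixes \<alpha> h :: "real \<Rightarrow> real"
  assumes model: "model b h" and rot: "rotationally_symmetric R b \<alpha>"
    and conf: "conformal (geodesic_ball R) flat_metric (geodesic_ball b) (model_metric h)
      (rot_map \<alpha> :: real^'n::finite \<Rightarrow> real^'n)"
    and card: "2 \<le> CARD('n)"
  shows "\<And>r. 0 \<le> r \<Longrightarrow> ereal r < R \<Longrightarrow> ereal (\<alpha> r) < b"
    and "\<And>r. 0 < r \<Longrightarrow> ereal r < R \<Longrightarrow> (\<alpha> has_real_derivative h (\<alpha> r) / r) (at r)"
proof -
  have pos: "0 < \<alpha> r" if "0 < r" "ereal r < R" for r
    using rot that by (simp add: rotationally_symmetric_def)
  have "smooth_on_interval (radial_interval R) \<alpha>"
    using rot by (simp add: rotationally_symmetric_def radial_interval_def)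
  then obtain D where D0: "D 0 = \<alpha>"
    and "\<forall>n. \<forall>x\<in>radial_interval R. (D n has_real_derivative D (Suc n) x) (at x within radial_interval R)"
    unfolding smooth_on_interval_def by blast
  then have D: "(D n has_real_derivative D (Suc n) x) (at x within radial_interval R)"
    if "0 \<le> x" "ereal x < R" for n x
    using that by (simp add: radial_interval_def)
  have mpos: "0 < h a" if "0 < a" "ereal a < b" for a
    using model that unfolding model_def by blast
  have into: "rot_map \<alpha> ` (geodesic_ball R :: (real^'n) set) \<subseteq> geodesic_ball b"
    using conf unfolding conformal_def by (rule conjunct1)
  have Di: "(D n has_real_derivative D (Suc n) x) (at x)" if "0 < x" "ereal x < R" for n x
  proof -
    have "at x within radial_interval R = at x"
      by (rule at_within_radial_interval[OF that]) (auto simp: radial_interval_def)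
    then show ?thesis using D[of x n] that by simp
  qed
  show less: "ereal (\<alpha> r) < b" if "0 \<le> r" "ereal r < R" for r
  proof (cases "r = 0")
    case True
    then show ?thesis using rot model by (simp add: rotationally_symmetric_def model_def zero_ereal_def)
  next
    case False
    define x :: "real^'n" where "x = r *\<^sub>R axis undefined 1"
    have "norm x = r" using that by (simp add: x_def)
    then have "rot_map \<alpha> x \<in> geodesic_ball b"
      using into that by (auto simp: geodesic_ball_def)
    moreover have "norm (rot_map \<alpha> x) = \<alpha> r"
      using pos[of r] that False \<open>norm x = r\<close> by (auto simp: rot_map_def)
    ultimately show ?thesis by (simp add: geodesic_ball_def)
  qed
  show "(\<alpha> has_real_derivative h (\<alpha> r) / r) (at r)" if r: "0 < r" "ereal r < R" for r
  proof -
    have h: "0 < h (\<alpha> s)" if "0 < s" "ereal s < R" for s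
      using mpos[OF pos[OF that]] less[of s] that by simp
    have sq: "(D 1 s)\<^sup>2 = (h (\<alpha> s) / s)\<^sup>2" if "0 < s" "ereal s < R" for s
      by (rule conformal_imp_profile_square[OF conf _ that(1) pos[OF that] _ card])
        (use that Di[of s 0] D0 in \<open>auto simp: geodesic_ball_def\<close>)
    have below: "ereal s < R" if "s \<le> r" for s
      using that r(2) by (meson ereal_less_eq(3) le_less_trans)
    have "0 < D 1 r"
    proof (rule positive_derivative_of_nonvanishing[where \<alpha>=\<alpha> and r=r, OF _ r(1) pos[OF r]])
      show "\<alpha> 0 = 0" using rot by (simp add: rotationally_symmetric_def)
      show "continuous_on {0..r} \<alpha>"
      proof (rule continuous_on_subset)
        show "continuous_on (radial_interval R) \<alpha>"
          by (rule DERIV_continuous_on[of _ _ "D 1"]) (use D[of _ 0] D0 in \<open>auto simp: radial_interval_def\<close>)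
      qed (use below in \<open>auto simp: radial_interval_def\<close>)
      show "continuous_on {0<..r} (D 1)"
        by (intro continuous_at_imp_continuous_on ballI DERIV_isCont[OF Di]) (use below in auto)
      show "(\<alpha> has_real_derivative D 1 s) (at s)" if "0 < s" "s \<le> r" for s
        using Di[of s 0] D0 below that by simp
      show "D 1 s \<noteq> 0" if "0 < s" "s \<le> r" for s
        using sq[of s] h[of s] below that by auto
    qed
    then have "D 1 r = h (\<alpha> r) / r"
      using sq[OF r] h[OF r] r by (simp add: power2_eq_iff_nonneg less_imp_le)
    then show ?thesis using Di[OF r, of 0] D0 by simp
  qed
qed

section \<open>Extension of bounded profiles\<close>

text \<open>A set of functions that is closed under differentiation consists of smooth functions. This
  avoids an explicit formula for the iterated derivatives.\<close>

lemma smooth_on_interval_derivation_closed: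
  assumes "\<And>f. f \<in> X \<Longrightarrow> \<exists>f'\<in>X. \<forall>x\<in>I. (f has_real_derivative f' x) (at x within I)"
    and "f \<in> X"
  shows "smooth_on_interval I f"
proof -
  obtain d where d: "\<And>f. f \<in> X \<Longrightarrow> d f \<in> X"
    "\<And>f x. f \<in> X \<Longrightarrow> x \<in> I \<Longrightarrow> (f has_real_derivative d f x) (at x within I)"
    using assms(1) by metis
  have "(d ^^ n) f \<in> X" for n
    by (induction n) (auto simp: assms(2) d(1))
  then have "(d ^^ n) f \<in> X" "x \<in> I \<Longrightarrow> ((d ^^ n) f has_real_derivative (d ^^ Suc n) f x) (at x within I)" for n x
    using d(2) by auto
  then show ?thesis unfolding smooth_on_interval_def by (intro exI[of _ "\<lambda>n. (d ^^ n) f"]) simp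
qed

text \<open>The polynomials in \<open>1/r\<close>, \<open>\<beta>\<close> and the functions \<open>H n \<circ> \<beta>\<close>. If \<open>\<beta>' = H 0 (\<beta>)/r\<close> and
  \<open>H (Suc n)\<close> is the derivative of \<open>H n\<close>, this set is closed under differentiation.\<close>

inductive_set ode_jets :: "(nat \<Rightarrow> real \<Rightarrow> real) \<Rightarrow> (real \<Rightarrow> real) \<Rightarrow> (real \<Rightarrow> real) set"
  for H :: "nat \<Rightarrow> real \<Rightarrow> real" and \<beta> :: "real \<Rightarrow> real" where
  "\<beta> \<in> ode_jets H \<beta>"
| "(\<lambda>r. H n (\<beta> r)) \<in> ode_jets H \<beta>"
| "(\<lambda>r. 1 / r) \<in> ode_jets H \<beta>"
| "(\<lambda>r. - 1) \<in> ode_jets H \<beta>"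
| "(\<lambda>r. 0) \<in> ode_jets H \<beta>"
| "f \<in> ode_jets H \<beta> \<Longrightarrow> g \<in> ode_jets H \<beta> \<Longrightarrow> (\<lambda>r. f r + g r) \<in> ode_jets H \<beta>"
| "f \<in> ode_jets H \<beta> \<Longrightarrow> g \<in> ode_jets H \<beta> \<Longrightarrow> (\<lambda>r. f r * g r) \<in> ode_jets H \<beta>"

lemma smooth_on_interval_ode:
  assumes I: "\<And>r. r \<in> I \<Longrightarrow> 0 < r"
    and ode: "\<And>r. r \<in> I \<Longrightarrow> (\<beta> has_real_derivative H 0 (\<beta> r) / r) (at r)"
    and H: "\<And>n r. r \<in> I \<Longrightarrow> (H n has_real_derivative H (Suc n) (\<beta> r)) (at (\<beta> r))"
  shows "smooth_on_interval I \<beta>"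
proof (rule smooth_on_interval_derivation_closed)
  show "\<beta> \<in> ode_jets H \<beta>" by (rule ode_jets.intros)
  have ode': "(\<beta> has_real_derivative H 0 (\<beta> r) * (1 / r)) (at r within I)" if "r \<in> I" for r
    using has_field_derivative_at_within[OF ode[OF that]] by simp
  fix f assume "f \<in> ode_jets H \<beta>"
  then show "\<exists>f'\<in>ode_jets H \<beta>. \<forall>r\<in>I. (f has_real_derivative f' r) (at r within I)"
  proof induction
    case 1
    show ?case
      by (intro bexI[of _ "\<lambda>r. H 0 (\<beta> r) * (1 / r)"] ballI ode' ode_jets.intros)
  next
    case (2 n)
    have "((\<lambda>r. H n (\<beta> r)) has_real_derivative H (Suc n) (\<beta> r) * (H 0 (\<beta> r) * (1 / r))) (at r within I)"
      if "r \<in> I" for r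
      by (rule DERIV_chain2[OF H[OF that] ode'[OF that]])
    then show ?case
      by (intro bexI[of _ "\<lambda>r. H (Suc n) (\<beta> r) * (H 0 (\<beta> r) * (1 / r))"] ballI ode_jets.intros)
  next
    case 3
    have "((\<lambda>r. 1 / r) has_real_derivative - 1 * (1 / r * (1 / r))) (at r within I)" if "r \<in> I" for r
      using I[OF that] by (auto intro!: derivative_eq_intros)
    then show ?case
      by (intro bexI[of _ "\<lambda>r. - 1 * (1 / r * (1 / r))"] ballI ode_jets.intros)
  next
    case 4
    show ?case by (rule bexI[of _ "\<lambda>r. 0"]) (auto intro!: ode_jets.intros)
  next
    case 5
    show ?case by (rule bexI[of _ "\<lambda>r. 0"]) (auto intro!: ode_jets.intros)
  next
    case (6 f g)
    then obtain f' g' where *: "f' \<in> ode_jets H \<beta>" "g' \<in> ode_jets H \<beta>"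
      "\<forall>r\<in>I. (f has_real_derivative f' r) (at r within I)"
      "\<forall>r\<in>I. (g has_real_derivative g' r) (at r within I)" by blast
    then show ?case
      by (intro bexI[of _ "\<lambda>r. f' r + g' r"] ballI) (auto intro!: ode_jets.intros DERIV_add)
  next
    case (7 f g)
    then obtain f' g' where *: "f' \<in> ode_jets H \<beta>" "g' \<in> ode_jets H \<beta>"
      "\<forall>r\<in>I. (f has_real_derivative f' r) (at r within I)"
      "\<forall>r\<in>I. (g has_real_derivative g' r) (at r within I)" by blast
    have "((\<lambda>r. f r * g r) has_real_derivative f' r * g r + g' r * f r) (at r within I)" if "r \<in> I" for r
      using that * by (intro DERIV_mult) auto
    with * 7 show ?case
      by (intro bexI[of _ "\<lambda>r. f' r * g r + g' r * f r"] ballI) (auto intro!: ode_jets.intros)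
  qed
qed

text \<open>Derivatives are unique on the overlap, so the two derivative sequences can be switched at an
  interior point \<open>s\<close> of it.\<close>

lemma smooth_on_interval_glue:
  fixes R R' :: real
  assumes "0 < R" "R \<le> R'"
    and "smooth_on_interval {0..<R} g" "smooth_on_interval {0<..<R'} f"
    and fg: "\<And>r. r < R \<Longrightarrow> f r = g r"
  shows "smooth_on_interval {0..<R'} f"
proof -
  obtain D where D: "D 0 = g" "\<And>n x. x \<in> {0..<R} \<Longrightarrow> (D n has_real_derivative D (Suc n) x) (at x within {0..<R})"
    using assms(3) unfolding smooth_on_interval_def by blast
  obtain E where E: "E 0 = f" "\<And>n x. x \<in> {0<..<R'} \<Longrightarrow> (E n has_real_derivative E (Suc n) x) (at x within {0<..<R'})"
    using assms(4) unfolding smooth_on_interval_def by blast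
  have E': "(E n has_real_derivative E (Suc n) x) (at x)" if "0 < x" "x < R'" for n x
    using E(2)[of x n] that by (simp add: at_within_open[of x "{0<..<R'}"])
  have D': "(D n has_real_derivative D (Suc n) x) (at x)" if "0 < x" "x < R" for n x
  proof -
    have "at x within {0..<R} = at x"
      by (rule at_within_open_subset[of x "{0<..<R}"]) (use that in auto)
    then show ?thesis using D(2)[of x n] that by simp
  qed
  have DE: "D n x = E n x" if "0 < x" "x < R" for n x
    using that
  proof (induction n arbitrary: x)
    case (Suc n)
    have "(D n has_real_derivative E (Suc n) x) (at x)"
      by (rule has_field_derivative_transform_within_open[OF E', where S="{0<..<R}"])
        (use Suc assms(2) in auto)
    with D'[OF Suc.prems, of n] show ?case by (rule DERIV_unique)
  qed (simp add: D(1) E(1) fg)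
  define s where "s = R / 2"
  have s: "0 < s" "s < R" using assms(1) by (auto simp: s_def)
  define C where "C = (\<lambda>n r. if r < s then D n r else E n r)"
  have CD: "C n r = D n r" if "0 \<le> r" "r < R" for n r
    using DE[of r n] that s by (auto simp: C_def)
  have CE: "C n r = E n r" if "0 < r" "r < R'" for n r
    using DE[of r n] that s by (auto simp: C_def)
  have "C 0 = f" using s(2) by (auto simp: C_def D(1) E(1) fg)
  moreover have "(C n has_real_derivative C (Suc n) x) (at x within {0..<R'})" if "x \<in> {0..<R'}" for n x
  proof (cases "x = 0")
    case True
    have "(C n has_real_derivative D (Suc n) 0) (at 0 within {0..<R})"
      by (rule has_field_derivative_transform_within[OF D(2), where d=1]) (use CD assms(1) in auto)
    moreover have "at 0 within {0..<R} = at (0::real) within {0..<R'}"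
      by (rule at_within_nhd[of 0 "{..<R}"]) (use assms in auto)
    ultimately show ?thesis using CD[of 0 "Suc n"] True assms(1) by simp
  next
    case False
    have "(C n has_real_derivative E (Suc n) x) (at x)"
      by (rule has_field_derivative_transform_within_open[OF E', where S="{0<..<R'}"])
        (use that False CE in auto)
    with CE[of x "Suc n"] that False show ?thesis by (auto intro: has_field_derivative_at_within)
  qed
  ultimately show ?thesis unfolding smooth_on_interval_def by (intro exI[of _ C]) auto
qed

text \<open>The function \<open>P = \<rho> exp (\<integral> 1/h)\<close> recovers the radius from the value of a profile: \<open>P (\<alpha> r)/r\<close> is
  constant along every solution of \<open>r \<alpha>' = h(\<alpha>)\<close>.\<close>

lemma ode_time_function:
  fixes h :: "real \<Rightarrow> real"
  assumes "continuous_on {u..v} h" "\<And>a. a \<in> {u..v} \<Longrightarrow> 0 < h a" "u < w" "w < v" "0 < \<rho>"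
  obtains P where "P w = \<rho>" "\<And>a. u < a \<Longrightarrow> a < v \<Longrightarrow> 0 < P a"
    "\<And>a. u < a \<Longrightarrow> a < v \<Longrightarrow> (P has_real_derivative P a / h a) (at a)"
proof -
  define L where "L = (\<lambda>a. integral {u..a} (\<lambda>s. 1 / h s))"
  define P where "P = (\<lambda>a. \<rho> * exp (L a - L w))"
  have c: "continuous_on {u..v} (\<lambda>s. 1 / h s)"
    using assms by (intro continuous_intros) (auto simp: less_le)
  have "(L has_real_derivative 1 / h a) (at a)" if "u < a" "a < v" for a
  proof -
    have "(L has_real_derivative 1 / h a) (at a within {u..v})"
      unfolding L_def by (rule integral_has_real_derivative[OF c]) (use that in auto)
    moreover have "at a within {u..v} = at a"
      by (rule at_within_open_subset[of a "{u<..<v}"]) (use that in auto)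
    ultimately show ?thesis by simp
  qed
  then have "(P has_real_derivative P a / h a) (at a)" if "u < a" "a < v" for a
    unfolding P_def using that by (auto intro!: derivative_eq_intros)
  with that[of P] assms(5) show ?thesis by (simp add: P_def)
qed

text \<open>With the function \<open>P\<close> of \<open>ode_time_function\<close> one has \<open>P (\<alpha> r) = r\<close>. Hence \<open>R\<close> is at most
  \<open>P a0\<close>, and since \<open>P\<close> is defined and increasing beyond \<open>a0\<close>, its inverse continues \<open>\<alpha>\<close> beyond
  \<open>R\<close>.\<close>

lemma bounded_profile_extends:
  fixes \<alpha> h :: "real \<Rightarrow> real"
  assumes model: "model b h" and rot: "rotationally_symmetric R b \<alpha>"
    and ode: "\<And>r. 0 < r \<Longrightarrow> ereal r < R \<Longrightarrow> (\<alpha> has_real_derivative h (\<alpha> r) / r) (at r)"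
    and bound: "ereal a0 < b" "\<And>r. 0 \<le> r \<Longrightarrow> ereal r < R \<Longrightarrow> \<alpha> r \<le> a0"
  obtains R' \<beta> where "R < R'" "rotationally_symmetric R' b \<beta>"
    "\<And>r. 0 \<le> r \<Longrightarrow> ereal r < R \<Longrightarrow> \<beta> r = \<alpha> r"
    "\<And>r. 0 \<le> r \<Longrightarrow> ereal r < R' \<Longrightarrow> ereal (\<beta> r) < b"
    "\<And>r. 0 < r \<Longrightarrow> ereal r < R' \<Longrightarrow> (\<beta> has_real_derivative h (\<beta> r) / r) (at r)"
proof -
  have mpos: "0 < h a" if "0 < a" "ereal a < b" for a
    using model that unfolding model_def by blast
  have pos: "0 < \<alpha> r" if "0 < r" "ereal r < R" for r
    using rot that unfolding rotationally_symmetric_def by blast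
  have \<alpha>0: "\<alpha> 0 = 0" and R0: "0 < R" using rot unfolding rotationally_symmetric_def by blast+
  obtain H where H0: "H 0 = h"
    and Hi: "\<And>n a. 0 < a \<Longrightarrow> ereal a < b \<Longrightarrow> (H n has_real_derivative H (Suc n) a) (at a)"
    using model_derivatives[OF model] by metis
  obtain r1 where r1: "0 < r1" "ereal r1 < R"
    using ereal_dense2[OF R0] by (auto simp: zero_ereal_def)
  have pos1: "0 < \<alpha> r1" and a01: "\<alpha> r1 \<le> a0" using pos[OF r1] bound(2)[of r1] r1 by auto
  obtain v where v: "a0 < v" "ereal v < b"
    using ereal_dense2[OF bound(1)] by auto
  define u where "u = \<alpha> r1 / 2"
  have u: "0 < u" "u < \<alpha> r1" using pos1 by (auto simp: u_def)
  have below_b: "ereal a < b" if "a \<le> v" for a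
    using that v(2) by (meson ereal_less_eq(3) le_less_trans)
  have h_uv: "0 < h a" if "a \<in> {u..v}" for a
    using mpos[of a] below_b[of a] that u by auto
  have c: "continuous_on {u..v} h"
    by (intro continuous_at_imp_continuous_on ballI DERIV_isCont[OF Hi[of _ 0, unfolded H0]])
      (use below_b u in auto)
  obtain P where P: "P (\<alpha> r1) = r1" "\<And>a. u < a \<Longrightarrow> a < v \<Longrightarrow> 0 < P a"
    "\<And>a. u < a \<Longrightarrow> a < v \<Longrightarrow> (P has_real_derivative P a / h a) (at a)"
    by (rule ode_time_function[OF c h_uv u(2) _ r1(1)]) (use v a01 in auto)
  have Pmono: "P a < P a'" if "u < a" "a < a'" "a' < v" for a a'
  proof (rule DERIV_pos_imp_increasing[OF that(2)])
    fix s assume "a \<le> s" "s \<le> a'"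
    then have s: "u < s" "s < v" using that by auto
    then have "0 < P s / h s" using P(2)[OF s] h_uv[of s] by simp
    with P(3)[OF s] show "\<exists>y. (P has_real_derivative y) (at s) \<and> 0 < y" by blast
  qed
  have below_R: "ereal s < R" if "s \<le> r" "ereal r < R" for r s
    using that by (meson ereal_less_eq(3) le_less_trans)
  have incr: "\<alpha> r1 \<le> \<alpha> r" if "r1 \<le> r" "ereal r < R" for r
  proof (rule DERIV_nonneg_imp_nondecreasing[OF that(1)])
    fix s assume s: "r1 \<le> s" "s \<le> r"
    then have sR: "0 < s" "ereal s < R" using r1 below_R[OF _ that(2)] by auto
    have "ereal (\<alpha> s) < b" using bound(2)[of s] sR below_b[of "\<alpha> s"] v by auto
    then have "0 < h (\<alpha> s) / s" using mpos[of "\<alpha> s"] pos[OF sR] sR by simp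
    with ode[OF sR] show "\<exists>y. (\<alpha> has_real_derivative y) (at s) \<and> 0 \<le> y" by (meson less_imp_le)
  qed
  have P\<alpha>: "P (\<alpha> r) = r" if r: "r1 \<le> r" "ereal r < R" for r
  proof -
    have "\<exists>k. \<forall>s\<in>{r1..r}. P (\<alpha> s) / s = k"
    proof (rule has_field_derivative_zero_constant)
      fix s assume "s \<in> {r1..r}"
      then have s: "r1 \<le> s" "0 < s" "ereal s < R" using r1 below_R[OF _ r(2)] by auto
      have as: "u < \<alpha> s" "\<alpha> s < v" using incr[OF s(1,3)] u bound(2)[of s] s v by auto
      have "((\<lambda>s. P (\<alpha> s)) has_real_derivative P (\<alpha> s) / h (\<alpha> s) * (h (\<alpha> s) / s)) (at s)"
        by (rule DERIV_chain2[OF P(3)[OF as] ode[OF s(2,3)]])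
      then have "((\<lambda>s. P (\<alpha> s)) has_real_derivative P (\<alpha> s) / s) (at s)"
        using h_uv[of "\<alpha> s"] as by simp
      then have "((\<lambda>s. P (\<alpha> s) / s) has_real_derivative (P (\<alpha> s) / s * s - P (\<alpha> s) * 1) / (s * s)) (at s)"
        by (rule DERIV_divide[OF _ DERIV_ident]) (use s(2) in simp)
      also have "(P (\<alpha> s) / s * s - P (\<alpha> s) * 1) / (s * s) = 0"
        using s(2) by simp
      finally show "((\<lambda>s. P (\<alpha> s) / s) has_real_derivative 0) (at s within {r1..r})"
        by (rule has_field_derivative_at_within)
    qed (rule convex_real_interval)
    then obtain k where k: "\<forall>s\<in>{r1..r}. P (\<alpha> s) / s = k" ..
    from bspec[OF k, of r1] bspec[OF k, of r] show ?thesis using P(1) r(1) r1(1) by simp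
  qed
  have Rfin: "R \<le> ereal (P a0)"
  proof (rule ccontr)
    assume "\<not> R \<le> ereal (P a0)"
    then obtain r where r: "P a0 < r" "ereal r < R" using ereal_dense2[of "ereal (P a0)" R] by (meson less_ereal.simps(1) not_le)
    have r': "ereal (max r r1) < R" using r r1 by (auto simp: max_def)
    have "\<alpha> (max r r1) \<le> a0" using bound(2)[OF _ r'] r1 by auto
    then have "P (\<alpha> (max r r1)) \<le> P a0"
      using Pmono[of "\<alpha> (max r r1)" a0] incr[OF _ r'] u v by (cases "\<alpha> (max r r1) = a0") auto
    then show False using P\<alpha>[OF _ r'] r by auto
  qed
  obtain Rr where Rr: "R = ereal Rr" using Rfin R0 by (cases R) auto
  \<comment> \<open>The continued profile takes values up to \<open>w\<close>, which is still inside the domain of \<open>P\<close>.\<close>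
  define w where "w = (a0 + v) / 2"
  have w: "a0 < w" "w < v" using v by (auto simp: w_def)
  define R' where "R' = P w"
  have "P a0 < R'" unfolding R'_def by (rule Pmono) (use w u a01 in auto)
  then have RR': "Rr < R'" using Rfin Rr by simp
  define \<beta> where "\<beta> = (\<lambda>r. if r < Rr then \<alpha> r else inv_into {\<alpha> r1..w} P r)"
  have cP: "continuous_on {\<alpha> r1..w} P"
    by (intro continuous_at_imp_continuous_on ballI DERIV_isCont[OF P(3)]) (use w u in auto)
  have \<beta>P: "\<beta> r \<in> {\<alpha> r1..<w} \<and> P (\<beta> r) = r" if r: "r1 \<le> r" "r < R'" for r
  proof (cases "r < Rr")
    case True
    then show ?thesis using P\<alpha>[of r] incr[of r] bound(2)[of r] r r1 w by (auto simp: \<beta>_def Rr)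
  next
    case False
    have "\<exists>x\<ge>\<alpha> r1. x \<le> w \<and> P x = r"
      by (rule IVT') (use r w a01 P(1) cP in \<open>auto simp: R'_def\<close>)
    then have im: "r \<in> P ` {\<alpha> r1..w}" by auto
    have "\<beta> r = inv_into {\<alpha> r1..w} P r" using False by (simp add: \<beta>_def)
    then have "\<beta> r \<in> {\<alpha> r1..w}" "P (\<beta> r) = r"
      using inv_into_into[OF im] f_inv_into_f[OF im] by simp_all
    moreover from this have "\<beta> r \<noteq> w" using r by (auto simp: R'_def)
    ultimately show ?thesis by auto
  qed
  have \<beta>_inv: "\<beta> (P a) = a" if "\<alpha> r1 \<le> a" "a < w" for a
  proof -
    have "r1 \<le> P a" using Pmono[of "\<alpha> r1" a] P(1) that w u by (cases "a = \<alpha> r1") auto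
    moreover have "P a < R'" unfolding R'_def by (rule Pmono) (use that w u in auto)
    ultimately have *: "\<beta> (P a) \<in> {\<alpha> r1..<w}" "P (\<beta> (P a)) = P a" using \<beta>P[of "P a"] by auto
    show ?thesis
      using Pmono[of "\<beta> (P a)" a] Pmono[of a "\<beta> (P a)"] * that w u by (cases "\<beta> (P a)" a rule: linorder_cases) auto
  qed
  have \<beta>\<alpha>: "\<beta> r = \<alpha> r" if "r < Rr" for r using that by (simp add: \<beta>_def)
  have \<beta>ode: "(\<beta> has_real_derivative h (\<beta> r) / r) (at r)" if r: "0 < r" "r < R'" for r
  proof (cases "r < Rr")
    case True
    have "(\<beta> has_real_derivative h (\<alpha> r) / r) (at r)"
      by (rule has_field_derivative_transform_within_open[OF ode, where S="{..<Rr}"])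
        (use True r in \<open>auto simp: Rr \<beta>\<alpha>\<close>)
    then show ?thesis using \<beta>\<alpha>[OF True] by simp
  next
    case False
    then have rr: "r1 < r" using r1 by (auto simp: Rr)
    have b: "\<beta> r \<in> {\<alpha> r1..<w}" "P (\<beta> r) = r" using \<beta>P[of r] rr r by auto
    have b': "\<alpha> r1 < \<beta> r" using b P(1) rr by (cases "\<beta> r = \<alpha> r1") auto
    have bd: "u < \<beta> r" "\<beta> r < v" using b b' u w by auto
    have hb: "0 < h (\<beta> r)" using h_uv bd by auto
    define e where "e = min (\<beta> r - \<alpha> r1) (w - \<beta> r) / 2"
    have e: "0 < e" using b b' by (auto simp: e_def)
    have e2: "e \<le> (\<beta> r - \<alpha> r1) / 2" "e \<le> (w - \<beta> r) / 2" by (auto simp: e_def)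
    have near: "\<alpha> r1 \<le> z" "z < w" if "\<bar>z - \<beta> r\<bar> \<le> e" for z
      using that e2 b b' unfolding abs_le_iff by auto
    have "isCont \<beta> (P (\<beta> r))"
    proof (rule isCont_inverse_function[where f=P and g=\<beta> and x="\<beta> r", OF e])
      fix z assume z: "\<bar>z - \<beta> r\<bar> \<le> e"
      show "\<beta> (P z) = z" by (rule \<beta>_inv[OF near[OF z]])
      show "isCont P z" by (rule DERIV_isCont[OF P(3)]) (use near[OF z] u w in auto)
    qed
    then have cont: "isCont \<beta> r" using b by simp
    have "(\<beta> has_real_derivative inverse (P (\<beta> r) / h (\<beta> r))) (at r)"
      by (rule DERIV_inverse_function[OF P(3)[OF bd] _ rr r(2) _ cont])
        (use hb b r \<beta>P in auto)
    then show ?thesis using b by (simp add: inverse_eq_divide)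
  qed
  have \<beta>less: "ereal (\<beta> r) < b" if "0 \<le> r" "r < R'" for r
  proof (cases "r < Rr")
    case True
    then show ?thesis using bound(2)[of r] that below_b[of "\<alpha> r"] v by (auto simp: \<beta>\<alpha> Rr)
  next
    case False
    then show ?thesis using \<beta>P[of r] that r1 w below_b[of "\<beta> r"] by (auto simp: Rr)
  qed
  have \<beta>pos: "0 < \<beta> r" if "0 < r" "r < R'" for r
  proof (cases "r < Rr")
    case True
    then show ?thesis using pos[of r] that by (auto simp: \<beta>\<alpha> Rr)
  next
    case False
    then show ?thesis using \<beta>P[of r] that r1 pos1 by (auto simp: Rr)
  qed
  have Rr0: "0 < Rr" using R0 Rr by simp
  have eqI: "{r. 0 \<le> r \<and> ereal r < ereal s} = {0..<s}" for s by auto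
  have sm\<alpha>: "smooth_on_interval {0..<Rr} \<alpha>"
    using rot unfolding rotationally_symmetric_def Rr eqI by blast
  have "smooth_on_interval {0<..<R'} \<beta>"
  proof (rule smooth_on_interval_ode)
    show "(\<beta> has_real_derivative H 0 (\<beta> r) / r) (at r)" if "r \<in> {0<..<R'}" for r
      using \<beta>ode that H0 by simp
    show "(H n has_real_derivative H (Suc n) (\<beta> r)) (at (\<beta> r))" if "r \<in> {0<..<R'}" for n r
      using Hi[of "\<beta> r"] \<beta>pos \<beta>less that by simp
  qed simp
  then have sm: "smooth_on_interval {0..<R'} \<beta>"
    by (rule smooth_on_interval_glue[OF Rr0 less_imp_le[OF RR'] sm\<alpha> _ \<beta>\<alpha>])
  have \<beta>0: "\<beta> 0 = 0" using \<alpha>0 Rr0 \<beta>\<alpha> by simp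
  have "\<beta> r \<in> model_interval b" if "0 \<le> r" "r < R'" for r
    using \<beta>less[OF that] \<beta>pos[of r] that \<beta>0 by (cases "r = 0") (auto simp: model_interval_def less_imp_le)
  then have "rotationally_symmetric (ereal R') b \<beta>"
    unfolding rotationally_symmetric_def eqI using sm \<beta>0 \<beta>pos Rr0 RR' by auto
  then show ?thesis
    using that[of "ereal R'" \<beta>] RR' \<beta>\<alpha> \<beta>less \<beta>ode by (simp add: Rr)
qed

section \<open>The first variation of the bienergy\<close>

lemma model_metric_radial:
  fixes x :: "real^'n::finite"
  assumes "x \<noteq> 0" "0 < c"
  shows "model_metric h (c *\<^sub>R (x /\<^sub>R norm x)) (T *\<^sub>R (x /\<^sub>R norm x)) (T *\<^sub>R (x /\<^sub>R norm x)) = T\<^sup>2"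
proof -
  define u where "u = x /\<^sub>R norm x"
  have nu: "norm u = 1" using assms by (simp add: u_def)
  then have uu: "u \<bullet> u = 1" by (simp add: norm_eq_1)
  define y where "y = c *\<^sub>R u"
  have ny: "norm y = c" using assms nu by (simp add: y_def)
  then have yu: "y /\<^sub>R norm y = u" and y0: "y \<noteq> 0" using assms by (auto simp: y_def)
  have "dr y (T *\<^sub>R u) = T" by (simp add: dr_def yu uu)
  moreover from this have "d_theta y (T *\<^sub>R u) = 0" by (simp add: d_theta_def yu)
  ultimately have "model_metric h y (T *\<^sub>R u) (T *\<^sub>R u) = T\<^sup>2"
    using y0 by (simp add: model_metric_def power2_eq_square)
  then show ?thesis by (simp add: y_def u_def)
qed

text \<open>The radial component at radius \<open>r\<close> of the tension field in dimension \<open>m\<close>, for a profile with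
  value \<open>b0\<close> and derivatives \<open>b1\<close>, \<open>b2\<close> at \<open>r\<close>; \<open>h'\<close> is the derivative of \<open>h\<close>.\<close>

definition radial_tension ::
  "(real \<Rightarrow> real) \<Rightarrow> (real \<Rightarrow> real) \<Rightarrow> real \<Rightarrow> real \<Rightarrow> real \<Rightarrow> real \<Rightarrow> real \<Rightarrow> real" where
  "radial_tension h h' m r b0 b1 b2 = b2 + (m - 1) * (b1 / r - h b0 * h' b0 / r\<^sup>2)"

lemma bienergy_rot_map:
  fixes \<phi> :: "real^'n::finite \<Rightarrow> real^'n"
  assumes pq: "0 < p" "p \<le> q" and S: "open S" "{p..q} \<subseteq> S" "S \<subseteq> {0<..}"
    and \<beta>1: "\<And>r. r \<in> S \<Longrightarrow> (\<beta> has_real_derivative \<beta>1 r) (at r)"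
    and \<beta>2: "\<And>r. r \<in> {p..q} \<Longrightarrow> (\<beta>1 has_real_derivative \<beta>2 r) (at r)"
    and pos: "\<And>r. r \<in> {p..q} \<Longrightarrow> 0 < \<beta> r"
    and h: "\<And>r. r \<in> {p..q} \<Longrightarrow> h (\<beta> r) \<noteq> 0"
      "\<And>r. r \<in> {p..q} \<Longrightarrow> (h has_real_derivative h1 (\<beta> r)) (at (\<beta> r))"
    and eq: "\<And>y. norm y \<in> S \<Longrightarrow> \<phi> y = rot_map \<beta> y"
    and cont: "continuous_on {p..q} (\<lambda>r. radial_tension h h1 (real CARD('n)) r (\<beta> r) (\<beta>1 r) (\<beta>2 r))"
  shows "bienergy flat_metric (model_metric h) {x. p \<le> norm x \<and> norm x \<le> q} \<phi> =
    (1/2) * (real CARD('n) * unit_ball_vol (real CARD('n))) * integral {p..q}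
      (\<lambda>r. (radial_tension h h1 (real CARD('n)) r (\<beta> r) (\<beta>1 r) (\<beta>2 r))\<^sup>2 * r ^ (CARD('n) - 1))"
proof -
  define T where "T = (\<lambda>r. radial_tension h h1 (real CARD('n)) r (\<beta> r) (\<beta>1 r) (\<beta>2 r))"
  have dens: "model_metric h (\<phi> x) (tension flat_metric (model_metric h) \<phi> x)
      (tension flat_metric (model_metric h) \<phi> x) * sqrt (det (gram flat_metric x)) = (T (norm x))\<^sup>2"
    if x: "p \<le> norm x" "norm x \<le> q" for x :: "real^'n"
  proof -
    have r: "norm x \<in> {p..q}" using x by simp
    have x0: "x \<noteq> 0" using x pq by auto
    have "tension flat_metric (model_metric h) \<phi> x = T (norm x) *\<^sub>R (x /\<^sub>R norm x)"
      unfolding T_def radial_tension_def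
      by (rule tension_rot_map[OF S(1) subsetD[OF S(2) r] S(3) \<beta>1 \<beta>2[OF r] pos[OF r] h(1)[OF r] h(2)[OF r] eq])
    moreover have "\<phi> x = \<beta> (norm x) *\<^sub>R (x /\<^sub>R norm x)"
      using eq[OF subsetD[OF S(2) r]] by (simp only: rot_map_def)
    moreover have "sqrt (det (gram flat_metric x)) = 1"
      by (simp add: gram_flat)
    ultimately show ?thesis
      using model_metric_radial[OF x0 pos[OF r]] by (simp only: mult_1_right)
  qed
  have closed: "closed {x :: real^'n. p \<le> norm x \<and> norm x \<le> q}"
    by (intro closed_Collect_conj closed_Collect_le continuous_intros)
  have "(LINT x:{x :: real^'n. p \<le> norm x \<and> norm x \<le> q}|lborel.
      model_metric h (\<phi> x) (tension flat_metric (model_metric h) \<phi> x)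
      (tension flat_metric (model_metric h) \<phi> x) * sqrt (det (gram flat_metric x))) =
    (LINT x:{x :: real^'n. p \<le> norm x \<and> norm x \<le> q}|lborel. (T (norm x))\<^sup>2)"
    by (rule set_lebesgue_integral_cong) (use closed dens in \<open>auto simp: borel_closed\<close>)
  also have "\<dots> = real CARD('n) * unit_ball_vol (real CARD('n)) * integral {p..q} (\<lambda>r. (T r)\<^sup>2 * r ^ (CARD('n) - 1))"
    by (rule LINT_annulus_radial) (use pq cont in \<open>auto simp: T_def intro: continuous_on_power\<close>)
  finally show ?thesis unfolding bienergy_def T_def by simp
qed

text \<open>The integrand is the derivative of \<open>r w \<eta>' - r w' \<eta> + 2 w \<eta>\<close>.\<close>

lemma integration_by_parts_twice:
  fixes w w1 w2 \<eta> \<eta>1 \<eta>2 :: "real \<Rightarrow> real"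
  assumes "p \<le> q"
    and "\<And>r. r \<in> {p..q} \<Longrightarrow> (w has_real_derivative w1 r) (at r)"
      "\<And>r. r \<in> {p..q} \<Longrightarrow> (w1 has_real_derivative w2 r) (at r)"
      "\<And>r. r \<in> {p..q} \<Longrightarrow> (\<eta> has_real_derivative \<eta>1 r) (at r)"
      "\<And>r. r \<in> {p..q} \<Longrightarrow> (\<eta>1 has_real_derivative \<eta>2 r) (at r)"
    and ends: "\<eta> p = 0" "\<eta> q = 0" "\<eta>1 p = 0" "\<eta>1 q = 0"
  shows "((\<lambda>r. w r * (r * \<eta>2 r + 3 * \<eta>1 r) - (r * w2 r - w1 r) * \<eta> r) has_integral 0) {p..q}"
proof -
  define B where "B = (\<lambda>r. r * w r * \<eta>1 r - r * w1 r * \<eta> r + 2 * (w r * \<eta> r))"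
  have "(B has_vector_derivative (w r * (r * \<eta>2 r + 3 * \<eta>1 r) - (r * w2 r - w1 r) * \<eta> r)) (at r within {p..q})"
    if "r \<in> {p..q}" for r
  proof -
    have "(B has_real_derivative
        ((1 * w r + w1 r * r) * \<eta>1 r + \<eta>2 r * (r * w r))
        - ((1 * w1 r + w2 r * r) * \<eta> r + \<eta>1 r * (r * w1 r))
        + 2 * (w1 r * \<eta> r + \<eta>1 r * w r)) (at r)"
      unfolding B_def
      by (intro DERIV_add DERIV_diff DERIV_mult DERIV_cmult DERIV_ident assms(2-5)[OF that])
    also have "((1 * w r + w1 r * r) * \<eta>1 r + \<eta>2 r * (r * w r))
        - ((1 * w1 r + w2 r * r) * \<eta> r + \<eta>1 r * (r * w1 r))
        + 2 * (w1 r * \<eta> r + \<eta>1 r * w r)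
      = w r * (r * \<eta>2 r + 3 * \<eta>1 r) - (r * w2 r - w1 r) * \<eta> r"
      by (simp add: algebra_simps)
    finally have "(B has_real_derivative (w r * (r * \<eta>2 r + 3 * \<eta>1 r) - (r * w2 r - w1 r) * \<eta> r)) (at r)" .
    then show ?thesis
      by (rule has_vector_derivative_at_within[OF iffD1[OF has_real_derivative_iff_has_vector_derivative]])
  qed
  then have "((\<lambda>r. w r * (r * \<eta>2 r + 3 * \<eta>1 r) - (r * w2 r - w1 r) * \<eta> r) has_integral B q - B p) {p..q}"
    by (rule fundamental_theorem_of_calculus[OF assms(1)])
  moreover have "B q - B p = 0" by (simp add: B_def ends)
  ultimately show ?thesis by (simp only:)
qed

lemma integral_times_positive_bump_nonzero:
  fixes K \<eta> :: "real \<Rightarrow> real"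
  assumes "p < q" "continuous_on {p..q} K" "continuous_on {p..q} \<eta>"
    and "\<And>r. r \<in> {p..q} \<Longrightarrow> 0 < K r" "\<And>r. r \<in> {p..q} \<Longrightarrow> 0 \<le> \<eta> r" "\<And>r. r \<in> {p<..<q} \<Longrightarrow> 0 < \<eta> r"
  shows "integral {p..q} (\<lambda>r. K r * \<eta> r) \<noteq> 0"
proof
  assume int: "integral {p..q} (\<lambda>r. K r * \<eta> r) = 0"
  have cont: "continuous_on {p..q} (\<lambda>r. K r * \<eta> r)"
    by (rule continuous_on_mult[OF assms(2,3)])
  have nonneg: "0 \<le> K r * \<eta> r" if "r \<in> {p..q}" for r
    by (rule mult_nonneg_nonneg[OF less_imp_le[OF assms(4)[OF that]] assms(5)[OF that]])
  have zero: "\<forall>r\<in>{p..q}. K r * \<eta> r = 0"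
    by (rule iffD1[OF integral_eq_0_iff[OF cont assms(1) nonneg] int])
  have m: "(p + q) / 2 \<in> {p<..<q}" "(p + q) / 2 \<in> {p..q}" using assms(1) by auto
  have "0 < K ((p + q) / 2) * \<eta> ((p + q) / 2)"
    by (rule mult_pos_pos[OF assms(4)[OF m(2)] assms(6)[OF m(1)]])
  then show False unfolding bspec[OF zero m(2)] by (rule less_irrefl[THEN notE])
qed

text \<open>The factor \<open>r\<close> makes \<open>rot_map (radial_bump p q)\<close> the vector field \<open>x \<mapsto> bump (p\<^sup>2) (q\<^sup>2) (x \<bullet> x) x\<close>,
  which is visibly smooth.\<close>

definition radial_bump :: "real \<Rightarrow> real \<Rightarrow> real \<Rightarrow> real" where
  "radial_bump p q r = bump (p\<^sup>2) (q\<^sup>2) (r * r) * r"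

lemma radial_bump_props:
  assumes "0 < p" "p < q"
  shows "\<And>r. p < r \<Longrightarrow> r < q \<Longrightarrow> 0 < radial_bump p q r"
    and "\<And>r. 0 \<le> r \<Longrightarrow> 0 \<le> radial_bump p q r"
    and "\<And>r. 0 \<le> r \<Longrightarrow> r \<le> p \<or> q \<le> r \<Longrightarrow> radial_bump p q r = 0"
proof -
  show "0 < radial_bump p q r" if "p < r" "r < q" for r
  proof -
    have "p * p < r * r" "r * r < q * q"
      by (rule mult_strict_mono'; use that assms in simp)+
    then show ?thesis
      using that assms by (simp add: radial_bump_def bump_pos power2_eq_square)
  qed
  show "radial_bump p q r = 0" if "0 \<le> r" "r \<le> p \<or> q \<le> r" for r
  proof -
    have "r \<le> p \<Longrightarrow> r * r \<le> p * p" "q \<le> r \<Longrightarrow> q * q \<le> r * r"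
      by (rule mult_mono; use that assms in simp)+
    then have "r * r \<le> p\<^sup>2 \<or> q\<^sup>2 \<le> r * r"
      using that(2) unfolding power2_eq_square by blast
    then show ?thesis by (simp add: radial_bump_def bump_eq_0)
  qed
  show "0 \<le> radial_bump p q r" if "0 \<le> r" for r
    using that by (simp add: radial_bump_def bump_def flat_exp_def)
qed

lemma Ck_on_real_derivative:
  fixes f :: "real \<Rightarrow> real"
  assumes "Ck_on (Suc k) S f" "x \<in> S"
  shows "(f has_real_derivative frechet_derivative f (at x) 1) (at x)"
proof -
  have d: "(f has_derivative frechet_derivative f (at x)) (at x)"
    by (rule Ck_on_SucD(1)[OF assms])
  then have "linear (frechet_derivative f (at x))" by (rule has_derivative_linear)
  then have "frechet_derivative f (at x) v = frechet_derivative f (at x) 1 * v" for v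
    using linear_scale[of "frechet_derivative f (at x)" v 1] by (simp add: mult.commute)
  then have "frechet_derivative f (at x) = (*) (frechet_derivative f (at x) 1)" by (rule ext)
  with d show ?thesis unfolding has_field_derivative_def by simp
qed

text \<open>On \<open>[0, \<infinity>)\<close> the bump has a minimum at \<open>p\<close> and at \<open>q\<close>, so its derivative vanishes there and the
  boundary terms of the integration by parts disappear.\<close>

lemma radial_bump_derivatives:
  assumes "0 < p" "p < q"
  obtains \<eta>1 \<eta>2 where "\<And>r. (radial_bump p q has_real_derivative \<eta>1 r) (at r)"
    "\<And>r. (\<eta>1 has_real_derivative \<eta>2 r) (at r)" "continuous_on UNIV \<eta>2" "\<eta>1 p = 0" "\<eta>1 q = 0"
proof -
  have eq: "radial_bump p q = (\<lambda>r. bump (p\<^sup>2) (q\<^sup>2) (r \<bullet> r) *\<^sub>R r)"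
    by (simp add: fun_eq_iff radial_bump_def)
  have C: "Ck_on k UNIV (radial_bump p q)" for k
    unfolding eq by (intro Ck_on_scaleR Ck_on_bump Ck_on_bounded_linear bounded_linear_ident open_UNIV)
  define \<eta>1 where "\<eta>1 = (\<lambda>r. frechet_derivative (radial_bump p q) (at r) 1)"
  define \<eta>2 where "\<eta>2 = (\<lambda>r. frechet_derivative \<eta>1 (at r) 1)"
  have C1: "Ck_on k UNIV \<eta>1" for k
    unfolding \<eta>1_def by (rule Ck_on_SucD(2)[OF C[of "Suc k"]])
  have C2: "Ck_on k UNIV \<eta>2" for k
    unfolding \<eta>2_def by (rule Ck_on_SucD(2)[OF C1[of "Suc k"]])
  have d: "(radial_bump p q has_real_derivative \<eta>1 r) (at r)" for r
    unfolding \<eta>1_def by (rule Ck_on_real_derivative[OF C[of "Suc 0"]]) simp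
  have "(\<eta>1 has_real_derivative \<eta>2 r) (at r)" for r
    unfolding \<eta>2_def by (rule Ck_on_real_derivative[OF C1[of "Suc 0"]]) simp
  moreover have "continuous_on UNIV \<eta>2" using C2[of 0] by simp
  moreover have "\<eta>1 s = 0" if "s = p \<or> s = q" for s
  proof (rule DERIV_local_min[OF d])
    have s: "0 < s" using that assms by auto
    have zero: "radial_bump p q s = 0"
      by (rule radial_bump_props(3)[OF assms]) (use s that in auto)
    show "0 < s" by (rule s)
    show "\<forall>y. \<bar>s - y\<bar> < s \<longrightarrow> radial_bump p q s \<le> radial_bump p q y"
    proof (intro allI impI)
      fix y assume "\<bar>s - y\<bar> < s"
      then have "0 \<le> y" by auto
      then show "radial_bump p q s \<le> radial_bump p q y"
        using radial_bump_props(2)[OF assms \<open>0 \<le> y\<close>] zero by simp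
    qed
  qed
  ultimately show ?thesis by (intro that[of \<eta>1 \<eta>2] d) auto
qed

text \<open>The variation is \<open>\<phi> x + t bump (x \<bullet> x) x\<close>, which gives smoothness in \<open>(t, x)\<close>; written through
  profiles, it gives the bound on the norm.\<close>

lemma radial_variation:
  fixes \<alpha> :: "real \<Rightarrow> real"
  assumes pq: "0 < p" "p < q" "ereal q < R"
    and smooth: "smooth_on (geodesic_ball R :: (real^'n::finite) set) (rot_map \<alpha>)"
    and \<epsilon>: "0 < \<epsilon>"
    and small: "\<And>t r. \<bar>t\<bar> < \<epsilon> \<Longrightarrow> r \<in> {p..q} \<Longrightarrow>
        0 < \<alpha> r + t * radial_bump p q r \<and> ereal (\<alpha> r + t * radial_bump p q r) < b"
    and range: "\<And>r. 0 \<le> r \<Longrightarrow> ereal r < R \<Longrightarrow> 0 \<le> \<alpha> r \<and> ereal (\<alpha> r) < b"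
  shows "variation (geodesic_ball R :: (real^'n) set) (geodesic_ball b) {x. p \<le> norm x \<and> norm x \<le> q}
     (rot_map \<alpha>) \<epsilon> (\<lambda>t. rot_map (\<lambda>r. \<alpha> r + t * radial_bump p q r))"
proof -
  let ?U = "geodesic_ball R :: (real^'n) set"
  have split: "rot_map (\<lambda>r. \<alpha> r + t * radial_bump p q r) x =
      rot_map \<alpha> x + (t * bump (p\<^sup>2) (q\<^sup>2) (x \<bullet> x)) *\<^sub>R x" for t and x :: "real^'n"
  proof (cases "x = 0")
    case False
    have "x \<bullet> x = norm x * norm x" by (simp add: power2_norm_eq_inner[symmetric] power2_eq_square)
    then show ?thesis
      using False by (simp add: rot_map_def radial_bump_def scaleR_add_left[symmetric] distrib_right mult.assoc)
  qed (simp add: rot_map_def)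
  have opU: "open ?U" by (rule open_geodesic_ball)
  define I where "I = {-\<epsilon><..<\<epsilon>}"
  have opI: "open I" and opIU: "open (I \<times> ?U)" using opU by (auto simp: I_def open_Times)
  have sm: "smooth_on (I \<times> ?U) (\<lambda>(t, x). rot_map (\<lambda>r. \<alpha> r + t * radial_bump p q r) x)"
    unfolding smooth_on_def
  proof
    fix k
    have "Ck_on k (I \<times> ?U) (\<lambda>z. rot_map \<alpha> (snd z) + (fst z *\<^sub>R bump (p\<^sup>2) (q\<^sup>2) (snd z \<bullet> snd z)) *\<^sub>R snd z)"
      using smooth unfolding smooth_on_def
      by (intro Ck_on_add[OF opIU] Ck_on_scaleR[OF opIU] Ck_on_compose_snd[OF opI opU, of k "rot_map \<alpha>"]
          Ck_on_bounded_linear[OF opIU] Ck_on_bump[OF opIU] bounded_linear_fst bounded_linear_snd) blast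
    moreover have "(\<lambda>(t, x :: real^'n). rot_map (\<lambda>r. \<alpha> r + t * radial_bump p q r) x) =
      (\<lambda>z. rot_map \<alpha> (snd z) + (fst z *\<^sub>R bump (p\<^sup>2) (q\<^sup>2) (snd z \<bullet> snd z)) *\<^sub>R snd z)"
      by (simp add: fun_eq_iff split)
    ultimately show "Ck_on k (I \<times> ?U) (\<lambda>(t, x). rot_map (\<lambda>r. \<alpha> r + t * radial_bump p q r) x)"
      by (simp only:)
  qed
  have norm_rot: "norm (rot_map \<beta> x) \<le> \<bar>\<beta> (norm x)\<bar>" for \<beta> and x :: "real^'n"
    by (cases "x = 0") (simp_all add: rot_map_def abs_mult mult.assoc)
  have into: "rot_map (\<lambda>r. \<alpha> r + t * radial_bump p q r) x \<in> geodesic_ball b" if t: "t \<in> {-\<epsilon><..<\<epsilon>}" and x: "x \<in> ?U" for t x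
  proof -
    define s where "s = \<alpha> (norm x) + t * radial_bump p q (norm x)"
    have "0 \<le> s \<and> ereal s < b"
    proof (cases "norm x \<in> {p..q}")
      case True
      then show ?thesis using small[of t "norm x"] t by (simp add: s_def abs_less_iff less_imp_le)
    next
      case False
      then have "norm x \<le> p \<or> q \<le> norm x" by auto
      then have "radial_bump p q (norm x) = 0" by (rule radial_bump_props(3)[OF pq(1,2) norm_ge_zero])
      moreover have "ereal (norm x) < R" using x by (simp add: geodesic_ball_def)
      ultimately show ?thesis using range[of "norm x"] by (simp add: s_def)
    qed
    moreover have "norm (rot_map (\<lambda>r. \<alpha> r + t * radial_bump p q r) x) \<le> \<bar>s\<bar>"
      using norm_rot[of "\<lambda>r. \<alpha> r + t * radial_bump p q r" x] by (simp add: s_def)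
    ultimately have "ereal (norm (rot_map (\<lambda>r. \<alpha> r + t * radial_bump p q r) x)) \<le> ereal s" "ereal s < b"
      by simp_all
    then show ?thesis
      unfolding geodesic_ball_def mem_Collect_eq by (rule order_le_less_trans)
  qed
  have outside: "rot_map (\<lambda>r. \<alpha> r + t * radial_bump p q r) x = rot_map \<alpha> x"
    if "x \<notin> interior {x. p \<le> norm x \<and> norm x \<le> q}" for t and x :: "real^'n"
  proof -
    have "open {x :: real^'n. p < norm x \<and> norm x < q}"
      by (intro open_Collect_conj open_Collect_less continuous_intros)
    then have "{x :: real^'n. p < norm x \<and> norm x < q} \<subseteq> interior {x. p \<le> norm x \<and> norm x \<le> q}"
      by (intro interior_maximal) auto
    then have "x \<notin> {x. p < norm x \<and> norm x < q}" using that by blast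
    then have "norm x \<le> p \<or> q \<le> norm x" by auto
    then have "radial_bump p q (norm x) = 0" by (rule radial_bump_props(3)[OF pq(1,2) norm_ge_zero])
    then show ?thesis by (simp add: rot_map_def)
  qed
  show ?thesis
    unfolding variation_def
    using \<epsilon> sm into outside by (intro conjI ballI image_subsetI) (simp_all add: I_def)
qed

section \<open>The Euler-Lagrange equation of the profile\<close>

text \<open>By compactness \<open>\<alpha>\<close> stays away from \<open>0\<close> and from \<open>b\<close>, and \<open>\<eta>\<close> is bounded.\<close>

lemma small_perturbation:
  fixes \<alpha> \<eta> :: "real \<Rightarrow> real"
  assumes "p \<le> q" and c: "continuous_on {p..q} \<alpha>" "continuous_on {p..q} \<eta>"
    and range: "\<And>r. r \<in> {p..q} \<Longrightarrow> 0 < \<alpha> r \<and> ereal (\<alpha> r) < b"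
  obtains \<epsilon> where "0 < \<epsilon>"
    "\<And>t r. \<bar>t\<bar> < \<epsilon> \<Longrightarrow> r \<in> {p..q} \<Longrightarrow> 0 < \<alpha> r + t * \<eta> r \<and> ereal (\<alpha> r + t * \<eta> r) < b"
proof -
  have ne: "{p..q} \<noteq> {}" using assms(1) by simp
  obtain l where l: "l \<in> {p..q}" "\<And>r. r \<in> {p..q} \<Longrightarrow> \<alpha> l \<le> \<alpha> r"
    using continuous_attains_inf[OF compact_Icc ne c(1)] by blast
  obtain u where u: "u \<in> {p..q}" "\<And>r. r \<in> {p..q} \<Longrightarrow> \<alpha> r \<le> \<alpha> u"
    using continuous_attains_sup[OF compact_Icc ne c(1)] by blast
  obtain k where k: "k \<in> {p..q}" "\<And>r. r \<in> {p..q} \<Longrightarrow> \<bar>\<eta> r\<bar> \<le> \<bar>\<eta> k\<bar>"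
    using continuous_attains_sup[OF compact_Icc ne continuous_on_rabs[OF c(2)]] by blast
  obtain v where v: "ereal (\<alpha> u) < ereal v" "ereal v < b"
    using range[OF u(1)] ereal_dense2 by blast
  define K where "K = \<bar>\<eta> k\<bar> + 1"
  define m where "m = min (\<alpha> l) (v - \<alpha> u)"
  have K: "0 < K" by (simp add: K_def)
  have m: "0 < m" "m \<le> \<alpha> l" "m \<le> v - \<alpha> u" using v range[OF l(1)] by (auto simp: m_def)
  show ?thesis
  proof
    show "0 < m / K" using m K by simp
    fix t r assume t: "\<bar>t\<bar> < m / K" and r: "r \<in> {p..q}"
    have "\<bar>t * \<eta> r\<bar> = \<bar>t\<bar> * \<bar>\<eta> r\<bar>" by (rule abs_mult)
    also have "\<dots> \<le> \<bar>t\<bar> * K" using k(2)[OF r] by (intro mult_left_mono) (simp_all add: K_def)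
    also have "\<dots> < m" using t K by (simp add: pos_less_divide_eq)
    finally have te: "\<bar>t * \<eta> r\<bar> < m" .
    have "0 < \<alpha> r + t * \<eta> r" "\<alpha> r + t * \<eta> r < v"
      using te m l(2)[OF r] u(2)[OF r] by linarith+
    moreover from this have "ereal (\<alpha> r + t * \<eta> r) < b"
      using v(2) by (meson less_ereal.simps(1) less_trans)
    ultimately show "0 < \<alpha> r + t * \<eta> r \<and> ereal (\<alpha> r + t * \<eta> r) < b" by blast
  qed
qed

text \<open>For a solution of \<open>r \<alpha>' = h(\<alpha>)\<close> in dimension 4, with \<open>H n\<close> the \<open>n\<close>-th derivative of \<open>h\<close>, this
  is \<open>r\<^sup>2\<close> times the radial tension at the value \<open>a = \<alpha> r\<close>. The next two definitions are its first
  two derivatives in \<open>a\<close>.\<close>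

definition scaled_tension :: "(nat \<Rightarrow> real \<Rightarrow> real) \<Rightarrow> real \<Rightarrow> real" where
  "scaled_tension H a = 2 * H 0 a * (1 - H 1 a)"

definition scaled_tension1 :: "(nat \<Rightarrow> real \<Rightarrow> real) \<Rightarrow> real \<Rightarrow> real" where
  "scaled_tension1 H a = 2 * H 1 a * (1 - H 1 a) - 2 * H 0 a * H 2 a"

definition scaled_tension2 :: "(nat \<Rightarrow> real \<Rightarrow> real) \<Rightarrow> real \<Rightarrow> real" where
  "scaled_tension2 H a = 2 * H 2 a - 6 * H 1 a * H 2 a - 2 * H 0 a * H 3 a"

text \<open>With \<open>w r = scaled_tension H (\<alpha> r)\<close> and \<open>G = h h'\<close>, the Euler-Lagrange expression of the reduced
  bienergy is \<open>r w'' - w' - 3 G'(\<alpha>) w/r\<close>. The equation \<open>r \<alpha>' = h(\<alpha>)\<close> eliminates the derivatives of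
  \<open>\<alpha>\<close>; what remains is \<open>euler_lagrange H (\<alpha> r)/r\<close>.\<close>

definition euler_lagrange :: "(nat \<Rightarrow> real \<Rightarrow> real) \<Rightarrow> real \<Rightarrow> real" where
  "euler_lagrange H a = (scaled_tension2 H a * H 0 a + scaled_tension1 H a * H 1 a) * H 0 a - 2 * scaled_tension1 H a * H 0 a
     - 3 * ((H 1 a)\<^sup>2 + H 0 a * H 2 a) * scaled_tension H a"

text \<open>In terms of \<open>G = h h'\<close> the right-hand side is \<open>2 h (2 h' (G' - 1) - h G'')\<close>.\<close>

lemma euler_lagrange_factor:
  "euler_lagrange H a = 2 * H 0 a * (2 * H 1 a * ((H 1 a)\<^sup>2 + H 0 a * H 2 a - 1)
     - H 0 a * (3 * H 1 a * H 2 a + H 0 a * H 3 a))"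
  by (simp add: euler_lagrange_def scaled_tension_def scaled_tension1_def scaled_tension2_def algebra_simps power2_eq_square)

text \<open>The bienergy of the varied map over the annulus is a constant times
  \<open>\<integral> T\<^sub>t(r)\<^sup>2 r\<^sup>3 dr\<close>. Differentiation under the integral sign at \<open>t = 0\<close> gives
  \<open>2 \<integral> (w (r \<eta>'' + 3 \<eta>') - 3 G'(\<alpha>) w \<eta>/r) dr\<close>, and two integrations by parts free \<open>\<eta>\<close> of its
  derivatives.\<close>

lemma first_variation:
  fixes H :: "nat \<Rightarrow> real \<Rightarrow> real" and \<alpha> :: "real \<Rightarrow> real"
  assumes H: "\<And>n a. 0 < a \<Longrightarrow> ereal a < b \<Longrightarrow> (H n has_real_derivative H (Suc n) a) (at a)"
    and Hpos: "\<And>a. 0 < a \<Longrightarrow> ereal a < b \<Longrightarrow> 0 < H 0 a"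
    and b: "0 < b" and \<alpha>0: "\<alpha> 0 = 0"
    and range: "\<And>r. 0 < r \<Longrightarrow> ereal r < R \<Longrightarrow> 0 < \<alpha> r \<and> ereal (\<alpha> r) < b"
    and ode: "\<And>r. 0 < r \<Longrightarrow> ereal r < R \<Longrightarrow> (\<alpha> has_real_derivative H 0 (\<alpha> r) / r) (at r)"
    and bih: "biharmonic (geodesic_ball R) flat_metric (geodesic_ball b) (model_metric (H 0))
       (rot_map \<alpha> :: real^4 \<Rightarrow> real^4)"
    and pq: "0 < p" "p < q" "ereal q < R"
  shows "integral {p..q} (\<lambda>r. euler_lagrange H (\<alpha> r) / r * radial_bump p q r) = 0"
proof -
  define S where "S = {r. 0 < r \<and> ereal r < R}"
  define J where "J = {a. 0 < a \<and> ereal a < b}"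
  define \<eta> where "\<eta> = radial_bump p q"
  have pqS: "{p..q} \<subseteq> S"
    using pq unfolding S_def by (auto intro: le_less_trans[of "ereal _" "ereal q" R])
  have S: "open S" "S \<subseteq> {0<..}" unfolding S_def by (rule open_radial_interior) auto
  have rS: "0 < r" "ereal r < R" if "r \<in> S" for r using that by (auto simp: S_def)
  obtain \<eta>1 \<eta>2 where \<eta>: "\<And>r. (\<eta> has_real_derivative \<eta>1 r) (at r)"
      "\<And>r. (\<eta>1 has_real_derivative \<eta>2 r) (at r)" "continuous_on UNIV \<eta>2" "\<eta>1 p = 0" "\<eta>1 q = 0"
    using radial_bump_derivatives[OF pq(1,2)] unfolding \<eta>_def by metis
  define \<alpha>1 where "\<alpha>1 = (\<lambda>r. H 0 (\<alpha> r) / r)"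
  define \<alpha>2 where "\<alpha>2 = (\<lambda>r. (H 0 (\<alpha> r) * H 1 (\<alpha> r) - H 0 (\<alpha> r)) / r\<^sup>2)"
  have d\<alpha>: "(\<alpha> has_real_derivative \<alpha>1 r) (at r)" if "r \<in> S" for r
    using ode[OF rS[OF that]] by (simp add: \<alpha>1_def)
  have dH\<alpha>: "((\<lambda>r. H n (\<alpha> r)) has_real_derivative H (Suc n) (\<alpha> r) * (H 0 (\<alpha> r) / r)) (at r)" if "r \<in> S" for n r
    by (rule DERIV_chain2[OF H ode]) (use range[OF rS[OF that]] rS[OF that] in auto)
  have d\<alpha>1: "(\<alpha>1 has_real_derivative \<alpha>2 r) (at r)" if "r \<in> S" for r
  proof -
    have "(\<alpha>1 has_real_derivative (H (Suc 0) (\<alpha> r) * (H 0 (\<alpha> r) / r) * r - H 0 (\<alpha> r) * 1) / (r * r)) (at r)"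
      unfolding \<alpha>1_def by (rule DERIV_divide[OF dH\<alpha>[OF that] DERIV_ident]) (use rS[OF that] in auto)
    then show ?thesis using rS[OF that] by (simp add: \<alpha>2_def power2_eq_square mult.commute)
  qed
  have cS: "continuous_on {p..q} f" if "\<And>r. r \<in> S \<Longrightarrow> (f has_real_derivative f' r) (at r)" for f f'
  proof (intro continuous_at_imp_continuous_on ballI)
    fix r assume "r \<in> {p..q}"
    then show "isCont f r" using DERIV_isCont[OF that] pqS by blast
  qed
  have c\<alpha>: "continuous_on {p..q} \<alpha>" and c\<alpha>1: "continuous_on {p..q} \<alpha>1"
    using cS[OF d\<alpha>] cS[OF d\<alpha>1] by blast+
  have cH\<alpha>: "continuous_on {p..q} (\<lambda>r. H n (\<alpha> r))" for n
    by (rule cS[OF dH\<alpha>])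
  have nz: "r \<noteq> 0" if "r \<in> {p..q}" for r using that pq(1) by auto
  have c\<alpha>2: "continuous_on {p..q} \<alpha>2"
    unfolding \<alpha>2_def using nz by (intro continuous_intros cH\<alpha>) auto
  have c\<eta>: "continuous_on {p..q} \<eta>" "continuous_on {p..q} \<eta>1" "continuous_on {p..q} \<eta>2"
    using cS[of \<eta> \<eta>1] cS[of \<eta>1 \<eta>2] \<eta>(1,2) continuous_on_subset[OF \<eta>(3)] by auto
  have cHJ: "continuous_on J (H n)" for n
    by (intro continuous_at_imp_continuous_on ballI DERIV_isCont[OF H]) (auto simp: J_def)
  have range': "0 < \<alpha> r \<and> ereal (\<alpha> r) < b" if "r \<in> {p..q}" for r
    using range[OF rS] that pqS by blast
  obtain \<epsilon> where \<epsilon>: "0 < \<epsilon>"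
    "\<And>t r. \<bar>t\<bar> < \<epsilon> \<Longrightarrow> r \<in> {p..q} \<Longrightarrow> 0 < \<alpha> r + t * \<eta> r \<and> ereal (\<alpha> r + t * \<eta> r) < b"
    by (rule small_perturbation[OF less_imp_le[OF pq(2)] c\<alpha> c\<eta>(1) range']) auto
  define I where "I = {-\<epsilon><..<\<epsilon>}"
  have tI: "\<bar>t\<bar> < \<epsilon>" if "t \<in> I" for t
    using that by (auto simp: I_def)
  have I0: "0 \<in> I" using \<epsilon>(1) by (simp add: I_def)
  have inJ: "\<alpha> r + t * \<eta> r \<in> J" if "t \<in> I" "r \<in> {p..q}" for t r
    using \<epsilon>(2)[OF tI[OF that(1)] that(2)] by (simp add: J_def)
  \<comment> \<open>\<open>T t\<close> is the radial tension of the varied profile and \<open>T' t\<close> its derivative in \<open>t\<close>.\<close>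
  define T where "T = (\<lambda>t r. radial_tension (H 0) (H 1) 4 r (\<alpha> r + t * \<eta> r) (\<alpha>1 r + t * \<eta>1 r) (\<alpha>2 r + t * \<eta>2 r))"
  define T' where "T' = (\<lambda>t r. \<eta>2 r + 3 * (\<eta>1 r / r -
      ((H 1 (\<alpha> r + t * \<eta> r))\<^sup>2 + H 0 (\<alpha> r + t * \<eta> r) * H 2 (\<alpha> r + t * \<eta> r)) * \<eta> r / r\<^sup>2))"
  have csnd: "continuous_on (I \<times> {p..q}) (\<lambda>z. f (snd z))" if "continuous_on {p..q} f" for f :: "real \<Rightarrow> real"
    by (rule continuous_on_compose2[OF that continuous_on_snd[OF continuous_on_id]]) auto
  have cfst: "continuous_on (I \<times> {p..q}) fst" by (intro continuous_intros)
  have cH2: "continuous_on (I \<times> {p..q}) (\<lambda>z. H n (\<alpha> (snd z) + fst z * \<eta> (snd z)))" for n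
  proof (rule continuous_on_compose2[OF cHJ])
    show "continuous_on (I \<times> {p..q}) (\<lambda>z. \<alpha> (snd z) + fst z * \<eta> (snd z))"
      by (intro continuous_on_add continuous_on_mult csnd cfst c\<alpha> c\<eta>)
    show "(\<lambda>z. \<alpha> (snd z) + fst z * \<eta> (snd z)) ` (I \<times> {p..q}) \<subseteq> J"
      using inJ by auto
  qed
  have nz2: "\<forall>z\<in>I \<times> {p..q}. snd z \<noteq> 0" "\<forall>z\<in>I \<times> {p..q}. (snd z)\<^sup>2 \<noteq> 0" using pq(1) by auto
  have cs: "continuous_on (I \<times> {p..q}) (\<lambda>z. snd z)" by (intro continuous_intros)
  have cT: "continuous_on (I \<times> {p..q}) (\<lambda>z. T (fst z) (snd z))"
    unfolding T_def radial_tension_def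
    by (intro continuous_on_add continuous_on_diff continuous_on_mult continuous_on_divide continuous_on_power
        continuous_on_const csnd cfst cs cH2 c\<alpha>1 c\<alpha>2 c\<eta> nz2)
  have cT': "continuous_on (I \<times> {p..q}) (\<lambda>z. T' (fst z) (snd z))"
    unfolding T'_def
    by (intro continuous_on_add continuous_on_diff continuous_on_mult continuous_on_divide continuous_on_power
        continuous_on_const csnd cfst cs cH2 c\<eta> nz2)
  have cTt: "continuous_on {p..q} (T t)" if "t \<in> I" for t
  proof -
    have "continuous_on {p..q} (\<lambda>r. T (fst (t, r)) (snd (t, r)))"
      by (rule continuous_on_compose2[OF cT]) (use that in \<open>auto intro!: continuous_intros\<close>)
    then show ?thesis by simp
  qed
  have dT: "((\<lambda>t. T t r) has_real_derivative T' t r) (at t)" if "t \<in> I" "r \<in> {p..q}" for t r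
  proof -
    have a: "0 < \<alpha> r + t * \<eta> r" "ereal (\<alpha> r + t * \<eta> r) < b"
      using \<epsilon>(2)[OF tI[OF that(1)] that(2)] by auto
    have lin: "((\<lambda>t. c + t * e) has_real_derivative e) (at t)" for c e :: real
      by (auto intro!: derivative_eq_intros)
    have dHt: "((\<lambda>t. H n (\<alpha> r + t * \<eta> r)) has_real_derivative H (Suc n) (\<alpha> r + t * \<eta> r) * \<eta> r) (at t)" for n
      by (rule DERIV_chain2[OF H[OF a] lin])
    have "((\<lambda>t. T t r) has_real_derivative
       \<eta>2 r + (4 - 1) * (\<eta>1 r / r - (H (Suc 0) (\<alpha> r + t * \<eta> r) * \<eta> r * H 1 (\<alpha> r + t * \<eta> r)
         + H (Suc 1) (\<alpha> r + t * \<eta> r) * \<eta> r * H 0 (\<alpha> r + t * \<eta> r)) / r\<^sup>2)) (at t)"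
      unfolding T_def radial_tension_def
      by (intro DERIV_add DERIV_cmult DERIV_diff DERIV_cdivide DERIV_mult dHt lin)
    then show ?thesis
      by (simp add: T'_def power2_eq_square numeral_2_eq_2 algebra_simps)
  qed
  define F where "F = (\<lambda>t r. (T t r)\<^sup>2 * r ^ 3)"
  define F' where "F' = (\<lambda>t r. 2 * T t r * T' t r * r ^ 3)"
  have dF: "((\<lambda>t. F t r) has_real_derivative F' t r) (at t within I)" if "t \<in> I" "r \<in> cbox p q" for t r
  proof -
    have "((\<lambda>t. F t r) has_real_derivative (of_nat 2 * (T' t r * T t r ^ (2 - Suc 0))) * r ^ 3) (at t)"
      unfolding F_def by (intro DERIV_cmult_right DERIV_power dT) (use that in auto)
    then have "((\<lambda>t. F t r) has_real_derivative F' t r) (at t)"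
      by (simp add: F'_def mult_ac)
    then show ?thesis by (rule has_field_derivative_at_within)
  qed
  have intF: "F t integrable_on cbox p q" if "t \<in> I" for t
    unfolding F_def cbox_interval by (intro integrable_continuous_real continuous_intros cTt[OF that])
  have cF': "continuous_on (I \<times> cbox p q) (\<lambda>(t, r). F' t r)"
    unfolding F'_def split_beta cbox_interval
    by (intro continuous_on_mult continuous_on_power continuous_on_const cT cT' cs)
  have conv: "convex I" by (simp add: I_def)
  have "((\<lambda>t. integral (cbox p q) (F t)) has_field_derivative integral (cbox p q) (F' 0)) (at 0 within I)"
    by (rule leibniz_rule_field_derivative[OF dF intF cF' I0 conv])
  moreover have at0: "at 0 within I = at 0" by (rule at_within_open[OF I0]) (simp add: I_def)
  ultimately have leib: "((\<lambda>t. integral {p..q} (F t)) has_real_derivative integral {p..q} (F' 0)) (at 0)"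
    by (simp only: cbox_interval)
  \<comment> \<open>The same integral is the bienergy, up to the constant \<open>C\<close> from polar coordinates.\<close>
  define D where "D = {x :: real^4. p \<le> norm x \<and> norm x \<le> q}"
  define \<Phi> where "\<Phi> = (\<lambda>t. rot_map (\<lambda>r. \<alpha> r + t * \<eta> r) :: real^4 \<Rightarrow> real^4)"
  define C where "C = (1/2) * (4 * unit_ball_vol 4)"
  have C: "C \<noteq> 0" unfolding C_def using less_imp_neq[OF unit_ball_vol_pos[of 4]] by simp
  have energy: "bienergy flat_metric (model_metric (H 0)) D (\<Phi> t) = C * integral {p..q} (F t)" if t: "t \<in> I" for t
  proof -
    have "bienergy flat_metric (model_metric (H 0)) D (\<Phi> t) =
      (1/2) * (real CARD(4) * unit_ball_vol (real CARD(4))) * integral {p..q}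
      (\<lambda>r. (radial_tension (H 0) (H 1) (real CARD(4)) r (\<alpha> r + t * \<eta> r) (\<alpha>1 r + t * \<eta>1 r) (\<alpha>2 r + t * \<eta>2 r))\<^sup>2
        * r ^ (CARD(4) - 1))"
      unfolding D_def
    proof (rule bienergy_rot_map[OF pq(1) less_imp_le[OF pq(2)] S(1) pqS S(2)])
      show "((\<lambda>r. \<alpha> r + t * \<eta> r) has_real_derivative \<alpha>1 r + t * \<eta>1 r) (at r)" if "r \<in> S" for r
        by (intro DERIV_add DERIV_cmult d\<alpha>[OF that] \<eta>)
      show "((\<lambda>r. \<alpha>1 r + t * \<eta>1 r) has_real_derivative \<alpha>2 r + t * \<eta>2 r) (at r)" if "r \<in> {p..q}" for r
        by (intro DERIV_add DERIV_cmult d\<alpha>1 subsetD[OF pqS that] \<eta>)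
      fix r assume r: "r \<in> {p..q}"
      have a: "0 < \<alpha> r + t * \<eta> r" "ereal (\<alpha> r + t * \<eta> r) < b"
        using \<epsilon>(2)[OF tI[OF t] r] by auto
      show "0 < \<alpha> r + t * \<eta> r" by (rule a)
      show "H 0 (\<alpha> r + t * \<eta> r) \<noteq> 0" using Hpos[OF a] by simp
      show "(H 0 has_real_derivative H 1 (\<alpha> r + t * \<eta> r)) (at (\<alpha> r + t * \<eta> r))"
        using H[OF a, of 0] by simp
    next
      show "\<Phi> t y = rot_map (\<lambda>r. \<alpha> r + t * \<eta> r) y" for y by (simp add: \<Phi>_def)
      show "continuous_on {p..q} (\<lambda>r. radial_tension (H 0) (H 1) (real CARD(4)) r (\<alpha> r + t * \<eta> r)
          (\<alpha>1 r + t * \<eta>1 r) (\<alpha>2 r + t * \<eta>2 r))"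
        using cTt[OF t] by (simp add: T_def)
    qed
    then show ?thesis by (simp add: C_def F_def T_def)
  qed
  have "0 \<le> \<alpha> r \<and> ereal (\<alpha> r) < b" if "0 \<le> r" "ereal r < R" for r
  proof (cases "r = 0")
    case True
    then show ?thesis using \<alpha>0 b by (simp add: zero_ereal_def)
  next
    case False
    then show ?thesis using range[of r] that by simp
  qed
  moreover have "smooth_on (geodesic_ball R :: (real^4) set) (rot_map \<alpha> :: real^4 \<Rightarrow> real^4)"
    using bih unfolding biharmonic_def by (rule conjunct1)
  ultimately have var: "variation (geodesic_ball R :: (real^4) set) (geodesic_ball b) D (rot_map \<alpha>) \<epsilon> \<Phi>"
    unfolding \<Phi>_def D_def \<eta>_def
    by (intro radial_variation[OF pq _ \<epsilon>(1) \<epsilon>(2)[unfolded \<eta>_def]]) assumption+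
  have Dc: "compact D"
  proof -
    have "D = cball 0 q - ball 0 p" by (auto simp: D_def)
    then show ?thesis by (simp only: compact_diff[OF compact_cball open_ball])
  qed
  have "D \<subseteq> geodesic_ball R"
    using pq(3) unfolding D_def geodesic_ball_def by (auto intro: le_less_trans[of "ereal _" "ereal q" R])
  with bih Dc var have "((\<lambda>t. bienergy flat_metric (model_metric (H 0)) D (\<Phi> t)) has_real_derivative 0) (at 0)"
    unfolding biharmonic_def by meson
  then have "((\<lambda>t. C * integral {p..q} (F t)) has_real_derivative 0) (at 0)"
    by (rule has_field_derivative_transform_within_open[of _ _ _ I]) (use I0 energy in \<open>auto simp: I_def\<close>)
  moreover have "((\<lambda>t. C * integral {p..q} (F t)) has_real_derivative C * integral {p..q} (F' 0)) (at 0)"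
    by (rule DERIV_cmult[OF leib])
  ultimately have "C * integral {p..q} (F' 0) = 0" by (metis DERIV_unique)
  then have zero: "integral {p..q} (F' 0) = 0" using C by simp
  \<comment> \<open>\<open>w1\<close> and \<open>w2\<close> are the derivatives of \<open>w\<close> in \<open>r\<close>, with \<open>r \<alpha>' = h(\<alpha>)\<close> inserted.\<close>
  define w where "w = (\<lambda>r. scaled_tension H (\<alpha> r))"
  define w1 where "w1 = (\<lambda>r. scaled_tension1 H (\<alpha> r) * (H 0 (\<alpha> r) / r))"
  define w2 where "w2 = (\<lambda>r. ((scaled_tension2 H (\<alpha> r) * H 0 (\<alpha> r) + scaled_tension1 H (\<alpha> r) * H 1 (\<alpha> r)) * H 0 (\<alpha> r)
     - scaled_tension1 H (\<alpha> r) * H 0 (\<alpha> r)) / r\<^sup>2)"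
  have Suc_num: "H (Suc 0) = H 1" "H (Suc 1) = H 2" "H (Suc 2) = H 3"
    by (simp_all add: numeral_2_eq_2 numeral_3_eq_3)
  have dst: "(scaled_tension H has_real_derivative scaled_tension1 H a) (at a)" "(scaled_tension1 H has_real_derivative scaled_tension2 H a) (at a)"
    if a: "0 < a" "ereal a < b" for a
  proof -
    note D0 = H[OF a, of 0, unfolded Suc_num] and D1 = H[OF a, of 1, unfolded Suc_num] and D2 = H[OF a, of 2, unfolded Suc_num]
    show "(scaled_tension H has_real_derivative scaled_tension1 H a) (at a)"
      unfolding scaled_tension_def[abs_def] scaled_tension1_def
      by (rule derivative_eq_intros D0 D1 refl)+ (simp add: algebra_simps)
    show "(scaled_tension1 H has_real_derivative scaled_tension2 H a) (at a)"
      unfolding scaled_tension1_def[abs_def] scaled_tension2_def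
      by (rule derivative_eq_intros D0 D1 D2 refl)+ (simp add: algebra_simps)
  qed
  have dw: "(w has_real_derivative w1 r) (at r)" if "r \<in> S" for r
    unfolding w_def w1_def by (rule DERIV_chain2[OF dst(1) ode]) (use range[OF rS[OF that]] rS[OF that] in auto)
  have dw1: "(w1 has_real_derivative w2 r) (at r)" if "r \<in> S" for r
  proof -
    have d1: "((\<lambda>r. scaled_tension1 H (\<alpha> r)) has_real_derivative scaled_tension2 H (\<alpha> r) * (H 0 (\<alpha> r) / r)) (at r)"
      by (rule DERIV_chain2[OF dst(2) ode]) (use range[OF rS[OF that]] rS[OF that] in auto)
    have "(w1 has_real_derivative scaled_tension2 H (\<alpha> r) * (H 0 (\<alpha> r) / r) * (H 0 (\<alpha> r) / r)
         + \<alpha>2 r * scaled_tension1 H (\<alpha> r)) (at r)"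
      unfolding w1_def using DERIV_mult[OF d1 d\<alpha>1[OF that, unfolded \<alpha>1_def]] .
    then show ?thesis
      using rS[OF that] by (simp add: w2_def \<alpha>2_def field_simps power2_eq_square)
  qed
  have ibp: "((\<lambda>r. w r * (r * \<eta>2 r + 3 * \<eta>1 r) - (r * w2 r - w1 r) * \<eta> r) has_integral 0) {p..q}"
  proof (rule integration_by_parts_twice[OF less_imp_le[OF pq(2)]])
    show "\<eta> p = 0" "\<eta> q = 0" unfolding \<eta>_def
      by (rule radial_bump_props(3)[OF pq(1,2)]; use pq in simp)+
  qed (use dw dw1 \<eta> pqS in \<open>blast+\<close>)
  have F'0: "F' 0 r = 2 * ((w r * (r * \<eta>2 r + 3 * \<eta>1 r) - (r * w2 r - w1 r) * \<eta> r)
      + euler_lagrange H (\<alpha> r) / r * \<eta> r)" if "r \<in> {p..q}" for r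
  proof -
    have r: "r \<noteq> 0" by (rule nz[OF that])
    have "T 0 r = w r / r\<^sup>2"
      using r by (simp add: T_def radial_tension_def \<alpha>1_def \<alpha>2_def w_def scaled_tension_def field_simps power2_eq_square)
    then have "F' 0 r = 2 * (w r * (r * T' 0 r))"
      using r by (simp add: F'_def power2_eq_square power3_eq_cube)
    also have "r * T' 0 r = r * \<eta>2 r + 3 * \<eta>1 r - 3 * ((H 1 (\<alpha> r))\<^sup>2 + H 0 (\<alpha> r) * H 2 (\<alpha> r)) * \<eta> r / r"
      using r by (simp add: T'_def field_simps power2_eq_square)
    finally have 1: "F' 0 r = 2 * (w r * (r * \<eta>2 r + 3 * \<eta>1 r)
        - 3 * ((H 1 (\<alpha> r))\<^sup>2 + H 0 (\<alpha> r) * H 2 (\<alpha> r)) * w r / r * \<eta> r)"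
      by (simp add: algebra_simps)
    have "r * w2 r - w1 r = ((scaled_tension2 H (\<alpha> r) * H 0 (\<alpha> r) + scaled_tension1 H (\<alpha> r) * H 1 (\<alpha> r)) * H 0 (\<alpha> r)
       - 2 * scaled_tension1 H (\<alpha> r) * H 0 (\<alpha> r)) / r"
      using r by (simp add: w2_def w1_def field_simps power2_eq_square)
    then have "euler_lagrange H (\<alpha> r) / r = (r * w2 r - w1 r)
       - 3 * ((H 1 (\<alpha> r))\<^sup>2 + H 0 (\<alpha> r) * H 2 (\<alpha> r)) * w r / r"
      by (simp add: euler_lagrange_def w_def diff_divide_distrib)
    moreover have "2 * (X - M * n) = 2 * ((X - Y * n) + e * n)" if "e = Y - M" for X Y M n e :: real
      unfolding that by (simp add: algebra_simps)
    ultimately show ?thesis unfolding 1 by blast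
  qed
  have "continuous_on {p..q} (\<lambda>r. euler_lagrange H (\<alpha> r) / r * \<eta> r)"
    unfolding euler_lagrange_def scaled_tension_def scaled_tension1_def scaled_tension2_def using nz
    by (intro continuous_intros cH\<alpha> c\<eta>) auto
  then have "((\<lambda>r. euler_lagrange H (\<alpha> r) / r * \<eta> r) has_integral
      integral {p..q} (\<lambda>r. euler_lagrange H (\<alpha> r) / r * \<eta> r)) {p..q}"
    by (intro integrable_integral integrable_continuous_real)
  from has_integral_mult_right[OF has_integral_add[OF ibp this], of 2]
  have "(F' 0 has_integral 2 * (0 + integral {p..q} (\<lambda>r. euler_lagrange H (\<alpha> r) / r * \<eta> r))) {p..q}"
    by (rule has_integral_eq[rotated]) (rule F'0[symmetric])
  with zero have "2 * (0 + integral {p..q} (\<lambda>r. euler_lagrange H (\<alpha> r) / r * \<eta> r)) = 0"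
    by (metis integral_unique)
  then show ?thesis unfolding \<eta>_def by simp
qed

text \<open>The fundamental lemma of the calculus of variations: were the Euler-Lagrange expression nonzero
  at \<open>r\<close>, it would have constant sign on an interval around \<open>r\<close>, and a bump supported there would
  contradict \<open>first_variation\<close>. The factor \<open>2 h(\<alpha>)\<close> is positive and cancels.\<close>

lemma biharmonic_profile_third_order_ode:
  fixes H :: "nat \<Rightarrow> real \<Rightarrow> real" and \<alpha> :: "real \<Rightarrow> real"
  assumes H: "\<And>n a. 0 < a \<Longrightarrow> ereal a < b \<Longrightarrow> (H n has_real_derivative H (Suc n) a) (at a)"
    and Hpos: "\<And>a. 0 < a \<Longrightarrow> ereal a < b \<Longrightarrow> 0 < H 0 a"
    and b: "0 < b" and \<alpha>0: "\<alpha> 0 = 0"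
    and range: "\<And>r. 0 < r \<Longrightarrow> ereal r < R \<Longrightarrow> 0 < \<alpha> r \<and> ereal (\<alpha> r) < b"
    and ode: "\<And>r. 0 < r \<Longrightarrow> ereal r < R \<Longrightarrow> (\<alpha> has_real_derivative H 0 (\<alpha> r) / r) (at r)"
    and bih: "biharmonic (geodesic_ball R) flat_metric (geodesic_ball b) (model_metric (H 0))
       (rot_map \<alpha> :: real^4 \<Rightarrow> real^4)"
    and r: "0 < r" "ereal r < R"
  shows "H 0 (\<alpha> r) * (3 * H 1 (\<alpha> r) * H 2 (\<alpha> r) + H 0 (\<alpha> r) * H 3 (\<alpha> r)) =
    2 * H 1 (\<alpha> r) * ((H 1 (\<alpha> r))\<^sup>2 + H 0 (\<alpha> r) * H 2 (\<alpha> r) - 1)"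
proof -
  define S where "S = {r. 0 < r \<and> ereal r < R}"
  have S: "open S" unfolding S_def by (rule open_radial_interior)
  define e where "e = (\<lambda>s. euler_lagrange H (\<alpha> s))"
  have cH\<alpha>: "continuous_on S (\<lambda>r. H n (\<alpha> r))" for n
    by (intro continuous_at_imp_continuous_on ballI DERIV_isCont[OF DERIV_chain2[OF H ode]])
      (use range in \<open>auto simp: S_def\<close>)
  have ce: "continuous_on S e"
    unfolding e_def euler_lagrange_def scaled_tension_def scaled_tension1_def scaled_tension2_def
    by (intro continuous_intros cH\<alpha>)
  have "e r = 0"
  proof (rule ccontr)
    assume nz: "e r \<noteq> 0"
    \<comment> \<open>Multiplication by \<open>e r\<close> treats both signs at once.\<close>
    define f where "f = (\<lambda>s. e r * e s)"
    have "continuous_on S f" unfolding f_def by (intro continuous_intros ce)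
    then have "open (S \<inter> f -` {0<..})"
      by (intro continuous_open_preimage S) auto
    moreover have "r \<in> S \<inter> f -` {0<..}" using r nz by (auto simp: S_def f_def zero_less_mult_iff linorder_neq_iff)
    ultimately obtain d where d: "0 < d" "cball r d \<subseteq> S \<inter> f -` {0<..}"
      by (meson open_contains_cball)
    have sub: "{r - d..r + d} \<subseteq> S \<inter> f -` {0<..}" using d(2) by (simp add: cball_eq_atLeastAtMost)
    then have ends: "r - d \<in> S" "r + d \<in> S" using d(1) by auto
    have pq: "0 < r - d" "r - d < r + d" "ereal (r + d) < R" using ends d(1) by (auto simp: S_def)
    have int: "integral {r - d..r + d} (\<lambda>s. e s / s * radial_bump (r - d) (r + d) s) = 0"
      unfolding e_def by (rule first_variation[OF H Hpos b \<alpha>0 range ode bih pq])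
    have "integral {r - d..r + d} (\<lambda>s. (e r * e s / s) * radial_bump (r - d) (r + d) s) \<noteq> 0"
    proof (rule integral_times_positive_bump_nonzero[OF pq(2)])
      obtain \<eta>1 where "\<And>s. (radial_bump (r - d) (r + d) has_real_derivative \<eta>1 s) (at s)"
        using radial_bump_derivatives[OF pq(1,2)] by metis
      then show "continuous_on {r - d..r + d} (radial_bump (r - d) (r + d))"
        by (intro continuous_at_imp_continuous_on ballI) (rule DERIV_isCont)
      have "continuous_on {r - d..r + d} e" using continuous_on_subset[OF ce] sub by blast
      then show "continuous_on {r - d..r + d} (\<lambda>s. e r * e s / s)"
        using pq(1) by (intro continuous_intros) auto
      show "0 < e r * e s / s" if "s \<in> {r - d..r + d}" for s
      proof -
        have "0 < f s" using sub that by blast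
        then show ?thesis using that pq(1) by (simp add: f_def)
      qed
      show "0 \<le> radial_bump (r - d) (r + d) s" if "s \<in> {r - d..r + d}" for s
        by (rule radial_bump_props(2)[OF pq(1,2)]) (use that pq(1) in simp)
      show "0 < radial_bump (r - d) (r + d) s" if "s \<in> {r - d<..<r + d}" for s
        by (rule radial_bump_props(1)[OF pq(1,2)]) (use that in simp_all)
    qed
    moreover have "integral {r - d..r + d} (\<lambda>s. (e r * e s / s) * radial_bump (r - d) (r + d) s) = 0"
    proof -
      have "(\<lambda>s. (e r * e s / s) * radial_bump (r - d) (r + d) s) =
          (\<lambda>s. e r * (e s / s * radial_bump (r - d) (r + d) s))"
        by (simp add: fun_eq_iff)
      then show ?thesis by (simp only: integral_mult_right int mult_zero_right)
    qed
    ultimately show False by contradiction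
  qed
  then show ?thesis
    using Hpos[of "\<alpha> r"] range[OF r] unfolding e_def euler_lagrange_factor by simp
qed

section \<open>Maximal profiles\<close>

text \<open>By the intermediate value theorem a profile that misses \<open>a\<close> stays below \<open>a\<close>; it then extends to a
  larger ball by \<open>bounded_profile_extends\<close>. The extended map is conformal: away from the origin
  by its differential equation, at the origin because it agrees with the given map nearby.\<close>

lemma maximal_profile_onto:
  fixes \<alpha> h :: "real \<Rightarrow> real"
  assumes model: "model b h" and rot: "rotationally_symmetric R b \<alpha>"
    and conf: "conformal (geodesic_ball R) flat_metric (geodesic_ball b) (model_metric h)
      (rot_map \<alpha> :: real^'n::finite \<Rightarrow> real^'n)"
    and card: "2 \<le> CARD('n)"
    and maximal: "\<not> (\<exists>R' \<beta>. R < R' \<and> rotationally_symmetric R' b \<beta> \<and>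
           (\<forall>r. 0 \<le> r \<and> ereal r < R \<longrightarrow> \<beta> r = \<alpha> r) \<and>
           conformal (geodesic_ball R') flat_metric (geodesic_ball b) (model_metric h)
             (rot_map \<beta> :: real^'n \<Rightarrow> real^'n))"
    and a: "0 \<le> a" "ereal a < b"
  shows "\<exists>r. 0 \<le> r \<and> ereal r < R \<and> \<alpha> r = a"
proof (rule ccontr)
  assume none: "\<not> (\<exists>r. 0 \<le> r \<and> ereal r < R \<and> \<alpha> r = a)"
  note less = profile_ode(1)[OF model rot conf card] and ode = profile_ode(2)[OF model rot conf card]
  have \<alpha>0: "\<alpha> 0 = 0" and R0: "0 < R" using rot unfolding rotationally_symmetric_def by blast+
  have "smooth_on_interval (radial_interval R) \<alpha>"
    using rot unfolding rotationally_symmetric_def radial_interval_def by blast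
  then obtain D where D0: "D 0 = \<alpha>"
    and D: "\<forall>n. \<forall>x\<in>radial_interval R. (D n has_real_derivative D (Suc n) x) (at x within radial_interval R)"
    unfolding smooth_on_interval_def by blast
  have cont: "continuous_on (radial_interval R) \<alpha>"
    by (rule DERIV_continuous_on[of _ _ "D 1"]) (use D[rule_format, of _ 0] D0 in simp)
  have bound: "\<alpha> r \<le> a" if "0 \<le> r" "ereal r < R" for r
  proof (rule ccontr)
    assume "\<not> \<alpha> r \<le> a"
    have sub: "{0..r} \<subseteq> radial_interval R"
      by (rule Icc_radial_interval) (use that in \<open>simp add: radial_interval_def\<close>)
    have "\<exists>s\<ge>0. s \<le> r \<and> \<alpha> s = a"
      by (rule IVT') (use \<open>\<not> \<alpha> r \<le> a\<close> that a(1) \<alpha>0 continuous_on_subset[OF cont sub] in auto)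
    then show False using none sub by (auto simp: radial_interval_def subset_iff)
  qed
  obtain R' \<beta> where RR': "R < R'" and rot': "rotationally_symmetric R' b \<beta>"
    and agree: "\<And>r. 0 \<le> r \<Longrightarrow> ereal r < R \<Longrightarrow> \<beta> r = \<alpha> r"
    and less': "\<And>r. 0 \<le> r \<Longrightarrow> ereal r < R' \<Longrightarrow> ereal (\<beta> r) < b"
    and ode': "\<And>r. 0 < r \<Longrightarrow> ereal r < R' \<Longrightarrow> (\<beta> has_real_derivative h (\<beta> r) / r) (at r)"
    using bounded_profile_extends[OF model rot ode a(2) bound] by blast
  have pos': "0 < \<beta> r" if "0 < r" "ereal r < R'" for r
    using rot' that unfolding rotationally_symmetric_def by blast
  have hpos: "0 < h s" if "0 < s" "ereal s < b" for s
    using model that unfolding model_def by blast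
  let ?U = "geodesic_ball R :: (real^'n) set"
  have zeroU: "0 \<in> ?U" using R0 by (simp add: geodesic_ball_def zero_ereal_def)
  have same: "rot_map \<beta> x = rot_map \<alpha> x" if "x \<in> ?U" for x
    using agree[of "norm x"] that by (simp add: rot_map_def geodesic_ball_def)
  obtain \<rho> where \<rho>: "\<forall>x\<in>?U. 0 < \<rho> x"
    "\<forall>x\<in>?U. \<forall>v w. model_metric h (rot_map \<alpha> x) (frechet_derivative (rot_map \<alpha>) (at x) v)
        (frechet_derivative (rot_map \<alpha>) (at x) w) = (\<rho> x)\<^sup>2 * flat_metric x v w"
    and diff: "\<forall>x\<in>?U. rot_map \<alpha> differentiable (at x)"
    using conf unfolding conformal_def by blast
  have fd: "frechet_derivative (rot_map \<beta>) (at (0 :: real^'n)) = frechet_derivative (rot_map \<alpha>) (at 0)"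
    by (rule frechet_derivative_cong_open(1)[OF open_geodesic_ball zeroU]) (rule same)
  have "rot_map \<beta> differentiable (at (0 :: real^'n)) \<longleftrightarrow> rot_map \<alpha> differentiable (at (0 :: real^'n))"
    by (rule frechet_derivative_cong_open(2)[OF open_geodesic_ball zeroU]) (rule same)
  then have diff0: "rot_map \<beta> differentiable (at (0 :: real^'n))" using diff zeroU by blast
  have "conformal (geodesic_ball R') flat_metric (geodesic_ball b) (model_metric h)
      (rot_map \<beta> :: real^'n \<Rightarrow> real^'n)"
  proof (rule conformal_rot_mapI)
    show "rot_map \<beta> ` geodesic_ball R' \<subseteq> (geodesic_ball b :: (real^'n) set)"
    proof (rule image_subsetI)
      have b0: "ereal 0 < b" by (rule le_less_trans[OF _ a(2)]) (simp add: a(1))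
      fix x :: "real^'n" assume "x \<in> geodesic_ball R'"
      then have x: "ereal (norm x) < R'" by (simp add: geodesic_ball_def)
      have "norm (rot_map \<beta> x) = \<beta> (norm x) \<or> norm (rot_map \<beta> x) = 0"
        using pos'[OF _ x] by (cases "x = 0") (simp_all add: rot_map_def less_imp_le)
      then show "rot_map \<beta> x \<in> geodesic_ball b"
        using less'[OF norm_ge_zero x] b0 by (auto simp: geodesic_ball_def)
    qed
    show "0 < \<beta> (norm x) \<and> 0 < h (\<beta> (norm x)) \<and>
      (\<beta> has_real_derivative h (\<beta> (norm x)) / norm x) (at (norm x))"
      if "x \<in> geodesic_ball R'" "x \<noteq> 0" for x :: "real^'n"
    proof -
      have x: "0 < norm x" "ereal (norm x) < R'" using that by (simp_all add: geodesic_ball_def)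
      show ?thesis using pos'[OF x] hpos[OF pos'[OF x] less'[OF norm_ge_zero x(2)]] ode'[OF x] by blast
    qed
    show "0 < \<rho> 0" using \<rho>(1) zeroU by blast
    show "rot_map \<beta> differentiable (at (0 :: real^'n))" by (rule diff0)
    show "model_metric h (rot_map \<beta> 0) (frechet_derivative (rot_map \<beta>) (at 0) v)
        (frechet_derivative (rot_map \<beta>) (at 0) w) = (\<rho> 0)\<^sup>2 * (v \<bullet> w)" for v w :: "real^'n"
      using \<rho>(2)[rule_format, OF zeroU, of v w] unfolding fd same[OF zeroU] flat_metric_def .
  qed
  with maximal RR' rot' agree show False by blast
qed

lemma rot_map_onto:
  fixes \<alpha> :: "real \<Rightarrow> real"
  assumes "rot_map \<alpha> ` (geodesic_ball R :: (real^'n::finite) set) \<subseteq> geodesic_ball b"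
    and onto: "\<And>a. 0 \<le> a \<Longrightarrow> ereal a < b \<Longrightarrow> \<exists>r. 0 \<le> r \<and> ereal r < R \<and> \<alpha> r = a"
    and "0 < R" "\<alpha> 0 = 0"
  shows "rot_map \<alpha> ` (geodesic_ball R :: (real^'n) set) = geodesic_ball b"
proof
  show "(geodesic_ball b :: (real^'n) set) \<subseteq> rot_map \<alpha> ` geodesic_ball R"
  proof
    fix y :: "real^'n" assume "y \<in> geodesic_ball b"
    then obtain r where r: "0 \<le> r" "ereal r < R" "\<alpha> r = norm y"
      using onto[of "norm y"] by (auto simp: geodesic_ball_def)
    show "y \<in> rot_map \<alpha> ` geodesic_ball R"
    proof (cases "y = 0")
      case True
      then have "y = rot_map \<alpha> 0" by (simp add: rot_map_def)
      moreover have "0 \<in> geodesic_ball R" using assms(3) by (simp add: geodesic_ball_def zero_ereal_def)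
      ultimately show ?thesis by (rule image_eqI)
    next
      case False
      then have "r \<noteq> 0" using r(3) assms(4) by auto
      define x where "x = r *\<^sub>R (y /\<^sub>R norm y)"
      have nx: "norm x = r" using False r(1) by (simp add: x_def)
      have "norm y * (inverse r * (r * inverse (norm y))) = 1"
        using False \<open>r \<noteq> 0\<close> by (simp add: field_simps)
      then have "y = rot_map \<alpha> x"
        unfolding rot_map_def nx r(3) unfolding x_def by simp
      moreover have "x \<in> geodesic_ball R" using nx r(2) by (simp add: geodesic_ball_def)
      ultimately show ?thesis by (rule image_eqI)
    qed
  qed
qed (rule assms(1))

section \<open>Classification\<close>

text \<open>If \<open>f' h = f\<close>, then \<open>f \<circ> \<alpha>\<close> satisfies the equation \<open>r z' = z\<close>, whose solutions are linear.\<close>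

lemma profile_first_integral:
  fixes \<alpha> h f :: "real \<Rightarrow> real"
  assumes ode: "\<And>r. 0 < r \<Longrightarrow> ereal r < R \<Longrightarrow> (\<alpha> has_real_derivative h (\<alpha> r) / r) (at r)"
    and f: "\<And>r. 0 < r \<Longrightarrow> ereal r < R \<Longrightarrow> (f has_real_derivative f' (\<alpha> r)) (at (\<alpha> r))"
    and eq: "\<And>r. 0 < r \<Longrightarrow> ereal r < R \<Longrightarrow> f' (\<alpha> r) * h (\<alpha> r) = f (\<alpha> r)"
  shows "\<exists>k. \<forall>r. 0 < r \<and> ereal r < R \<longrightarrow> f (\<alpha> r) = k * r"
proof -
  define S where "S = radial_interval R \<inter> {0<..}"
  have "\<exists>k. \<forall>r\<in>S. f (\<alpha> r) / r = k"
  proof (rule has_field_derivative_zero_constant)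
    show "convex S" unfolding S_def by (intro convex_Int convex_radial_interval) simp
    fix r assume "r \<in> S"
    then have r: "0 < r" "ereal r < R" by (auto simp: S_def radial_interval_def)
    have "((\<lambda>r. f (\<alpha> r)) has_real_derivative f' (\<alpha> r) * (h (\<alpha> r) / r)) (at r)"
      by (rule DERIV_chain2[OF f[OF r] ode[OF r]])
    then have "((\<lambda>r. f (\<alpha> r) / r) has_real_derivative
        (f' (\<alpha> r) * (h (\<alpha> r) / r) * r - f (\<alpha> r) * 1) / (r * r)) (at r)"
      by (rule DERIV_divide[OF _ DERIV_ident]) (use r in simp)
    also have "(f' (\<alpha> r) * (h (\<alpha> r) / r) * r - f (\<alpha> r) * 1) / (r * r) = 0"
      using r eq[OF r] by simp
    finally show "((\<lambda>r. f (\<alpha> r) / r) has_real_derivative 0) (at r within S)"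
      by (rule has_field_derivative_at_within)
  qed
  then obtain k where k: "\<forall>r\<in>S. f (\<alpha> r) / r = k" ..
  have "f (\<alpha> r) = k * r" if "0 < r" "ereal r < R" for r
    using bspec[OF k, of r] that by (simp add: S_def radial_interval_def field_simps)
  then show ?thesis by blast
qed

text \<open>The function \<open>f(a) = tan (d a/2)\<close> satisfies \<open>f' h = f\<close> for \<open>h(a) = sin (d a)/d\<close>. The bound
  \<open>\<alpha> < pi/d\<close> keeps the angle in the range where \<open>arctan\<close> inverts \<open>tan\<close>.\<close>

lemma spherical_profile:
  fixes \<alpha> h :: "real \<Rightarrow> real"
  assumes d: "0 < d"
    and ode: "\<And>r. 0 < r \<Longrightarrow> ereal r < R \<Longrightarrow> (\<alpha> has_real_derivative h (\<alpha> r) / r) (at r)"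
    and range: "\<And>r. 0 < r \<Longrightarrow> ereal r < R \<Longrightarrow> 0 < \<alpha> r \<and> \<alpha> r < pi / d"
    and h: "\<And>r. 0 < r \<Longrightarrow> ereal r < R \<Longrightarrow> h (\<alpha> r) = (1 / d) * sin (d * \<alpha> r)"
  shows "\<exists>k. \<forall>r. 0 < r \<and> ereal r < R \<longrightarrow> 0 < k \<and> \<alpha> r = (2 / d) * arctan (k * r)"
proof -
  have u: "0 < d * \<alpha> r / 2" "d * \<alpha> r / 2 < pi / 2" if "0 < r" "ereal r < R" for r
    using range[OF that] d by (simp_all add: pos_less_divide_eq mult.commute)
  have c: "cos (d * \<alpha> r / 2) \<noteq> 0" if "0 < r" "ereal r < R" for r
    using cos_gt_zero_pi[of "d * \<alpha> r / 2"] u[OF that] by simp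
  have "\<exists>k. \<forall>r. 0 < r \<and> ereal r < R \<longrightarrow> tan (d * \<alpha> r / 2) = k * r"
  proof (rule profile_first_integral[OF ode, where f="\<lambda>a. tan (d * a / 2)"])
    fix r assume r: "0 < r" "ereal r < R"
    have "((\<lambda>a. d * a / 2) has_real_derivative d * 1 / 2) (at (\<alpha> r))"
      by (intro DERIV_cdivide DERIV_cmult DERIV_ident)
    from DERIV_chain2[OF DERIV_tan[OF c[OF r]] this]
    show "((\<lambda>a. tan (d * a / 2)) has_real_derivative
        inverse ((cos (d * \<alpha> r / 2))\<^sup>2) * (d / 2)) (at (\<alpha> r))" by simp
    have "sin (d * \<alpha> r) = 2 * sin (d * \<alpha> r / 2) * cos (d * \<alpha> r / 2)"
      using sin_double[of "d * \<alpha> r / 2"] by simp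
    then show "inverse ((cos (d * \<alpha> r / 2))\<^sup>2) * (d / 2) * h (\<alpha> r) = tan (d * \<alpha> r / 2)"
      using h[OF r] d c[OF r] by (simp add: tan_def field_simps power2_eq_square)
  qed
  then obtain k where k: "\<And>r. 0 < r \<Longrightarrow> ereal r < R \<Longrightarrow> tan (d * \<alpha> r / 2) = k * r" by blast
  have "0 < k \<and> \<alpha> r = (2 / d) * arctan (k * r)" if r: "0 < r" "ereal r < R" for r
  proof
    have "0 < k * r" using tan_gt_zero[OF u[OF r]] k[OF r] by simp
    then show "0 < k" using r(1) by (simp add: zero_less_mult_iff)
    have "arctan (k * r) = d * \<alpha> r / 2"
      unfolding k[OF r, symmetric] by (rule arctan_tan) (use u[OF r] in auto)
    then show "\<alpha> r = (2 / d) * arctan (k * r)" using d by (simp add: field_simps)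
  qed
  then show ?thesis by blast
qed

text \<open>Here \<open>f(a) = tanh (d a/2)\<close> plays the part of the tangent.\<close>

lemma hyperbolic_profile:
  fixes \<alpha> h :: "real \<Rightarrow> real"
  assumes d: "0 < d"
    and ode: "\<And>r. 0 < r \<Longrightarrow> ereal r < R \<Longrightarrow> (\<alpha> has_real_derivative h (\<alpha> r) / r) (at r)"
    and pos: "\<And>r. 0 < r \<Longrightarrow> ereal r < R \<Longrightarrow> 0 < \<alpha> r"
    and h: "\<And>r. 0 < r \<Longrightarrow> ereal r < R \<Longrightarrow> h (\<alpha> r) = (1 / d) * sinh (d * \<alpha> r)"
  shows "\<exists>k. \<forall>r. 0 < r \<and> ereal r < R \<longrightarrow> 0 < k \<and> k * r < 1 \<and> \<alpha> r = (2 / d) * artanh (k * r)"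
proof -
  have "\<exists>k. \<forall>r. 0 < r \<and> ereal r < R \<longrightarrow> tanh (d * \<alpha> r / 2) = k * r"
  proof (rule profile_first_integral[OF ode, where f="\<lambda>a. tanh (d * a / 2)"])
    fix r assume r: "0 < r" "ereal r < R"
    show "((\<lambda>a. tanh (d * a / 2)) has_real_derivative
        (1 - (tanh (d * \<alpha> r / 2))\<^sup>2) * (d / 2)) (at (\<alpha> r))"
      by (auto intro!: derivative_eq_intros simp: cosh_real_nonzero)
    have s: "sinh (d * \<alpha> r) = 2 * sinh (d * \<alpha> r / 2) * cosh (d * \<alpha> r / 2)"
      using sinh_double[of "d * \<alpha> r / 2"] by simp
    have t: "1 - (tanh (d * \<alpha> r / 2))\<^sup>2 = 1 / (cosh (d * \<alpha> r / 2))\<^sup>2"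
    proof -
      have "1 - (tanh u)\<^sup>2 = ((cosh u)\<^sup>2 - (sinh u)\<^sup>2) / (cosh u)\<^sup>2" for u :: real
        by (simp add: tanh_def power_divide diff_divide_distrib cosh_real_nonzero)
      then show ?thesis by (simp only: hyperbolic_pythagoras)
    qed
    show "(1 - (tanh (d * \<alpha> r / 2))\<^sup>2) * (d / 2) * h (\<alpha> r) = tanh (d * \<alpha> r / 2)"
      unfolding t h[OF r] s using d by (simp add: tanh_def power2_eq_square)
  qed
  then obtain k where k: "\<And>r. 0 < r \<Longrightarrow> ereal r < R \<Longrightarrow> tanh (d * \<alpha> r / 2) = k * r" by blast
  have "0 < k \<and> k * r < 1 \<and> \<alpha> r = (2 / d) * artanh (k * r)" if r: "0 < r" "ereal r < R" for r
  proof (intro conjI)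
    have "0 < k * r" using k[OF r] pos[OF r] d by (simp flip: k[OF r])
    then show "0 < k" using r(1) by (simp add: zero_less_mult_iff)
    show "k * r < 1" unfolding k[OF r, symmetric] by (rule tanh_real_lt_1)
    have "artanh (k * r) = d * \<alpha> r / 2"
      unfolding k[OF r, symmetric] by (rule artanh_tanh_real)
    then show "\<alpha> r = (2 / d) * artanh (k * r)" using d by (simp add: field_simps)
  qed
  then show ?thesis by blast
qed

lemma harmonic_dilation:
  fixes \<phi> :: "real^'n::finite \<Rightarrow> real^'n"
  assumes "open U" "\<And>x. x \<in> U \<Longrightarrow> \<phi> x = c *\<^sub>R x" "x \<in> U"
  shows "tension flat_metric flat_metric \<phi> x = 0"
proof -
  have p: "partial i (\<lambda>y. \<phi> y $ k) y = c * kron i k" if "y \<in> U" for i k y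
  proof -
    have "partial i (\<lambda>y. \<phi> y $ k) y = partial i (\<lambda>y. c * y $ k) y"
      by (rule partial_cong_open[OF assms(1) that]) (simp add: assms(2))
    also have "\<dots> = c * kron i k"
      by (subst partial_eqI[OF has_derivative_mult_right[OF has_derivative_component]])
        (simp add: axis_nth_kron)
    finally show ?thesis .
  qed
  have "partial i (partial i (\<lambda>y. \<phi> y $ k)) x = 0" for i k
  proof -
    have "partial i (partial i (\<lambda>y. \<phi> y $ k)) x = partial i (\<lambda>y. c * kron i k) x"
      by (rule partial_cong_open[OF assms(1,3) p])
    then show ?thesis by (simp add: partial_def)
  qed
  then show ?thesis by (simp add: tension_flat_domain christoffel_flat vec_eq_iff)
qed

lemma at_0_within_radial_interval:
  assumes "0 < b"
  shows "at 0 within radial_interval b \<noteq> bot"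
proof -
  obtain \<delta> where \<delta>: "0 < \<delta>" "ereal \<delta> < b"
    using ereal_dense2[OF assms] by (auto simp: zero_ereal_def)
  have "{0..\<delta>} \<subseteq> radial_interval b"
    by (rule Icc_radial_interval) (use \<delta> in \<open>simp add: radial_interval_def\<close>)
  then have "at 0 within {0..\<delta>} \<le> at 0 within radial_interval b" by (rule at_le)
  moreover have "at 0 within {0..\<delta>} \<noteq> bot"
    using \<delta>(1) by (simp add: at_within_Icc_at_right trivial_limit_at_right_real)
  ultimately show ?thesis by (metis bot.extremum_uniqueI)
qed

text \<open>The linear equation \<open>h'' = \<kappa> h\<close> with \<open>h(0) = 0\<close> and \<open>h'(0) = 1\<close> determines \<open>h\<close> on \<open>[0, b)\<close>. The
  length \<open>b\<close> follows from the zeros of the solution: \<open>h\<close> is positive on \<open>(0, b)\<close> and, by continuity,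
  vanishes at \<open>b\<close> if \<open>b\<close> is finite.\<close>

lemma warping_function_cases:
  fixes H :: "nat \<Rightarrow> real \<Rightarrow> real"
  assumes model: "model b (H 0)"
    and H: "\<And>n a. a \<in> model_interval b \<Longrightarrow> (H n has_real_derivative H (Suc n) a) (at a within model_interval b)"
    and eq: "\<And>a. 0 < a \<Longrightarrow> ereal a < b \<Longrightarrow> H 0 a * (3 * H 1 a * H 2 a + H 0 a * H 3 a) =
      2 * H 1 a * ((H 1 a)\<^sup>2 + H 0 a * H 2 a - 1)"
  obtains d where "0 < d" "b = ereal (pi / d)" "\<And>a. a \<in> model_interval b \<Longrightarrow> H 0 a = (1 / d) * sin (d * a)"
  | d where "0 < d" "b = \<infinity>" "\<And>a. a \<in> model_interval b \<Longrightarrow> H 0 a = (1 / d) * sinh (d * a)"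
  | "b = \<infinity>" "\<And>a. a \<in> model_interval b \<Longrightarrow> H 0 a = a"
proof -
  define I where "I = radial_interval b"
  have b0: "0 < b" and H00: "H 0 0 = 0"
    and H1: "(H 0 has_real_derivative 1) (at 0 within model_interval b)"
    using model unfolding model_def by blast+
  have hpos: "0 < H 0 a" if "0 < a" "ereal a < b" for a
    using model that unfolding model_def by blast
  have IM: "I \<subseteq> model_interval b"
    by (auto simp: I_def radial_interval_def model_interval_def less_imp_le)
  have I0: "0 \<in> I" using b0 by (simp add: I_def radial_interval_def zero_ereal_def)
  have conv: "convex I" unfolding I_def by (rule convex_radial_interval)
  have nt: "at 0 within I \<noteq> bot" unfolding I_def by (rule at_0_within_radial_interval[OF b0])
  have HI: "(H n has_real_derivative H (Suc n) a) (at a within I)" if "a \<in> I" for n a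
    by (rule DERIV_subset[OF H IM]) (use that IM in blast)
  have H10: "H 1 0 = 1"
  proof -
    have "((\<lambda>y. (H 0 y - H 0 0) / (y - 0)) \<longlongrightarrow> H 1 0) (at 0 within I)"
      using HI[OF I0, of 0] by (simp add: has_field_derivative_iff)
    moreover have "((\<lambda>y. (H 0 y - H 0 0) / (y - 0)) \<longlongrightarrow> 1) (at 0 within I)"
      using DERIV_subset[OF H1 IM] by (simp add: has_field_derivative_iff)
    ultimately show ?thesis by (rule tendsto_unique[OF nt])
  qed
  have Suc_num: "H (Suc 0) = H 1" "H (Suc 1) = H 2" "H (Suc 2) = H 3"
    by (simp_all add: numeral_2_eq_2 numeral_3_eq_3)
  note D0 = HI[of _ 0, unfolded Suc_num] and D1 = HI[of _ 1, unfolded Suc_num] and D2 = HI[of _ 2, unfolded Suc_num]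
  have "\<exists>\<kappa>. \<forall>a\<in>I. (H 1 has_real_derivative \<kappa> * H 0 a) (at a within I)"
  proof (rule third_order_ode_imp_linear_ode[OF D0 D1 D2 conv I0 _ nt H00 H10])
    show "I \<subseteq> {0..}" by (auto simp: I_def radial_interval_def)
    fix a assume "a \<in> I" "0 < a"
    then have a: "0 < a" "ereal a < b" by (auto simp: I_def radial_interval_def)
    show "0 < H 0 a" by (rule hpos[OF a])
    show "H 0 a * (3 * H 1 a * H 2 a + H 0 a * H 3 a) = 2 * H 1 a * ((H 1 a)\<^sup>2 + H 0 a * H 2 a - 1)"
      by (rule eq[OF a])
  qed
  then obtain \<kappa> where \<kappa>: "\<And>a. a \<in> I \<Longrightarrow> (H 1 has_real_derivative \<kappa> * H 0 a) (at a within I)" by blast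
  have endpoint: "H 0 \<beta> = g \<beta> \<and> H 0 \<beta> = 0 \<and> 0 < \<beta>"
    if g: "\<And>a. a \<in> I \<Longrightarrow> H 0 a = g a" "continuous_on UNIV g" and \<beta>: "b = ereal \<beta>" for g \<beta>
  proof -
    have \<beta>0: "0 < \<beta>" using b0 \<beta> by simp
    have M: "model_interval b = {0..\<beta>}" by (auto simp: model_interval_def \<beta>)
    have "continuous_on {0..\<beta>} (H 0)"
      by (rule DERIV_continuous_on[of _ _ "H 1"]) (use H[of _ 0] M in simp)
    moreover have cl: "closure {0..<\<beta>} = {0..\<beta>}"
      by (rule closure_atLeastLessThan[OF \<beta>0])
    ultimately have cont: "continuous_on (closure {0..<\<beta>}) (\<lambda>a. H 0 a - g a)"
      using \<beta>0 continuous_on_subset[OF g(2)] by (simp add: continuous_on_diff)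
    have mem: "\<beta> \<in> closure {0..<\<beta>}" unfolding cl using \<beta>0 by simp
    have "H 0 a - g a = 0" if "a \<in> {0..<\<beta>}" for a
      using g(1)[of a] that by (simp add: I_def radial_interval_def \<beta>)
    then have "H 0 \<beta> - g \<beta> = 0"
      by (rule continuous_constant_on_closure[OF cont _ mem])
    moreover have "H 0 \<beta> = 0" using model \<beta> unfolding model_def by blast
    ultimately show ?thesis using \<beta>0 by simp
  qed
  have M_inf: "model_interval b = I" if "b = \<infinity>"
    by (auto simp: I_def radial_interval_def model_interval_def that)
  have b_cases: "b = \<infinity> \<or> (\<exists>\<beta>. b = ereal \<beta>)" using b0 by (cases b) auto
  consider "\<kappa> < 0" | "0 < \<kappa>" | "\<kappa> = 0" by linarith
  then show thesis
  proof cases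
    case 1
    define d where "d = sqrt (- \<kappa>)"
    have d: "0 < d" "\<kappa> = - (d\<^sup>2)" using 1 by (simp_all add: d_def)
    have h: "H 0 a = (1 / d) * sin (d * a)" if "a \<in> I" for a
      by (rule linear_ode_sin[OF conv I0 d(1) H00 H10 D0 _ that]) (use \<kappa> d(2) in simp_all)
    have "\<not> ereal (pi / d) < b"
    proof
      assume less: "ereal (pi / d) < b"
      have "0 < H 0 (pi / d)" by (rule hpos[OF _ less]) (use d in simp)
      moreover have "H 0 (pi / d) = 0"
        using h[of "pi / d"] less d by (simp add: I_def radial_interval_def)
      ultimately show False by simp
    qed
    then obtain \<beta> where \<beta>: "b = ereal \<beta>" "\<beta> \<le> pi / d"
      using b_cases by auto
    have "continuous_on UNIV (\<lambda>a. (1 / d) * sin (d * a))" by (intro continuous_intros)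
    from endpoint[OF h this \<beta>(1)] have e: "H 0 \<beta> = (1 / d) * sin (d * \<beta>)" "H 0 \<beta> = 0" "0 < \<beta>" by blast+
    have "\<beta> = pi / d"
    proof (rule ccontr)
      assume "\<beta> \<noteq> pi / d"
      then have "d * \<beta> < pi" using \<beta>(2) d(1) by (simp add: less_le field_simps)
      then have "0 < sin (d * \<beta>)" using d(1) e(3) by (intro sin_gt_zero) simp_all
      then show False using e d(1) by simp
    qed
    moreover have "H 0 a = (1 / d) * sin (d * a)" if "a \<in> model_interval b" for a
    proof (cases "a = \<beta>")
      case True
      then show ?thesis using e(1) by simp
    next
      case False
      then have "a \<in> I" using that by (auto simp: I_def radial_interval_def model_interval_def \<beta>(1))
      then show ?thesis by (rule h)
    qed
    ultimately show thesis using that(1)[OF d(1)] \<beta>(1) by blast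
  next
    case 2
    define d where "d = sqrt \<kappa>"
    have d: "0 < d" "\<kappa> = d\<^sup>2" using 2 by (simp_all add: d_def)
    have h: "H 0 a = (1 / d) * sinh (d * a)" if "a \<in> I" for a
      by (rule linear_ode_sinh[OF conv I0 d(1) H00 H10 D0 _ that]) (use \<kappa> d(2) in simp_all)
    have "b = \<infinity>"
    proof (rule ccontr)
      assume "b \<noteq> \<infinity>"
      then obtain \<beta> where \<beta>: "b = ereal \<beta>" using b_cases by blast
      have "continuous_on UNIV (\<lambda>a. (1 / d) * sinh (d * a))" by (intro continuous_intros)
      from endpoint[OF h this \<beta>] have "H 0 \<beta> = (1 / d) * sinh (d * \<beta>)" "H 0 \<beta> = 0" "0 < \<beta>"
        by blast+
      moreover from this have "0 < sinh (d * \<beta>)" using d(1) by simp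
      ultimately show False using d(1) by simp
    qed
    then show thesis using that(2)[OF d(1)] h M_inf by blast
  next
    case 3
    have h: "H 0 a = a" if "a \<in> I" for a
      by (rule linear_ode_identity[OF conv I0 H00 H10 D0 _ that]) (use \<kappa> 3 in simp_all)
    have "b = \<infinity>"
    proof (rule ccontr)
      assume "b \<noteq> \<infinity>"
      then obtain \<beta> where \<beta>: "b = ereal \<beta>" using b_cases by blast
      from endpoint[OF h continuous_on_id \<beta>] have "H 0 \<beta> = \<beta>" "H 0 \<beta> = 0" "0 < \<beta>"
        by blast+
      then show False by simp
    qed
    then show thesis using that(3) h M_inf by blast
  qed
qed

theorem theorem4p1:
  fixes b R :: ereal and h \<alpha> :: "real \<Rightarrow> real" and \<phi> :: "real^4 \<Rightarrow> real^4"
  assumes "model b h"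
    and "rotationally_symmetric R b \<alpha>"
    and "\<phi> = rot_map \<alpha>"
    and "diffeomorphism (geodesic_ball R) (\<phi> ` geodesic_ball R) \<phi>"
    and "conformal (geodesic_ball R) flat_metric (geodesic_ball b) (model_metric h) \<phi>"
    and maximal: "\<not> (\<exists>R' \<beta>. R < R' \<and> rotationally_symmetric R' b \<beta> \<and>
           (\<forall>r. 0 \<le> r \<and> ereal r < R \<longrightarrow> \<beta> r = \<alpha> r) \<and>
           conformal (geodesic_ball R') flat_metric (geodesic_ball b) (model_metric h)
             (rot_map \<beta> :: real^4 \<Rightarrow> real^4))"
    and "proper_biharmonic (geodesic_ball R) flat_metric (geodesic_ball b) (model_metric h) \<phi>"
  shows "\<exists>c d :: real. c > 0 \<and> d > 0 \<and>
     ((b = ereal (pi / d) \<and> (\<forall>a\<in>model_interval b. h a = (1 / d) * sin (d * a)) \<and>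
       R = \<infinity> \<and> (\<forall>r\<ge>0. \<alpha> r = (2 / d) * arctan (c\<^sup>2 * r)) \<and>
       diffeomorphism UNIV (geodesic_ball (ereal (pi / d))) \<phi>)
      \<or>
      (b = \<infinity> \<and> (\<forall>a\<in>model_interval b. h a = (1 / d) * sinh (d * a)) \<and>
       R = ereal (1 / c\<^sup>2) \<and>
       (\<forall>r. 0 \<le> r \<and> r < 1 / c\<^sup>2 \<longrightarrow> \<alpha> r = (2 / d) * artanh (c\<^sup>2 * r)) \<and>
       diffeomorphism (ball 0 (1 / c\<^sup>2)) UNIV \<phi>))"
proof -
  note model = assms(1) and rot = assms(2) and \<phi> = assms(3)
  have conf: "conformal (geodesic_ball R) flat_metric (geodesic_ball b) (model_metric h)
      (rot_map \<alpha> :: real^4 \<Rightarrow> real^4)"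
    using assms(5) unfolding \<phi> .
  have card: "2 \<le> CARD(4)" by simp
  note less = profile_ode(1)[OF model rot conf card] and ode = profile_ode(2)[OF model rot conf card]
  note onto = maximal_profile_onto[OF model rot conf card maximal]
  have \<alpha>0: "\<alpha> 0 = 0" and R0: "0 < R" using rot unfolding rotationally_symmetric_def by blast+
  have pos: "0 < \<alpha> r" if "0 < r" "ereal r < R" for r
    using rot that unfolding rotationally_symmetric_def by blast
  have b0: "0 < b" using model unfolding model_def by blast
  obtain H where H0: "H 0 = h"
    and H: "\<And>n a. a \<in> model_interval b \<Longrightarrow> (H n has_real_derivative H (Suc n) a) (at a within model_interval b)"
    and Hi: "\<And>n a. 0 < a \<Longrightarrow> ereal a < b \<Longrightarrow> (H n has_real_derivative H (Suc n) a) (at a)"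
    using model_derivatives[OF model] by metis
  have hpos: "0 < h a" if "0 < a" "ereal a < b" for a
    using model that unfolding model_def by blast
  have range: "0 < \<alpha> r \<and> ereal (\<alpha> r) < b" if "0 < r" "ereal r < R" for r
    using pos[OF that] less[of r] that by simp
  have bih: "biharmonic (geodesic_ball R) flat_metric (geodesic_ball b) (model_metric (H 0))
      (rot_map \<alpha> :: real^4 \<Rightarrow> real^4)"
    and not_harm: "\<not> harmonic (geodesic_ball R) flat_metric (geodesic_ball b) (model_metric h)
      (rot_map \<alpha> :: real^4 \<Rightarrow> real^4)"
    using assms(7) unfolding \<phi> proper_biharmonic_def H0 by blast+
  have third_order: "H 0 a * (3 * H 1 a * H 2 a + H 0 a * H 3 a) = 2 * H 1 a * ((H 1 a)\<^sup>2 + H 0 a * H 2 a - 1)"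
    if a: "0 < a" "ereal a < b" for a
  proof -
    obtain r where r: "0 \<le> r" "ereal r < R" "\<alpha> r = a" using onto[of a] a by auto
    then have "0 < r" using a(1) \<alpha>0 by (cases "r = 0") auto
    from biharmonic_profile_third_order_ode[OF Hi hpos[folded H0] b0 \<alpha>0 range ode[folded H0] bih this r(2)]
    show ?thesis unfolding r(3) .
  qed
  have modelH: "model b (H 0)" using model unfolding H0 .
  have into: "rot_map \<alpha> ` (geodesic_ball R :: (real^4) set) \<subseteq> geodesic_ball b"
    using conf unfolding conformal_def by (rule conjunct1)
  have image: "\<phi> ` geodesic_ball R = geodesic_ball b"
    unfolding \<phi> by (rule rot_map_onto[OF into onto R0 \<alpha>0])
  have diffeo: "diffeomorphism (geodesic_ball R) (geodesic_ball b) \<phi>"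
    using assms(4) unfolding image .
  have R_cases: "R = \<infinity> \<or> (\<exists>\<rho>. R = ereal \<rho> \<and> 0 < \<rho>)" using R0 by (cases R) auto
  obtain r0 where r0: "0 < r0" "ereal r0 < R"
    using ereal_dense2[OF R0] by (auto simp: zero_ereal_def)
  have ball_inf: "(geodesic_ball \<infinity> :: (real^4) set) = UNIV" by (auto simp: geodesic_ball_def)
  show ?thesis
  proof (rule warping_function_cases[OF modelH H third_order])
    fix d assume sphere: "0 < d" "b = ereal (pi / d)"
      "\<And>a. a \<in> model_interval b \<Longrightarrow> H 0 a = (1 / d) * sin (d * a)"
    have M: "a \<in> model_interval b" if "0 < a" "ereal a < b" for a
      using that by (simp add: model_interval_def less_imp_le)
    have "\<exists>k. \<forall>r. 0 < r \<and> ereal r < R \<longrightarrow> 0 < k \<and> \<alpha> r = (2 / d) * arctan (k * r)"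
    proof (rule spherical_profile[OF sphere(1) ode])
      fix r assume r: "0 < r" "ereal r < R"
      show "0 < \<alpha> r \<and> \<alpha> r < pi / d" using range[OF r] by (simp add: sphere(2))
      show "h (\<alpha> r) = (1 / d) * sin (d * \<alpha> r)"
        using sphere(3)[OF M] range[OF r] unfolding H0 by blast
    qed
    then obtain k where k: "\<And>r. 0 < r \<Longrightarrow> ereal r < R \<Longrightarrow> 0 < k \<and> \<alpha> r = (2 / d) * arctan (k * r)" by blast
    have k0: "0 < k" using k[OF r0] by simp
    \<comment> \<open>On a finite interval the profile would miss the value \<open>(2/d) arctan (k \<rho>)\<close>.\<close>
    have Rinf: "R = \<infinity>"
    proof (rule ccontr)
      assume "R \<noteq> \<infinity>"
      then obtain \<rho> where \<rho>: "R = ereal \<rho>" "0 < \<rho>" using R_cases by blast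
      define a where "a = (2 / d) * arctan (k * \<rho>)"
      have a0: "0 < a" using k0 \<rho>(2) sphere(1) by (simp add: a_def)
      have "2 * arctan (k * \<rho>) < pi" using arctan_ubound[of "k * \<rho>"] by simp
      then have "ereal a < b" using sphere(1) by (simp add: sphere(2) a_def divide_strict_right_mono)
      then obtain r where r: "0 \<le> r" "ereal r < R" "\<alpha> r = a" using onto[of a] a0 by auto
      have "0 < r" using r a0 \<alpha>0 by (cases "r = 0") auto
      then have "arctan (k * r) = arctan (k * \<rho>)"
        using k[of r] r sphere(1) by (simp add: a_def)
      then have "r = \<rho>" using k0 by (simp add: arctan_eq_iff)
      then show False using r(2) \<rho>(1) by simp
    qed
    have ksq: "(sqrt k)\<^sup>2 = k" using k0 by simp
    have "\<alpha> r = (2 / d) * arctan ((sqrt k)\<^sup>2 * r)" if "0 \<le> r" for r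
      using k[of r] that \<alpha>0 unfolding ksq Rinf by (cases "r = 0") simp_all
    moreover have "diffeomorphism UNIV (geodesic_ball (ereal (pi / d))) \<phi>"
      using diffeo unfolding Rinf ball_inf sphere(2) .
    moreover have "\<forall>a\<in>model_interval b. h a = (1 / d) * sin (d * a)"
      using sphere(3) unfolding H0 by blast
    moreover have "0 < sqrt k" using k0 by simp
    ultimately show ?thesis using sphere(1,2) Rinf by blast
  next
    fix d assume hyperbolic: "0 < d" "b = \<infinity>"
      "\<And>a. a \<in> model_interval b \<Longrightarrow> H 0 a = (1 / d) * sinh (d * a)"
    have M: "a \<in> model_interval b" if "0 < a" for a
      using that by (simp add: model_interval_def hyperbolic(2))
    have "\<exists>k. \<forall>r. 0 < r \<and> ereal r < R \<longrightarrow> 0 < k \<and> k * r < 1 \<and> \<alpha> r = (2 / d) * artanh (k * r)"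
    proof (rule hyperbolic_profile[OF hyperbolic(1) ode pos])
      show "h (\<alpha> r) = (1 / d) * sinh (d * \<alpha> r)" if "0 < r" "ereal r < R" for r
        using hyperbolic(3)[OF M[OF pos[OF that]]] unfolding H0 .
    qed
    then obtain k where k: "\<And>r. 0 < r \<Longrightarrow> ereal r < R \<Longrightarrow> 0 < k \<and> k * r < 1 \<and> \<alpha> r = (2 / d) * artanh (k * r)" by blast
    have k0: "0 < k" using k[OF r0] by simp
    \<comment> \<open>\<open>R\<close> is at most \<open>1/k\<close>, where the hyperbolic tangent would reach 1; on a shorter interval the
      profile would miss the value \<open>(2/d) artanh (k \<rho>)\<close>.\<close>
    have "\<not> ereal (1 / k) < R" using k[of "1 / k"] k0 by auto
    then obtain \<rho> where \<rho>: "R = ereal \<rho>" "0 < \<rho>" "\<rho> \<le> 1 / k" using R_cases by auto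
    have "\<rho> = 1 / k"
    proof (rule ccontr)
      assume "\<rho> \<noteq> 1 / k"
      then have k\<rho>: "k * \<rho> < 1" "0 < k * \<rho>" using \<rho> k0 by (simp_all add: less_le field_simps)
      define a where "a = (2 / d) * artanh (k * \<rho>)"
      have "0 < artanh (k * \<rho>)" using k\<rho> by (simp add: artanh_def field_simps)
      then have a0: "0 < a" using hyperbolic(1) by (simp add: a_def)
      then obtain r where r: "0 \<le> r" "ereal r < R" "\<alpha> r = a" using onto[of a] by (auto simp: hyperbolic(2))
      have "0 < r" using r a0 \<alpha>0 by (cases "r = 0") auto
      then have kr: "k * r < 1" "artanh (k * r) = artanh (k * \<rho>)"
        using k[of r] r hyperbolic(1) by (simp_all add: a_def)
      have "0 \<le> k * r" by (rule mult_nonneg_nonneg) (use k0 r(1) in simp_all)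
      then have bounds: "0 < 1 + k * r" "0 < 1 - k * r" "0 < 1 + k * \<rho>" "0 < 1 - k * \<rho>"
        using kr(1) k\<rho> by linarith+
      then have "(1 + k * r) / (1 - k * r) = (1 + k * \<rho>) / (1 - k * \<rho>)"
        using kr(2) by (simp add: artanh_def)
      then have "k * r = k * \<rho>" using bounds by (simp add: field_simps)
      then have "r = \<rho>" using k0 by simp
      then show False using r(2) \<rho>(1) by simp
    qed
    then have R: "R = ereal (1 / k)" using \<rho>(1) by simp
    have ksq: "(sqrt k)\<^sup>2 = k" using k0 by simp
    have "\<alpha> r = (2 / d) * artanh ((sqrt k)\<^sup>2 * r)" if "0 \<le> r" "r < 1 / (sqrt k)\<^sup>2" for r
      using k[of r] that \<alpha>0 unfolding ksq R by (cases "r = 0") simp_all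
    moreover have "diffeomorphism (ball 0 (1 / (sqrt k)\<^sup>2)) UNIV \<phi>"
    proof -
      have "geodesic_ball R = (ball 0 (1 / k) :: (real^4) set)" by (auto simp: geodesic_ball_def R)
      then show ?thesis using diffeo unfolding ksq hyperbolic(2) ball_inf by simp
    qed
    moreover have "\<forall>a\<in>model_interval b. h a = (1 / d) * sinh (d * a)"
      using hyperbolic(3) unfolding H0 by blast
    moreover have "R = ereal (1 / (sqrt k)\<^sup>2)" using R unfolding ksq .
    moreover have "0 < sqrt k" using k0 by simp
    ultimately show ?thesis using hyperbolic(1,2) by blast
  next
    assume flat: "b = \<infinity>" "\<And>a. a \<in> model_interval b \<Longrightarrow> H 0 a = a"
    have hid: "h a = a" if "0 \<le> a" for a
      using flat(2)[of a] that by (simp add: model_interval_def flat(1) H0)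
    have metric: "model_metric h = (flat_metric :: 4 metric)"
    proof -
      have "model_metric h = (model_metric (\<lambda>r. r) :: 4 metric)"
        by (intro ext) (simp add: model_metric_def hid)
      then show ?thesis by (simp only: model_metric_flat)
    qed
    have "\<exists>k. \<forall>r. 0 < r \<and> ereal r < R \<longrightarrow> \<alpha> r = k * r"
      by (rule profile_first_integral[OF ode, where f="\<lambda>a. a" and f'="\<lambda>_. 1"])
        (simp_all add: hid less_imp_le[OF pos])
    then obtain k where k: "\<And>r. 0 < r \<Longrightarrow> ereal r < R \<Longrightarrow> \<alpha> r = k * r" by blast
    have lin: "rot_map \<alpha> x = k *\<^sub>R x" if "x \<in> geodesic_ball R" for x :: "real^4"
      using k[of "norm x"] that by (cases "x = 0") (simp_all add: rot_map_def geodesic_ball_def)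
    have "harmonic (geodesic_ball R) flat_metric (geodesic_ball b) (model_metric h)
      (rot_map \<alpha> :: real^4 \<Rightarrow> real^4)"
      unfolding harmonic_def metric
    proof (intro conjI ballI)
      show "smooth_on (geodesic_ball R) (rot_map \<alpha> :: real^4 \<Rightarrow> real^4)"
        using bih unfolding biharmonic_def by (rule conjunct1)
      show "rot_map \<alpha> ` (geodesic_ball R :: (real^4) set) \<subseteq> geodesic_ball b" by (rule into)
      show "tension flat_metric flat_metric (rot_map \<alpha>) x = 0" if "x \<in> geodesic_ball R" for x :: "real^4"
        by (rule harmonic_dilation[OF open_geodesic_ball lin that])
    qed
    then show ?thesis using not_harm by contradiction
  qed
qed

end
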